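(* Let $R$ be a commutative ring, $I\subset R$ a nilpotent ideal and $N\geqslant 1$ a natural number such that $I^N=0$. Suppose that the quotient map $R\to R/I$ admits a splitting by a ring homomorphism $R/I\to R$ and that $N!$ is invertible in $R$. Then for any natural number $n\geqslant 0$, the Bloch map $$\mathrm{B}\colon K^M_{n+1}(R,I)\longrightarrow \Omega^n_{R,I}/d\,\Omega^{n-1}_{R,I}$$ exists.
   Context: All rings are commutative, associative and unital; natural numbers include $0$. Milnor $K$-groups: $K^M_n(R):=(R^* )^{\otimes n}/\mathrm{St}_n(R)$ (tensor powers over $\mathbb Z$), where $\mathrm{St}_n(R)$ is the subgroup generated by all $r_1\otimes\cdots\otimes r_i\otimes r\otimes(1-r)\otimes r_{i+1}\otimes\cdots\otimes r_{n-2}$ with $0\leqslant i\leqslant n-2$ and $r_1,\ldots,r_{n-2},r,1-r\in R^*$. The class of $r_1\otimes\cdots\otimes r_n$ is denoted $\{r_1,\ldots,r_n\}$. For a nilpotent ideal $I\subset R$, $K^M_n(R,I):=\mathrm{Ker}(K^M_n(R)\to K^M_n(R/I))$. Differential forms: $\Omega^1_R$ is the $R$-module of absolute Kähler differentials (over $\mathbb Z$), $\Omega^n_R:=\bigwedge^n_R\Omega^1_R$ ($\Omega^0_R=R$, $\Omega^{-1}_R=0$), $d$ is the de Rham differential, and $\Omega^n_{R,I}:=\mathrm{Ker}(\Omega^n_R\to\Omega^n_{R/I})$. Bloch map: when $I^N=0$ and $(N-1)!$ is invertible in $R$, put $\log(1+x):=x-\frac{x^2}{2}+\cdots+(-1)^N\frac{x^{N-1}}{N-1}$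 for $x\in I$. A group homomorphism $\mathrm{B}\colon K^M_{n+1}(R,I)\to \Omega^n_{R,I}/d\,\Omega^{n-1}_{R,I}$ is called a Bloch map if for all $0\leqslant i\leqslant n$, $r_1,\ldots,r_n\in R^*$, $x\in I$, $\mathrm{B}\{r_1,\ldots,r_i,1+x,r_{i+1},\ldots,r_n\}$ is the class of $(-1)^i\log(1+x)\frac{dr_1}{r_1}\wedge\cdots\wedge\frac{dr_n}{r_n}$. *)

theory Defs
  imports "HOL-Algebra.Free_Abelian_Groups" "HOL-Algebra.QuotRing" "HOL-Algebra.Ideal_Product" "HOL-Algebra.Module"
begin

section \<open>Tensor powers of abelian groups and Milnor K-groups\<close>

definition tuples :: "'a set \<Rightarrow> nat \<Rightarrow> 'a list set" where
  "tuples A n = {xs. length xs = n \<and> set xs \<subseteq> A}"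

text \<open>The tensor power \<open>G \<otimes> \<dots> \<otimes> G\<close> over the integers of a (multiplicatively written)
  abelian group: free abelian group on \<open>n\<close>-tuples modulo multiadditivity.
  In particular it is infinite cyclic for \<open>n = 0\<close>.\<close>

definition tensor_relations :: "('a, 'm) monoid_scheme \<Rightarrow> nat \<Rightarrow> ('a list \<Rightarrow>\<^sub>0 int) set" where
  "tensor_relations G n = generate (free_Abelian_group (tuples (carrier G) n))
     {frag_of (xs @ (a \<otimes>\<^bsub>G\<^esub> b) # ys) - frag_of (xs @ a # ys) - frag_of (xs @ b # ys) | xs a b ys.
        length xs + length ys + 1 = n \<and> set xs \<subseteq> carrier G \<and> set ys \<subseteq> carrier G
        \<and> a \<in> carrier G \<and> b \<in> carrier G}"

definition tensor_power :: "('a, 'm) monoid_scheme \<Rightarrow> nat \<Rightarrow> ('a list \<Rightarrow>\<^sub>0 int) set monoid" where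
  "tensor_power G n = free_Abelian_group (tuples (carrier G) n) Mod tensor_relations G n"

definition pure_tensor :: "('a, 'm) monoid_scheme \<Rightarrow> 'a list \<Rightarrow> ('a list \<Rightarrow>\<^sub>0 int) set" where
  "pure_tensor G xs =
     tensor_relations G (length xs) #>\<^bsub>free_Abelian_group (tuples (carrier G) (length xs))\<^esub> frag_of xs"

definition steinberg :: "('a, 'm) ring_scheme \<Rightarrow> nat \<Rightarrow> ('a list \<Rightarrow>\<^sub>0 int) set set" where
  "steinberg R n = generate (tensor_power (units_of R) n)
     {pure_tensor (units_of R) (rs @ [r, \<one>\<^bsub>R\<^esub> \<ominus>\<^bsub>R\<^esub> r] @ ss) | rs r ss.
        length rs + length ss + 2 = n \<and> set rs \<subseteq> Units R \<and> set ss \<subseteq> Units R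
        \<and> r \<in> Units R \<and> \<one>\<^bsub>R\<^esub> \<ominus>\<^bsub>R\<^esub> r \<in> Units R}"

definition milnor_K :: "('a, 'm) ring_scheme \<Rightarrow> nat \<Rightarrow> ('a list \<Rightarrow>\<^sub>0 int) set set monoid" where
  "milnor_K R n = tensor_power (units_of R) n Mod steinberg R n"

definition milnor_symbol :: "('a, 'm) ring_scheme \<Rightarrow> 'a list \<Rightarrow> ('a list \<Rightarrow>\<^sub>0 int) set set" where
  "milnor_symbol R rs =
     steinberg R (length rs) #>\<^bsub>tensor_power (units_of R) (length rs)\<^esub> pure_tensor (units_of R) rs"

text \<open>The functorial map induced by a ring homomorphism \<open>f\<close>. Symbols generate \<^term>\<open>milnor_K R n\<close>,
  so it is the only homomorphism with the prescribed values; \<^const>\<open>extensional\<close> fixes the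
  irrelevant values outside the carrier. The same scheme is used for the maps on
  differential forms below.\<close>

definition milnor_K_map ::
  "('a, 'm) ring_scheme \<Rightarrow> ('b, 'k) ring_scheme \<Rightarrow> ('a \<Rightarrow> 'b) \<Rightarrow> nat \<Rightarrow>
     ('a list \<Rightarrow>\<^sub>0 int) set set \<Rightarrow> ('b list \<Rightarrow>\<^sub>0 int) set set" where
  "milnor_K_map R S f n = (THE \<phi>. \<phi> \<in> hom (milnor_K R n) (milnor_K S n)
      \<and> \<phi> \<in> extensional (carrier (milnor_K R n))
      \<and> (\<forall>rs \<in> tuples (Units R) n. \<phi> (milnor_symbol R rs) = milnor_symbol S (map f rs)))"

definition milnor_K_rel :: "('a, 'm) ring_scheme \<Rightarrow> 'a set \<Rightarrow> nat \<Rightarrow> ('a list \<Rightarrow>\<^sub>0 int) set set monoid" where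
  "milnor_K_rel R I n = (milnor_K R n)\<lparr>carrier :=
     kernel (milnor_K R n) (milnor_K (R Quot I) n) (milnor_K_map R (R Quot I) (\<lambda>a. I +>\<^bsub>R\<^esub> a) n)\<rparr>"


section \<open>Free modules, quotient modules and exterior powers\<close>

text \<open>The ring components \<^const>\<open>monoid.mult\<close> and \<^const>\<open>one\<close> of a module record carry no
  information and are left unspecified.\<close>

definition free_module :: "('a, 'm) ring_scheme \<Rightarrow> 's set \<Rightarrow> ('a, 's \<Rightarrow> 'a) module" where
  "free_module R S = \<lparr>carrier = {f. range f \<subseteq> carrier R \<and> finite {s. f s \<noteq> \<zero>\<^bsub>R\<^esub>} \<and> {s. f s \<noteq> \<zero>\<^bsub>R\<^esub>} \<subseteq> S},
     monoid.mult = undefined, one = undefined, zero = (\<lambda>s. \<zero>\<^bsub>R\<^esub>), add = (\<lambda>f g s. f s \<oplus>\<^bsub>R\<^esub> g s),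
     smult = (\<lambda>r f s. r \<otimes>\<^bsub>R\<^esub> f s)\<rparr>"

definition free_gen :: "('a, 'm) ring_scheme \<Rightarrow> 's \<Rightarrow> 's \<Rightarrow> 'a" where
  "free_gen R s = (\<lambda>t. if t = s then \<one>\<^bsub>R\<^esub> else \<zero>\<^bsub>R\<^esub>)"

definition module_span :: "('a, 'm) ring_scheme \<Rightarrow> ('a, 'b, 'k) module_scheme \<Rightarrow> 'b set \<Rightarrow> 'b set" where
  "module_span R M X = \<Inter>{H. submodule H R M \<and> X \<subseteq> H}"

definition quot_module :: "('a, 'b, 'k) module_scheme \<Rightarrow> 'b set \<Rightarrow> ('a, 'b set) module" where
  "quot_module M H = \<lparr>carrier = a_rcosets\<^bsub>M\<^esub> H, monoid.mult = undefined, one = undefined,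
     zero = H, add = set_add M, smult = (\<lambda>r X. \<Union>x\<in>X. H +>\<^bsub>M\<^esub> (r \<odot>\<^bsub>M\<^esub> x))\<rparr>"

text \<open>The exterior power is the free module on \<open>n\<close>-tuples modulo multilinearity and the vanishing
  of tuples with a repeated entry. For \<open>n = 0\<close> this is the free module on the empty tuple,
  i.e. the ring itself.\<close>

definition exterior_relations ::
  "('a, 'm) ring_scheme \<Rightarrow> ('a, 'b, 'k) module_scheme \<Rightarrow> nat \<Rightarrow> ('b list \<Rightarrow> 'a) set" where
  "exterior_relations R M n =
    (let F = free_module R (tuples (carrier M) n); \<delta> = free_gen R in module_span R F
      ({\<delta> (xs @ (a \<oplus>\<^bsub>M\<^esub> b) # ys) \<ominus>\<^bsub>F\<^esub> \<delta> (xs @ a # ys) \<ominus>\<^bsub>F\<^esub> \<delta> (xs @ b # ys) | xs a b ys.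
          length xs + length ys + 1 = n \<and> set xs \<subseteq> carrier M \<and> set ys \<subseteq> carrier M
          \<and> a \<in> carrier M \<and> b \<in> carrier M}
       \<union> {\<delta> (xs @ (r \<odot>\<^bsub>M\<^esub> a) # ys) \<ominus>\<^bsub>F\<^esub> r \<odot>\<^bsub>F\<^esub> \<delta> (xs @ a # ys) | xs r a ys.
          length xs + length ys + 1 = n \<and> set xs \<subseteq> carrier M \<and> set ys \<subseteq> carrier M
          \<and> r \<in> carrier R \<and> a \<in> carrier M}
       \<union> {\<delta> xs | xs. xs \<in> tuples (carrier M) n \<and> \<not> distinct xs}))"

definition exterior_power ::
  "('a, 'm) ring_scheme \<Rightarrow> ('a, 'b, 'k) module_scheme \<Rightarrow> nat \<Rightarrow> ('a, ('b list \<Rightarrow> 'a) set) module" where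
  "exterior_power R M n =
     quot_module (free_module R (tuples (carrier M) n)) (exterior_relations R M n)"

definition wedge :: "('a, 'm) ring_scheme \<Rightarrow> ('a, 'b, 'k) module_scheme \<Rightarrow> 'b list \<Rightarrow> ('b list \<Rightarrow> 'a) set" where
  "wedge R M xs = exterior_relations R M (length xs)
     +>\<^bsub>free_module R (tuples (carrier M) (length xs))\<^esub> free_gen R xs"


section \<open>Absolute differential forms\<close>

definition kahler_relations :: "('a, 'm) ring_scheme \<Rightarrow> ('a \<Rightarrow> 'a) set" where
  "kahler_relations R =
    (let F = free_module R (carrier R); \<delta> = free_gen R in module_span R F
      ({\<delta> (a \<oplus>\<^bsub>R\<^esub> b) \<ominus>\<^bsub>F\<^esub> \<delta> a \<ominus>\<^bsub>F\<^esub> \<delta> b | a b. a \<in> carrier R \<and> b \<in> carrier R}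
       \<union> {\<delta> (a \<otimes>\<^bsub>R\<^esub> b) \<ominus>\<^bsub>F\<^esub> a \<odot>\<^bsub>F\<^esub> \<delta> b \<ominus>\<^bsub>F\<^esub> b \<odot>\<^bsub>F\<^esub> \<delta> a | a b. a \<in> carrier R \<and> b \<in> carrier R}))"

definition kahler :: "('a, 'm) ring_scheme \<Rightarrow> ('a, ('a \<Rightarrow> 'a) set) module" where
  "kahler R = quot_module (free_module R (carrier R)) (kahler_relations R)"

definition kahler_d :: "('a, 'm) ring_scheme \<Rightarrow> 'a \<Rightarrow> ('a \<Rightarrow> 'a) set" where
  "kahler_d R a = kahler_relations R +>\<^bsub>free_module R (carrier R)\<^esub> free_gen R a"

type_synonym 'a form = "(('a \<Rightarrow> 'a) set list \<Rightarrow> 'a) set"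

definition forms :: "('a, 'm) ring_scheme \<Rightarrow> nat \<Rightarrow> ('a, 'a form) module" where
  "forms R n = exterior_power R (kahler R) n"

definition form_wedge :: "('a, 'm) ring_scheme \<Rightarrow> ('a \<Rightarrow> 'a) set list \<Rightarrow> 'a form" where
  "form_wedge R \<omega>s = wedge R (kahler R) \<omega>s"

text \<open>The de Rham differential is the unique additive map with
  \<open>d (a db\<^sub>1 \<and> \<dots> \<and> db\<^sub>n) = da \<and> db\<^sub>1 \<and> \<dots> \<and> db\<^sub>n\<close>; forms of this
  shape generate \<open>\<Omega>\<^sup>n\<close> as an abelian group.\<close>

definition de_rham :: "('a, 'm) ring_scheme \<Rightarrow> nat \<Rightarrow> 'a form \<Rightarrow> 'a form" where
  "de_rham R n = (THE \<phi>. \<phi> \<in> hom (add_monoid (forms R n)) (add_monoid (forms R (n + 1)))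
      \<and> \<phi> \<in> extensional (carrier (forms R n))
      \<and> (\<forall>a \<in> carrier R. \<forall>bs \<in> tuples (carrier R) n.
           \<phi> (a \<odot>\<^bsub>forms R n\<^esub> form_wedge R (map (kahler_d R) bs))
           = form_wedge R (map (kahler_d R) (a # bs))))"

definition forms_map ::
  "('a, 'm) ring_scheme \<Rightarrow> ('b, 'k) ring_scheme \<Rightarrow> ('a \<Rightarrow> 'b) \<Rightarrow> nat \<Rightarrow> 'a form \<Rightarrow> 'b form" where
  "forms_map R S f n = (THE \<phi>. \<phi> \<in> hom (add_monoid (forms R n)) (add_monoid (forms S n))
      \<and> \<phi> \<in> extensional (carrier (forms R n))
      \<and> (\<forall>a \<in> carrier R. \<forall>bs \<in> tuples (carrier R) n.
           \<phi> (a \<odot>\<^bsub>forms R n\<^esub> form_wedge R (map (kahler_d R) bs))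
           = f a \<odot>\<^bsub>forms S n\<^esub> form_wedge S (map (\<lambda>b. kahler_d S (f b)) bs)))"

definition forms_rel :: "('a, 'm) ring_scheme \<Rightarrow> 'a set \<Rightarrow> nat \<Rightarrow> 'a form set" where
  "forms_rel R I n =
     a_kernel (forms R n) (forms (R Quot I) n) (forms_map R (R Quot I) (\<lambda>a. I +>\<^bsub>R\<^esub> a) n)"

text \<open>The subgroup \<open>d \<Omega>\<^sup>n\<^sup>-\<^sup>1\<close> of relative forms, where \<open>\<Omega>\<^sup>n\<^sup>-\<^sup>1 = 0\<close> for \<open>n = 0\<close>.\<close>

definition exact_rel :: "('a, 'm) ring_scheme \<Rightarrow> 'a set \<Rightarrow> nat \<Rightarrow> 'a form set" where
  "exact_rel R I n = (case n of 0 \<Rightarrow> {\<zero>\<^bsub>forms R 0\<^esub>} | Suc m \<Rightarrow> de_rham R m ` forms_rel R I m)"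

definition forms_rel_group :: "('a, 'm) ring_scheme \<Rightarrow> 'a set \<Rightarrow> nat \<Rightarrow> 'a form monoid" where
  "forms_rel_group R I n =
     \<lparr>carrier = forms_rel R I n, monoid.mult = add (forms R n), one = \<zero>\<^bsub>forms R n\<^esub>\<rparr>"


section \<open>Bloch maps\<close>

definition nil_log :: "('a, 'm) ring_scheme \<Rightarrow> nat \<Rightarrow> 'a \<Rightarrow> 'a" where
  "nil_log R N x = (\<Oplus>\<^bsub>R\<^esub>k\<in>{1..<N}.
     (\<ominus>\<^bsub>R\<^esub> \<one>\<^bsub>R\<^esub>) [^]\<^bsub>R\<^esub> (k + 1) \<otimes>\<^bsub>R\<^esub> (inv\<^bsub>R\<^esub> (add_pow R k \<one>\<^bsub>R\<^esub>) \<otimes>\<^bsub>R\<^esub> x [^]\<^bsub>R\<^esub> k))"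

definition dlog :: "('a, 'm) ring_scheme \<Rightarrow> 'a \<Rightarrow> ('a \<Rightarrow> 'a) set" where
  "dlog R r = inv\<^bsub>R\<^esub> r \<odot>\<^bsub>kahler R\<^esub> kahler_d R r"

definition is_Bloch_map ::
  "('a, 'm) ring_scheme \<Rightarrow> 'a set \<Rightarrow> nat \<Rightarrow> nat \<Rightarrow>
     (('a list \<Rightarrow>\<^sub>0 int) set set \<Rightarrow> 'a form set) \<Rightarrow> bool" where
  "is_Bloch_map R I N n B \<longleftrightarrow>
     B \<in> hom (milnor_K_rel R I (n + 1)) (forms_rel_group R I n Mod exact_rel R I n)
     \<and> (\<forall>i \<le> n. \<forall>rs \<in> tuples (Units R) n. \<forall>x \<in> I.
          B (milnor_symbol R (take i rs @ (\<one>\<^bsub>R\<^esub> \<oplus>\<^bsub>R\<^esub> x) # drop i rs))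
          = exact_rel R I n #>\<^bsub>forms_rel_group R I n\<^esub>
              (((\<ominus>\<^bsub>R\<^esub> \<one>\<^bsub>R\<^esub>) [^]\<^bsub>R\<^esub> i \<otimes>\<^bsub>R\<^esub> nil_log R N x) \<odot>\<^bsub>forms R n\<^esub> form_wedge R (map (dlog R) rs)))"

end

theory Submission
  imports "HOL-Computational_Algebra.Polynomial" Defs
begin

text \<open>Let \<open>\<sigma>\<close> be the composite of the quotient map \<open>R \<rightarrow> R/I\<close> with its section: a ring endomorphism of
  \<open>R\<close> that kills \<open>I\<close> and satisfies \<open>r - \<sigma>(r) \<in> I\<close>. Every unit is \<open>r = \<sigma>(r)(1 + x)\<close> with \<open>x \<in> I\<close>, and
  \<open>\<lambda>(r) = log(1 + x)\<close> is a homomorphism from the units to the additive group of \<open>I\<close> with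
  \<open>d\<lambda>(r) = dr/r - d\<sigma>(r)/\<sigma>(r)\<close>. Peeling off the factors \<open>1 + x\<^sub>i\<close> from left to right shows that a Bloch
  map that is extended by zero on the symbols of \<open>\<sigma>(R)\<close> has to be, modulo exact forms,
  \<open>{r\<^sub>0, \<dots>, r\<^sub>n} \<mapsto> \<Sum>\<^sub>i (-1)\<^sup>i \<lambda>(r\<^sub>i) dlog \<sigma>(r\<^sub>0) \<and> \<dots> \<and> dlog \<sigma>(r\<^bsub>i-1\<^esub>) \<and> dlog r\<^bsub>i+1\<^esub> \<and> \<dots> \<and> dlog r\<^sub>n\<close>,
  and the proof takes this formula (\<open>bloch_sum\<close>) as the definition. It is multiplicative in every
  entry and its values have coefficients in \<open>I\<close>, so it is defined on the whole tensor power with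
  values in relative forms. It remains to work modulo exact relative forms.

  On a Steinberg symbol with entries \<open>r, 1 - r\<close> in neighbouring positions, all summands outside these
  two positions contain \<open>dlog r \<and> dlog (1 - r) = 0\<close> or \<open>dlog \<sigma>(r) \<and> dlog \<sigma>(1 - r) = 0\<close>. The two
  others combine to a wedge product of closed forms with
  \<open>\<lambda>(r) dlog(1 - r) - \<lambda>(1 - r) dlog \<sigma>(r)\<close>, and this 1-form is \<open>df\<close> for a truncated dilogarithm
  \<open>f \<in> I\<close> (\<open>steinberg_form_exact\<close>, \<open>bloch_sum_steinberg\<close>). The defining property of a Bloch map holds
  because integration by parts, \<open>\<lambda>(r) dL \<equiv> - L d\<lambda>(r)\<close> with \<open>L = log(1 + x)\<close>, turns each
  \<open>dlog \<sigma>(r)\<close> into \<open>dlog r\<close> (\<open>bloch_sum_one_plus\<close>).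

  The invertibility of \<open>N\<close>, and not only of \<open>(N - 1)!\<close>, enters through \<open>N x\<^bsup>N-1\<^esup> dx = d(x\<^sup>N) = 0\<close>:
  without \<open>x\<^bsup>N-1\<^esup> dx = 0\<close> the truncated logarithm would not satisfy \<open>d log(1 + x) = dx/(1 + x)\<close>.
  Additivity of the truncated logarithm is an identity of integer polynomials modulo terms of
  degree at least \<open>N\<close>; it is proved by differentiating and then evaluated in \<open>R\<close>.

  Forms are given by generators and relations, and the de Rham differential and the functorial maps
  are characterised by their values on \<open>a db\<^sub>1 \<and> \<dots> \<and> db\<^sub>n\<close>. Their existence follows from the
  universal property that additive maps out of \<open>\<Omega>\<^sup>n\<close> correspond to alternating maps of
  \<open>(a, b\<^sub>1, \<dots>, b\<^sub>n)\<close> that are derivations in each \<open>b\<^sub>i\<close> (\<open>forms_universal\<close>).\<close>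

section \<open>Modules given by generators and relations\<close>

lemma (in module) submodule_abelian_subgroup:
  assumes "submodule H R M"
  shows "abelian_subgroup H M"
  using assms M.abelian_group_axioms
  by (intro abelian_subgroupI3 additive_subgroup.intro) (auto simp: submodule_def)

lemma quot_module_simps [simp]:
  "carrier (quot_module M H) = a_rcosets\<^bsub>M\<^esub> H"
  "zero (quot_module M H) = H"
  "add (quot_module M H) = set_add M"
  by (auto simp: quot_module_def)

lemma hom_quot_module: "hom (add_monoid (quot_module M H)) G = hom (add_monoid M Mod H) G"
  by (simp add: hom_def quot_module_def FactGroup_def A_RCOSETS_def set_add_def)

lemma (in module) quot_module_smult:
  assumes H: "submodule H R M" and r: "r \<in> carrier R" and x: "x \<in> carrier M"
  shows "r \<odot>\<^bsub>quot_module M H\<^esub> (H +>\<^bsub>M\<^esub> x) = H +>\<^bsub>M\<^esub> (r \<odot>\<^bsub>M\<^esub> x)"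
proof -
  interpret H: abelian_subgroup H M by (rule submodule_abelian_subgroup[OF H])
  have "H +>\<^bsub>M\<^esub> (r \<odot>\<^bsub>M\<^esub> y) = H +>\<^bsub>M\<^esub> (r \<odot>\<^bsub>M\<^esub> x)" if y: "y \<in> H +>\<^bsub>M\<^esub> x" for y
  proof -
    obtain h where h: "h \<in> H" "y = h \<oplus>\<^bsub>M\<^esub> x"
      using y unfolding a_r_coset_def' by auto
    have hM: "h \<in> carrier M" using h by simp
    have rh: "r \<odot>\<^bsub>M\<^esub> h \<in> H" using submodule.smult_closed[OF H r] h by simp
    have "r \<odot>\<^bsub>M\<^esub> y = r \<odot>\<^bsub>M\<^esub> h \<oplus>\<^bsub>M\<^esub> r \<odot>\<^bsub>M\<^esub> x"
      using h r x hM by (simp add: smult_r_distr)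
    then have "r \<odot>\<^bsub>M\<^esub> y \<in> H +>\<^bsub>M\<^esub> (r \<odot>\<^bsub>M\<^esub> x)"
      using rh unfolding a_r_coset_def' by auto
    then show ?thesis
      using H.a_repr_independence'[of "r \<odot>\<^bsub>M\<^esub> y" "r \<odot>\<^bsub>M\<^esub> x"] r x by simp
  qed
  then have "(\<Union>y\<in>H +>\<^bsub>M\<^esub> x. H +>\<^bsub>M\<^esub> (r \<odot>\<^bsub>M\<^esub> y)) = (\<Union>y\<in>H +>\<^bsub>M\<^esub> x. H +>\<^bsub>M\<^esub> (r \<odot>\<^bsub>M\<^esub> x))"
    by (rule SUP_cong[OF refl])
  also have "\<dots> = H +>\<^bsub>M\<^esub> (r \<odot>\<^bsub>M\<^esub> x)" using H.a_rcos_self[OF x] by blast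
  finally show ?thesis by (simp add: quot_module_def)
qed

lemma (in module) quot_module_is_module:
  assumes H: "submodule H R M"
  shows "module R (quot_module M H)"
proof -
  interpret H: abelian_subgroup H M by (rule submodule_abelian_subgroup[OF H])
  have el: "\<exists>x\<in>carrier M. X = H +>\<^bsub>M\<^esub> x" if "X \<in> a_rcosets\<^bsub>M\<^esub> H" for X
    using that unfolding A_RCOSETS_def' by auto
  have cl: "H +>\<^bsub>M\<^esub> x \<in> a_rcosets\<^bsub>M\<^esub> H" if "x \<in> carrier M" for x
    using that unfolding A_RCOSETS_def' by auto
  note sm = quot_module_smult[OF H]
  show ?thesis
  proof (rule moduleI)
    show "cring R" by (rule R.is_cring)
    have H: "H = H +>\<^bsub>M\<^esub> \<zero>\<^bsub>M\<^esub>" using H.a_rcos_const[OF H.zero_closed] by simp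
    have inv: "\<exists>Y\<in>a_rcosets\<^bsub>M\<^esub> H. Y <+>\<^bsub>M\<^esub> (H +>\<^bsub>M\<^esub> x) = H" if "x \<in> carrier M" for x
      using that
      by (intro bexI[of _ "H +>\<^bsub>M\<^esub> (\<ominus>\<^bsub>M\<^esub> x)"]) (simp_all add: H.a_rcos_sum M.l_neg cl H[symmetric])
    show "abelian_group (quot_module M H)"
      by (rule abelian_groupI)
        (auto dest!: el intro!: cl inv simp: H.a_rcos_sum M.a_assoc M.a_comm M.a_lcomm H[symmetric] H.rcosets_add_eq
          intro: H.a_subgroup_in_rcosets)
  qed (auto dest!: el intro!: cl simp: sm H.a_rcos_sum smult_l_distr smult_r_distr smult_assoc1)
qed

lemma (in module) quot_module_universal:
  assumes H: "submodule H R M" and G: "abelian_group G"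
    and h: "h \<in> hom (add_monoid M) (add_monoid G)"
    and van: "\<And>x. x \<in> H \<Longrightarrow> h x = \<zero>\<^bsub>G\<^esub>"
  obtains g where "g \<in> hom (add_monoid (quot_module M H)) (add_monoid G)"
    "\<And>x. x \<in> carrier M \<Longrightarrow> g (H +>\<^bsub>M\<^esub> x) = h x"
proof -
  interpret H: abelian_subgroup H M by (rule submodule_abelian_subgroup[OF H])
  interpret G: abelian_group G by (rule G)
  have wd0: "h x = h y" if xy: "x \<in> carrier M" "y \<in> carrier M" "H +>\<^bsub>M\<^esub> x = H +>\<^bsub>M\<^esub> y" for x y
  proof -
    have "x \<in> H +>\<^bsub>M\<^esub> y" using H.a_rcos_self[OF xy(1)] xy by simp
    then obtain u where u: "u \<in> H" "x = u \<oplus>\<^bsub>M\<^esub> y" unfolding a_r_coset_def' by auto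
    have uM: "u \<in> carrier M" using u by simp
    have hy: "h y \<in> carrier G" using h xy(2) by (simp add: hom_def Pi_iff)
    have "h (u \<oplus>\<^bsub>M\<^esub> y) = h u \<oplus>\<^bsub>G\<^esub> h y"
      using h xy(2) uM by (simp add: hom_def)
    then show ?thesis using van[OF u(1)] u(2) hy by simp
  qed
  have wd: "h x = h y" if "x \<in> carrier (add_monoid M)" "y \<in> carrier (add_monoid M)"
      "H #>\<^bsub>add_monoid M\<^esub> x = H #>\<^bsub>add_monoid M\<^esub> y" for x y
    using wd0[of x y] that unfolding a_r_coset_def by simp
  obtain g where g: "g \<in> hom (add_monoid M Mod H) (add_monoid G)"
    "\<And>x. x \<in> carrier (add_monoid M) \<Longrightarrow> g (H #>\<^bsub>add_monoid M\<^esub> x) = h x"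
    by (rule FactGroup_universal[OF h H.a_normal], erule (2) wd, blast)
  show ?thesis
  proof (rule that)
    show "g \<in> hom (add_monoid (quot_module M H)) (add_monoid G)" using g(1) by (simp only: hom_quot_module)
    show "g (H +>\<^bsub>M\<^esub> x) = h x" if "x \<in> carrier M" for x
      using g(2) that by (simp add: a_r_coset_def)
  qed
qed

lemma free_module_simps [simp]:
  "zero (free_module R S) = (\<lambda>s. \<zero>\<^bsub>R\<^esub>)"
  "add (free_module R S) = (\<lambda>f g s. f s \<oplus>\<^bsub>R\<^esub> g s)"
  "smult (free_module R S) = (\<lambda>r f s. r \<otimes>\<^bsub>R\<^esub> f s)"
  by (auto simp: free_module_def)

lemma free_module_carrier_iff:
  "f \<in> carrier (free_module R S) \<longleftrightarrow>
     (\<forall>s. f s \<in> carrier R) \<and> finite {s. f s \<noteq> \<zero>\<^bsub>R\<^esub>} \<and> {s. f s \<noteq> \<zero>\<^bsub>R\<^esub>} \<subseteq> S"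
  by (auto simp: free_module_def)

context cring
begin

lemma free_module_is_module: "module R (free_module R S)"
proof (rule moduleI)
  show "cring R" by (rule is_cring)
  show "abelian_group (free_module R S)"
  proof (rule abelian_groupI)
    fix f g assume "f \<in> carrier (free_module R S)" "g \<in> carrier (free_module R S)"
    then have f: "\<And>s. f s \<in> carrier R" "\<And>s. g s \<in> carrier R" "{s. f s \<noteq> \<zero>} \<union> {s. g s \<noteq> \<zero>} \<subseteq> S"
      and fin: "finite ({s. f s \<noteq> \<zero>} \<union> {s. g s \<noteq> \<zero>})"
      by (auto simp: free_module_carrier_iff)
    have sub: "{s. f s \<oplus> g s \<noteq> \<zero>} \<subseteq> {s. f s \<noteq> \<zero>} \<union> {s. g s \<noteq> \<zero>}" by auto
    show "f \<oplus>\<^bsub>free_module R S\<^esub> g \<in> carrier (free_module R S)"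
      unfolding free_module_carrier_iff free_module_simps
      using f finite_subset[OF sub fin] sub by blast
  next
    fix f assume f: "f \<in> carrier (free_module R S)"
    have "(\<lambda>s. \<ominus> f s) \<in> carrier (free_module R S)"
      using f by (auto simp: free_module_carrier_iff elim: finite_subset[rotated])
    moreover have "(\<lambda>s. \<ominus> f s) \<oplus>\<^bsub>free_module R S\<^esub> f = \<zero>\<^bsub>free_module R S\<^esub>"
      using f by (auto simp: free_module_carrier_iff l_neg)
    ultimately show "\<exists>g\<in>carrier (free_module R S). g \<oplus>\<^bsub>free_module R S\<^esub> f = \<zero>\<^bsub>free_module R S\<^esub>"
      by blast
  qed (auto simp: free_module_carrier_iff a_assoc a_comm a_lcomm fun_eq_iff)
next
  fix r f assume "r \<in> carrier R" "f \<in> carrier (free_module R S)"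
  then show "r \<odot>\<^bsub>free_module R S\<^esub> f \<in> carrier (free_module R S)"
    by (auto simp: free_module_carrier_iff intro: finite_subset[of _ "{s. f s \<noteq> \<zero>}"])
qed (auto simp: free_module_carrier_iff l_distr r_distr m_assoc fun_eq_iff)

lemma free_gen_closed: "s \<in> S \<Longrightarrow> free_gen R s \<in> carrier (free_module R S)"
  by (auto simp: free_module_carrier_iff free_gen_def)

lemma free_module_induct [consumes 1, case_names zero gen add]:
  assumes "f \<in> carrier (free_module R S)"
    and zero: "P (\<lambda>s. \<zero>)"
    and gen: "\<And>r s. r \<in> carrier R \<Longrightarrow> s \<in> S \<Longrightarrow> P (r \<odot>\<^bsub>free_module R S\<^esub> free_gen R s)"
    and add: "\<And>f g. f \<in> carrier (free_module R S) \<Longrightarrow> g \<in> carrier (free_module R S) \<Longrightarrow>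
        P f \<Longrightarrow> P g \<Longrightarrow> P (f \<oplus>\<^bsub>free_module R S\<^esub> g)"
  shows "P f"
proof -
  interpret F: module R "free_module R S" by (rule free_module_is_module)
  have "f \<in> carrier (free_module R S) \<Longrightarrow> {s. f s \<noteq> \<zero>} \<subseteq> T \<Longrightarrow> P f" if "finite T" for T f
    using that
  proof (induction T arbitrary: f rule: finite_induct)
    case empty
    then have "f = (\<lambda>s. \<zero>)" by auto
    then show ?case using zero by simp
  next
    case (insert t T)
    show ?case
    proof (cases "t \<in> S")
      case True
      define g where "g = (\<lambda>s. if s = t then \<zero> else f s)"
      have g: "g \<in> carrier (free_module R S)"
        using insert.prems
        by (auto simp: free_module_carrier_iff g_def intro: finite_subset[of _ "{s. f s \<noteq> \<zero>}"])
      have "{s. g s \<noteq> \<zero>} \<subseteq> T" using insert.prems by (auto simp: g_def)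
      then have Pg: "P g" using insert.IH g by blast
      have ft: "f t \<in> carrier R" using insert.prems by (auto simp: free_module_carrier_iff)
      have "P (f t \<odot>\<^bsub>free_module R S\<^esub> free_gen R t)" using gen ft True by blast
      then have "P (g \<oplus>\<^bsub>free_module R S\<^esub> (f t \<odot>\<^bsub>free_module R S\<^esub> free_gen R t))"
        by (intro add g Pg F.smult_closed ft free_gen_closed True)
      moreover have "f = g \<oplus>\<^bsub>free_module R S\<^esub> (f t \<odot>\<^bsub>free_module R S\<^esub> free_gen R t)"
        using insert.prems ft by (auto simp: g_def free_gen_def fun_eq_iff free_module_carrier_iff)
      ultimately show ?thesis by simp
    next
      case False
      then have "{s. f s \<noteq> \<zero>} \<subseteq> T" using insert.prems by (auto simp: free_module_carrier_iff)
      then show ?thesis using insert.IH insert.prems by blast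
    qed
  qed
  then show ?thesis using assms(1) by (auto simp: free_module_carrier_iff)
qed

lemma free_module_universal:
  assumes G: "abelian_group G"
    and \<phi>: "\<And>s. s \<in> S \<Longrightarrow> \<phi> s \<in> hom (add_monoid R) (add_monoid G)"
  obtains h where "h \<in> hom (add_monoid (free_module R S)) (add_monoid G)"
    "\<And>r s. r \<in> carrier R \<Longrightarrow> s \<in> S \<Longrightarrow> h (r \<odot>\<^bsub>free_module R S\<^esub> free_gen R s) = \<phi> s r"
proof -
  interpret G: abelian_group G by (rule G)
  interpret F: module R "free_module R S" by (rule free_module_is_module)
  have cl: "\<phi> s r \<in> carrier G" if "s \<in> S" "r \<in> carrier R" for s r
    using \<phi>[OF that(1)] that(2) by (auto simp: hom_def)
  have ad: "\<phi> s (r \<oplus> t) = \<phi> s r \<oplus>\<^bsub>G\<^esub> \<phi> s t" if "s \<in> S" "r \<in> carrier R" "t \<in> carrier R" for s r t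
    using \<phi>[OF that(1)] that(2,3) by (auto simp: hom_def)
  have z: "\<phi> s \<zero> = \<zero>\<^bsub>G\<^esub>" if "s \<in> S" for s
    using ad[OF that, of \<zero> \<zero>] cl[OF that, of \<zero>] by simp
  define h where "h f = (\<Oplus>\<^bsub>G\<^esub>s\<in>{s. f s \<noteq> \<zero>}. \<phi> s (f s))" for f
  have h_sup: "h f = (\<Oplus>\<^bsub>G\<^esub>s\<in>T. \<phi> s (f s))"
    if f: "f \<in> carrier (free_module R S)" and T: "finite T" "T \<subseteq> S" "{s. f s \<noteq> \<zero>} \<subseteq> T" for f T
    unfolding h_def using f T
    by (intro G.add.finprod_mono_neutral_cong_left) (auto simp: z free_module_carrier_iff intro!: cl)
  have "h \<in> hom (add_monoid (free_module R S)) (add_monoid G)"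
  proof (rule homI)
    fix f assume "f \<in> carrier (add_monoid (free_module R S))"
    then show "h f \<in> carrier (add_monoid G)"
      by (auto simp: h_def free_module_carrier_iff intro!: G.finsum_closed cl)
  next
    fix f g assume "f \<in> carrier (add_monoid (free_module R S))"
      "g \<in> carrier (add_monoid (free_module R S))"
    then have f: "f \<in> carrier (free_module R S)" and g: "g \<in> carrier (free_module R S)" by auto
    let ?T = "{s. f s \<noteq> \<zero>} \<union> {s. g s \<noteq> \<zero>}"
    have T: "finite ?T" "?T \<subseteq> S" using f g by (auto simp: free_module_carrier_iff)
    have fg: "\<And>s. f s \<in> carrier R" "\<And>s. g s \<in> carrier R"
      using f g by (auto simp: free_module_carrier_iff)
    have "h (f \<oplus>\<^bsub>free_module R S\<^esub> g) = (\<Oplus>\<^bsub>G\<^esub>s\<in>?T. \<phi> s ((f \<oplus>\<^bsub>free_module R S\<^esub> g) s))"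
      by (intro h_sup F.M.a_closed f g T) auto
    also have "\<dots> = (\<Oplus>\<^bsub>G\<^esub>s\<in>?T. \<phi> s (f s) \<oplus>\<^bsub>G\<^esub> \<phi> s (g s))"
      using T by (intro G.finsum_cong') (auto intro!: cl ad fg)
    also have "\<dots> = (\<Oplus>\<^bsub>G\<^esub>s\<in>?T. \<phi> s (f s)) \<oplus>\<^bsub>G\<^esub> (\<Oplus>\<^bsub>G\<^esub>s\<in>?T. \<phi> s (g s))"
      using T by (intro G.finsum_addf) (auto intro!: cl fg)
    also have "\<dots> = h f \<oplus>\<^bsub>G\<^esub> h g"
      using h_sup[OF f T] h_sup[OF g T] by auto
    finally show "h (f \<otimes>\<^bsub>add_monoid (free_module R S)\<^esub> g) = h f \<otimes>\<^bsub>add_monoid G\<^esub> h g" by simp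
  qed
  moreover have "h (r \<odot>\<^bsub>free_module R S\<^esub> free_gen R s) = \<phi> s r" if r: "r \<in> carrier R" and s: "s \<in> S" for r s
  proof -
    have "h (r \<odot>\<^bsub>free_module R S\<^esub> free_gen R s)
        = (\<Oplus>\<^bsub>G\<^esub>t\<in>{s}. \<phi> t ((r \<odot>\<^bsub>free_module R S\<^esub> free_gen R s) t))"
      using r s by (intro h_sup F.smult_closed free_gen_closed) (auto simp: free_gen_def split: if_splits)
    also have "\<dots> = \<phi> s r" using r s cl by (simp add: free_gen_def)
    finally show ?thesis .
  qed
  ultimately show ?thesis by (rule that)
qed

end

lemma (in module) module_span_submodule:
  assumes "X \<subseteq> carrier M"
  shows "submodule (module_span R M X) R M"
proof (rule submoduleI)
  show "module_span R M X \<subseteq> carrier M"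
    using carrier_is_submodule assms unfolding module_span_def by blast
  show "\<zero>\<^bsub>M\<^esub> \<in> module_span R M X"
    unfolding module_span_def by (auto simp: submodule_def dest!: subgroup.one_closed)
qed (auto simp: module_span_def dest: submoduleE)

lemma module_span_incl: "X \<subseteq> module_span R M X"
  unfolding module_span_def by blast

lemma module_span_least: "submodule H R M \<Longrightarrow> X \<subseteq> H \<Longrightarrow> module_span R M X \<subseteq> H"
  unfolding module_span_def by blast

text \<open>The kernel of an additive map need not be a submodule, so the vanishing of \<open>h\<close> has to be tested
  on all multiples of the generators.\<close>

lemma (in module) hom_vanishes_on_module_span:
  assumes X: "X \<subseteq> carrier M" and h: "abelian_group_hom M G h"
    and van: "\<And>r x. r \<in> carrier R \<Longrightarrow> x \<in> X \<Longrightarrow> h (r \<odot>\<^bsub>M\<^esub> x) = \<zero>\<^bsub>G\<^esub>"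
    and x: "x \<in> module_span R M X"
  shows "h x = \<zero>\<^bsub>G\<^esub>"
proof -
  interpret h: abelian_group_hom M G h by (rule h)
  let ?H = "{x \<in> carrier M. \<forall>r \<in> carrier R. h (r \<odot>\<^bsub>M\<^esub> x) = \<zero>\<^bsub>G\<^esub>}"
  have "submodule ?H R M"
    by (rule submoduleI) (auto simp: smult_r_distr smult_r_minus smult_assoc1[symmetric])
  then have "module_span R M X \<subseteq> ?H"
    using X van by (intro module_span_least) auto
  then have "x \<in> carrier M" "h (\<one> \<odot>\<^bsub>M\<^esub> x) = \<zero>\<^bsub>G\<^esub>" using x by auto
  then show ?thesis by simp
qed

definition presented_module :: "('a, 'm) ring_scheme \<Rightarrow> 's set \<Rightarrow> ('s \<Rightarrow> 'a) set \<Rightarrow> ('a, ('s \<Rightarrow> 'a) set) module" where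
  "presented_module R S X = quot_module (free_module R S) (module_span R (free_module R S) X)"

definition presented_class :: "('a, 'm) ring_scheme \<Rightarrow> 's set \<Rightarrow> ('s \<Rightarrow> 'a) set \<Rightarrow> ('s \<Rightarrow> 'a) \<Rightarrow> ('s \<Rightarrow> 'a) set" where
  "presented_class R S X f = module_span R (free_module R S) X +>\<^bsub>free_module R S\<^esub> f"

lemma abelian_group_hom_of_hom:
  assumes "abelian_group M" "abelian_group G" "h \<in> hom (add_monoid M) (add_monoid G)"
  shows "abelian_group_hom M G h"
  using assms
  by (intro abelian_group_homI group_hom.intro group_hom_axioms.intro abelian_group.a_group)

(* From here on the free module is used through its module structure and not pointwise. *)
declare free_module_simps [simp del]

lemma (in abelian_group) diff_eq_zero_iff:
  assumes "x \<in> carrier G" "y \<in> carrier G"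
  shows "x \<ominus> y = \<zero> \<longleftrightarrow> x = y"
proof
  assume "x \<ominus> y = \<zero>"
  then have "(x \<oplus> \<ominus> y) \<oplus> y = \<zero> \<oplus> y" by (simp only: minus_eq)
  then show "x = y" using assms by (simp add: a_assoc l_neg)
qed (use assms in \<open>simp add: minus_eq r_neg\<close>)

text \<open>Kaehler differentials and exterior powers are both free modules modulo the span of explicit
  relations, so the passage from relations to induction and universal property is done only once.\<close>

locale presentation = cring R for R (structure) +
  fixes S :: "'s set" and X :: "('s \<Rightarrow> 'a) set"
  assumes relations_subset: "X \<subseteq> carrier (free_module R S)"
begin

abbreviation "F \<equiv> free_module R S"
abbreviation "Q \<equiv> presented_module R S X"
abbreviation "cl \<equiv> presented_class R S X"

sublocale F: module R F
  by (rule free_module_is_module)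

lemma span_submodule: "submodule (module_span R F X) R F"
  by (rule F.module_span_submodule[OF relations_subset])

sublocale Q: module R Q
  unfolding presented_module_def by (rule F.quot_module_is_module[OF span_submodule])

sublocale H: abelian_subgroup "module_span R F X" F
  by (rule F.submodule_abelian_subgroup[OF span_submodule])

lemma class_closed [simp]: "f \<in> carrier F \<Longrightarrow> cl f \<in> carrier Q"
  by (auto simp: presented_class_def presented_module_def A_RCOSETS_def')

lemma class_add: "f \<in> carrier F \<Longrightarrow> g \<in> carrier F \<Longrightarrow> cl (f \<oplus>\<^bsub>F\<^esub> g) = cl f \<oplus>\<^bsub>Q\<^esub> cl g"
  unfolding presented_class_def presented_module_def quot_module_simps
  by (subst H.a_rcos_sum) simp_all

lemma class_smult: "r \<in> carrier R \<Longrightarrow> f \<in> carrier F \<Longrightarrow> cl (r \<odot>\<^bsub>F\<^esub> f) = r \<odot>\<^bsub>Q\<^esub> cl f"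
  unfolding presented_class_def presented_module_def
  by (subst F.quot_module_smult[OF span_submodule]) simp_all

lemma class_of_relation: "f \<in> module_span R F X \<Longrightarrow> cl f = \<zero>\<^bsub>Q\<^esub>"
  unfolding presented_class_def presented_module_def quot_module_simps
  by (rule H.a_rcos_const)

lemma class_zero: "cl \<zero>\<^bsub>F\<^esub> = \<zero>\<^bsub>Q\<^esub>"
  by (rule class_of_relation[OF H.zero_closed])

lemma class_minus: "f \<in> carrier F \<Longrightarrow> cl (\<ominus>\<^bsub>F\<^esub> f) = \<ominus>\<^bsub>Q\<^esub> cl f"
  using class_smult[of "\<ominus> \<one>" f] F.smult_l_minus[of \<one> f] Q.smult_l_minus[of \<one> "cl f"]
  by simp

lemma class_diff: "f \<in> carrier F \<Longrightarrow> g \<in> carrier F \<Longrightarrow> cl (f \<ominus>\<^bsub>F\<^esub> g) = cl f \<ominus>\<^bsub>Q\<^esub> cl g"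
  unfolding a_minus_def by (simp only: class_add class_minus F.M.a_inv_closed)

lemma class_eq_add:
  assumes "x \<in> carrier F" "y \<in> carrier F" "z \<in> carrier F" "x \<ominus>\<^bsub>F\<^esub> y \<ominus>\<^bsub>F\<^esub> z \<in> X"
  shows "cl x = cl y \<oplus>\<^bsub>Q\<^esub> cl z"
proof -
  have "cl (x \<ominus>\<^bsub>F\<^esub> y \<ominus>\<^bsub>F\<^esub> z) = \<zero>\<^bsub>Q\<^esub>"
    by (intro class_of_relation subsetD[OF module_span_incl assms(4)])
  then have "cl x \<ominus>\<^bsub>Q\<^esub> cl y \<ominus>\<^bsub>Q\<^esub> cl z = \<zero>\<^bsub>Q\<^esub>"
    using assms(1-3) by (simp add: class_diff)
  then have z: "cl x \<ominus>\<^bsub>Q\<^esub> cl y = cl z"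
    using assms(1-3) Q.M.diff_eq_zero_iff[of "cl x \<ominus>\<^bsub>Q\<^esub> cl y" "cl z"] by simp
  have "cl y \<oplus>\<^bsub>Q\<^esub> (cl x \<oplus>\<^bsub>Q\<^esub> \<ominus>\<^bsub>Q\<^esub> cl y) = cl x"
    using assms(1-3) Q.M.a_lcomm[of "cl y" "cl x" "\<ominus>\<^bsub>Q\<^esub> cl y"] by (simp add: Q.M.r_neg)
  then show ?thesis unfolding z[symmetric] a_minus_def by simp
qed

lemma class_eq:
  assumes "x \<in> carrier F" "y \<in> carrier F" "x \<ominus>\<^bsub>F\<^esub> y \<in> X"
  shows "cl x = cl y"
proof -
  have "cl (x \<ominus>\<^bsub>F\<^esub> y) = \<zero>\<^bsub>Q\<^esub>"
    by (intro class_of_relation subsetD[OF module_span_incl assms(3)])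
  then show ?thesis
    using assms(1,2) Q.M.diff_eq_zero_iff by (simp add: class_diff)
qed

lemma hom_smult_diff:
  assumes h: "abelian_group_hom F G h" and "r \<in> carrier R" "x \<in> carrier F" "y \<in> carrier F"
  shows "h (r \<odot>\<^bsub>F\<^esub> (x \<ominus>\<^bsub>F\<^esub> y)) = h (r \<odot>\<^bsub>F\<^esub> x) \<ominus>\<^bsub>G\<^esub> h (r \<odot>\<^bsub>F\<^esub> y)"
proof -
  interpret h: abelian_group_hom F G h by (rule h)
  show ?thesis using assms(2-)
    by (simp add: a_minus_def F.smult_r_distr F.smult_r_minus)
qed

lemma presented_induct [consumes 1, case_names gen zero add]:
  assumes x: "x \<in> carrier Q"
    and gen: "\<And>r s. r \<in> carrier R \<Longrightarrow> s \<in> S \<Longrightarrow> P (r \<odot>\<^bsub>Q\<^esub> cl (free_gen R s))"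
    and zero: "P \<zero>\<^bsub>Q\<^esub>"
    and add: "\<And>x y. x \<in> carrier Q \<Longrightarrow> y \<in> carrier Q \<Longrightarrow> P x \<Longrightarrow> P y \<Longrightarrow> P (x \<oplus>\<^bsub>Q\<^esub> y)"
  shows "P x"
proof -
  obtain f where f: "f \<in> carrier F" "x = cl f"
    using x unfolding presented_module_def presented_class_def quot_module_simps A_RCOSETS_def' by auto
  from f(1) have "P (cl f)"
  proof (induction f rule: free_module_induct)
    case zero then show ?case using assms(3) class_zero by (simp add: free_module_simps)
  next
    case (gen r s) then show ?case using assms(2)[of r s] class_smult[of r "free_gen R s"] free_gen_closed[of s S]
      by simp
  next
    case (add f g) then show ?case using assms(4)[of "cl f" "cl g"] class_add[of f g]
      by simp
  qed
  then show ?thesis using f by simp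
qed

text \<open>The target is only a group, and the value at \<open>r\<close> times the generator \<open>s\<close> is \<open>\<phi> s r\<close>. This
  generality is needed for semilinear maps and for the de Rham differential, which is not linear.\<close>

lemma presented_universal:
  assumes G: "abelian_group G"
    and \<phi>: "\<And>s. s \<in> S \<Longrightarrow> \<phi> s \<in> hom (add_monoid R) (add_monoid G)"
    and van: "\<And>h r x. abelian_group_hom F G h \<Longrightarrow>
      (\<And>r s. r \<in> carrier R \<Longrightarrow> s \<in> S \<Longrightarrow> h (r \<odot>\<^bsub>F\<^esub> free_gen R s) = \<phi> s r) \<Longrightarrow>
      r \<in> carrier R \<Longrightarrow> x \<in> X \<Longrightarrow> h (r \<odot>\<^bsub>F\<^esub> x) = \<zero>\<^bsub>G\<^esub>"
  obtains g where "g \<in> hom (add_monoid Q) (add_monoid G)"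
    "\<And>r s. r \<in> carrier R \<Longrightarrow> s \<in> S \<Longrightarrow> g (r \<odot>\<^bsub>Q\<^esub> cl (free_gen R s)) = \<phi> s r"
proof -
  interpret G: abelian_group G by (rule G)
  obtain h where h: "h \<in> hom (add_monoid F) (add_monoid G)"
    and hgen: "\<And>r s. r \<in> carrier R \<Longrightarrow> s \<in> S \<Longrightarrow> h (r \<odot>\<^bsub>F\<^esub> free_gen R s) = \<phi> s r"
    by (rule free_module_universal[OF G, of S \<phi>], erule \<phi>, blast)
  have hh: "abelian_group_hom F G h"
    by (rule abelian_group_hom_of_hom[OF F.M.abelian_group_axioms G h])
  have hvan: "h (r \<odot>\<^bsub>F\<^esub> x) = \<zero>\<^bsub>G\<^esub>" if "r \<in> carrier R" "x \<in> X" for r x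
    by (rule van[OF hh _ that]) (rule hgen)
  have hz: "h x = \<zero>\<^bsub>G\<^esub>" if "x \<in> module_span R F X" for x
    by (rule F.hom_vanishes_on_module_span[OF relations_subset hh _ that]) (rule hvan)
  obtain g where g: "g \<in> hom (add_monoid Q) (add_monoid G)" "\<And>f. f \<in> carrier F \<Longrightarrow> g (cl f) = h f"
    unfolding presented_module_def presented_class_def
    by (rule F.quot_module_universal[OF span_submodule G h], erule hz, blast)
  have "g (r \<odot>\<^bsub>Q\<^esub> cl (free_gen R s)) = \<phi> s r" if "r \<in> carrier R" "s \<in> S" for r s
    using that g(2)[of "r \<odot>\<^bsub>F\<^esub> free_gen R s"] hgen[of r s] class_smult[of r "free_gen R s"]
      free_gen_closed[of s S] F.smult_closed[of r "free_gen R s"]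
    by simp
  then show ?thesis using g(1) that by blast
qed

end

lemma (in abelian_group) add_diff_diff_cancel:
  assumes "x \<in> carrier G" "y \<in> carrier G"
  shows "(x \<oplus> y) \<ominus> x \<ominus> y = \<zero>"
proof -
  have "(x \<oplus> y) \<ominus> x = y" using assms by (simp add: minus_eq a_comm[of x y] a_assoc r_neg)
  then show ?thesis using assms by (simp add: diff_eq_zero_iff)
qed

lemma (in cring) free_module_minus_closed:
  "x \<in> carrier (free_module R S) \<Longrightarrow> y \<in> carrier (free_module R S) \<Longrightarrow>
    x \<ominus>\<^bsub>free_module R S\<^esub> y \<in> carrier (free_module R S)"
  using free_module_is_module[of S] by (intro abelian_group.minus_closed) (auto simp: module_def)

lemma (in cring) free_module_smult_closed:
  "r \<in> carrier R \<Longrightarrow> x \<in> carrier (free_module R S) \<Longrightarrow>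
    r \<odot>\<^bsub>free_module R S\<^esub> x \<in> carrier (free_module R S)"
  by (rule module.smult_closed[OF free_module_is_module])

section \<open>Kaehler differentials and exterior powers\<close>

definition kahler_rels :: "('a, 'm) ring_scheme \<Rightarrow> ('a \<Rightarrow> 'a) set" where
  "kahler_rels R = (let F = free_module R (carrier R); \<delta> = free_gen R in
      {\<delta> (a \<oplus>\<^bsub>R\<^esub> b) \<ominus>\<^bsub>F\<^esub> \<delta> a \<ominus>\<^bsub>F\<^esub> \<delta> b | a b. a \<in> carrier R \<and> b \<in> carrier R}
       \<union> {\<delta> (a \<otimes>\<^bsub>R\<^esub> b) \<ominus>\<^bsub>F\<^esub> a \<odot>\<^bsub>F\<^esub> \<delta> b \<ominus>\<^bsub>F\<^esub> b \<odot>\<^bsub>F\<^esub> \<delta> a | a b. a \<in> carrier R \<and> b \<in> carrier R})"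

lemma kahler_eq_presented: "kahler R = presented_module R (carrier R) (kahler_rels R)"
  unfolding kahler_def kahler_relations_def kahler_rels_def presented_module_def Let_def ..

lemma kahler_d_eq_class: "kahler_d R a = presented_class R (carrier R) (kahler_rels R) (free_gen R a)"
  unfolding kahler_d_def kahler_relations_def kahler_rels_def presented_class_def Let_def ..

lemma (in cring) kahler_presentation: "presentation R (carrier R) (kahler_rels R)"
  by unfold_locales
    (auto simp: kahler_rels_def Let_def
      intro!: free_module_minus_closed free_module_smult_closed free_gen_closed)

context cring
begin

interpretation K: presentation R "carrier R" "kahler_rels R"
  by (rule kahler_presentation)

lemma kahler_module: "module R (kahler R)"
  unfolding kahler_eq_presented by (rule K.Q.module_axioms)

lemma kahler_d_closed [simp]: "a \<in> carrier R \<Longrightarrow> kahler_d R a \<in> carrier (kahler R)"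
  unfolding kahler_eq_presented kahler_d_eq_class by (intro K.class_closed free_gen_closed)

lemma kahler_d_add:
  assumes "a \<in> carrier R" "b \<in> carrier R"
  shows "kahler_d R (a \<oplus> b) = kahler_d R a \<oplus>\<^bsub>kahler R\<^esub> kahler_d R b"
  unfolding kahler_eq_presented kahler_d_eq_class
  using assms by (intro K.class_eq_add free_gen_closed) (auto simp: kahler_rels_def Let_def)

lemma kahler_d_mult:
  assumes "a \<in> carrier R" "b \<in> carrier R"
  shows "kahler_d R (a \<otimes> b) =
    a \<odot>\<^bsub>kahler R\<^esub> kahler_d R b \<oplus>\<^bsub>kahler R\<^esub> b \<odot>\<^bsub>kahler R\<^esub> kahler_d R a"
proof -
  have "K.cl (free_gen R (a \<otimes> b)) =
      K.cl (a \<odot>\<^bsub>K.F\<^esub> free_gen R b) \<oplus>\<^bsub>K.Q\<^esub> K.cl (b \<odot>\<^bsub>K.F\<^esub> free_gen R a)"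
    using assms by (intro K.class_eq_add K.F.smult_closed free_gen_closed) (auto simp: kahler_rels_def Let_def)
  then show ?thesis
    unfolding kahler_eq_presented kahler_d_eq_class
    using assms by (simp add: K.class_smult free_gen_closed)
qed

lemma kahler_induct [consumes 1, case_names gen zero add]:
  assumes x: "x \<in> carrier (kahler R)"
    and gen: "\<And>r b. r \<in> carrier R \<Longrightarrow> b \<in> carrier R \<Longrightarrow> P (r \<odot>\<^bsub>kahler R\<^esub> kahler_d R b)"
    and zero: "P \<zero>\<^bsub>kahler R\<^esub>"
    and add: "\<And>x y. x \<in> carrier (kahler R) \<Longrightarrow> y \<in> carrier (kahler R) \<Longrightarrow> P x \<Longrightarrow> P y \<Longrightarrow>
        P (x \<oplus>\<^bsub>kahler R\<^esub> y)"
  shows "P x"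
  using assms unfolding kahler_eq_presented kahler_d_eq_class by (rule K.presented_induct)

text \<open>\<open>\<phi> b r\<close> is the value at \<open>r db\<close>; the last assumption is the Leibniz rule for \<open>r d(ab)\<close>.\<close>

lemma kahler_universal:
  assumes G: "abelian_group G"
    and \<phi>: "\<And>b. b \<in> carrier R \<Longrightarrow> \<phi> b \<in> hom (add_monoid R) (add_monoid G)"
    and \<phi>_add: "\<And>a b r. a \<in> carrier R \<Longrightarrow> b \<in> carrier R \<Longrightarrow> r \<in> carrier R \<Longrightarrow>
      \<phi> (a \<oplus> b) r = \<phi> a r \<oplus>\<^bsub>G\<^esub> \<phi> b r"
    and \<phi>_mult: "\<And>a b r. a \<in> carrier R \<Longrightarrow> b \<in> carrier R \<Longrightarrow> r \<in> carrier R \<Longrightarrow>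
      \<phi> (a \<otimes> b) r = \<phi> b (r \<otimes> a) \<oplus>\<^bsub>G\<^esub> \<phi> a (r \<otimes> b)"
  obtains g where "g \<in> hom (add_monoid (kahler R)) (add_monoid G)"
    "\<And>r b. r \<in> carrier R \<Longrightarrow> b \<in> carrier R \<Longrightarrow> g (r \<odot>\<^bsub>kahler R\<^esub> kahler_d R b) = \<phi> b r"
proof -
  interpret G: abelian_group G by (rule G)
  have clo: "\<phi> b r \<in> carrier G" if "b \<in> carrier R" "r \<in> carrier R" for b r
    using \<phi>[OF that(1)] that(2) by (auto simp: hom_def)
  show ?thesis
  proof (rule K.presented_universal[OF G, of \<phi>])
    show "\<phi> s \<in> hom (add_monoid R) (add_monoid G)" if "s \<in> carrier R" for s by (rule \<phi>[OF that])
  next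
    fix h r x
    assume h: "abelian_group_hom K.F G h"
      and hg: "\<And>r s. r \<in> carrier R \<Longrightarrow> s \<in> carrier R \<Longrightarrow> h (r \<odot>\<^bsub>K.F\<^esub> free_gen R s) = \<phi> s r"
      and r: "r \<in> carrier R" and x: "x \<in> kahler_rels R"
    consider (add) a b where "a \<in> carrier R" "b \<in> carrier R"
        "x = free_gen R (a \<oplus> b) \<ominus>\<^bsub>K.F\<^esub> free_gen R a \<ominus>\<^bsub>K.F\<^esub> free_gen R b"
      | (mult) a b where "a \<in> carrier R" "b \<in> carrier R"
        "x = free_gen R (a \<otimes> b) \<ominus>\<^bsub>K.F\<^esub> a \<odot>\<^bsub>K.F\<^esub> free_gen R b \<ominus>\<^bsub>K.F\<^esub> b \<odot>\<^bsub>K.F\<^esub> free_gen R a"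
      using x unfolding kahler_rels_def Let_def by blast
    then show "h (r \<odot>\<^bsub>K.F\<^esub> x) = \<zero>\<^bsub>G\<^esub>"
    proof cases
      case add
      then show ?thesis using r
        by (simp add: K.hom_smult_diff[OF h] free_gen_closed hg \<phi>_add G.add_diff_diff_cancel clo)
    next
      case mult
      then show ?thesis using r
        by (simp add: K.hom_smult_diff[OF h] free_gen_closed hg \<phi>_mult G.add_diff_diff_cancel clo
            K.F.smult_assoc1[symmetric])
    qed
  next
    fix g
    assume "g \<in> hom (add_monoid K.Q) (add_monoid G)"
      "\<And>r s. r \<in> carrier R \<Longrightarrow> s \<in> carrier R \<Longrightarrow> g (r \<odot>\<^bsub>K.Q\<^esub> K.cl (free_gen R s)) = \<phi> s r"
    then show ?thesis
      using that unfolding kahler_eq_presented kahler_d_eq_class by blast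
  qed
qed

end

definition exterior_rels ::
  "('a, 'm) ring_scheme \<Rightarrow> ('a, 'b, 'k) module_scheme \<Rightarrow> nat \<Rightarrow> ('b list \<Rightarrow> 'a) set" where
  "exterior_rels R M n = (let F = free_module R (tuples (carrier M) n); \<delta> = free_gen R in
      {\<delta> (xs @ (a \<oplus>\<^bsub>M\<^esub> b) # ys) \<ominus>\<^bsub>F\<^esub> \<delta> (xs @ a # ys) \<ominus>\<^bsub>F\<^esub> \<delta> (xs @ b # ys) | xs a b ys.
          length xs + length ys + 1 = n \<and> set xs \<subseteq> carrier M \<and> set ys \<subseteq> carrier M
          \<and> a \<in> carrier M \<and> b \<in> carrier M}
       \<union> {\<delta> (xs @ (r \<odot>\<^bsub>M\<^esub> a) # ys) \<ominus>\<^bsub>F\<^esub> r \<odot>\<^bsub>F\<^esub> \<delta> (xs @ a # ys) | xs r a ys.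
          length xs + length ys + 1 = n \<and> set xs \<subseteq> carrier M \<and> set ys \<subseteq> carrier M
          \<and> r \<in> carrier R \<and> a \<in> carrier M}
       \<union> {\<delta> xs | xs. xs \<in> tuples (carrier M) n \<and> \<not> distinct xs})"

lemma exterior_power_eq_presented:
  "exterior_power R M n = presented_module R (tuples (carrier M) n) (exterior_rels R M n)"
  unfolding exterior_power_def exterior_relations_def exterior_rels_def presented_module_def Let_def ..

lemma wedge_eq_class:
  "length xs = n \<Longrightarrow> wedge R M xs = presented_class R (tuples (carrier M) n) (exterior_rels R M n) (free_gen R xs)"
  unfolding wedge_def exterior_relations_def exterior_rels_def presented_class_def Let_def by simp

lemma tuples_append [simp]: "xs @ ys \<in> tuples A n \<longleftrightarrow>
    set xs \<subseteq> A \<and> set ys \<subseteq> A \<and> length xs + length ys = n"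
  by (auto simp: tuples_def)

lemma (in module) exterior_presentation: "presentation R (tuples (carrier M) n) (exterior_rels R M n)"
  by unfold_locales
    (auto simp: exterior_rels_def Let_def
      intro!: R.free_module_minus_closed R.free_module_smult_closed R.free_gen_closed)

context module
begin

context
  fixes n :: nat
begin

interpretation E: presentation R "tuples (carrier M) n" "exterior_rels R M n"
  by (rule exterior_presentation)

lemma exterior_power_module: "module R (exterior_power R M n)"
  unfolding exterior_power_eq_presented by (rule E.Q.module_axioms)

lemma wedge_closed:
  assumes "xs \<in> tuples (carrier M) n"
  shows "wedge R M xs \<in> carrier (exterior_power R M n)"
proof -
  have "length xs = n" using assms by (simp add: tuples_def)
  then show ?thesis unfolding exterior_power_eq_presented wedge_eq_class[OF \<open>length xs = n\<close>]
    using assms by (intro E.class_closed R.free_gen_closed)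
qed

lemma wedge_add:
  assumes "length xs + length ys + 1 = n" "set xs \<subseteq> carrier M" "set ys \<subseteq> carrier M"
    "a \<in> carrier M" "b \<in> carrier M"
  shows "wedge R M (xs @ (a \<oplus>\<^bsub>M\<^esub> b) # ys) =
    wedge R M (xs @ a # ys) \<oplus>\<^bsub>exterior_power R M n\<^esub> wedge R M (xs @ b # ys)"
proof -
  have "E.cl (free_gen R (xs @ (a \<oplus>\<^bsub>M\<^esub> b) # ys)) =
      E.cl (free_gen R (xs @ a # ys)) \<oplus>\<^bsub>E.Q\<^esub> E.cl (free_gen R (xs @ b # ys))"
  proof (rule E.class_eq_add)
    show "free_gen R (xs @ (a \<oplus>\<^bsub>M\<^esub> b) # ys) \<ominus>\<^bsub>E.F\<^esub> free_gen R (xs @ a # ys) \<ominus>\<^bsub>E.F\<^esub> free_gen R (xs @ b # ys)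
        \<in> exterior_rels R M n"
      unfolding exterior_rels_def Let_def using assms by blast
  qed (use assms in \<open>auto intro!: R.free_gen_closed\<close>)
  then show ?thesis
    using assms(1) by (simp add: wedge_eq_class[where n = n] exterior_power_eq_presented)
qed

lemma wedge_smult:
  assumes "length xs + length ys + 1 = n" "set xs \<subseteq> carrier M" "set ys \<subseteq> carrier M"
    "r \<in> carrier R" "a \<in> carrier M"
  shows "wedge R M (xs @ (r \<odot>\<^bsub>M\<^esub> a) # ys) =
    r \<odot>\<^bsub>exterior_power R M n\<^esub> wedge R M (xs @ a # ys)"
proof -
  have gen: "free_gen R (xs @ a # ys) \<in> carrier E.F"
    using assms by (auto intro!: R.free_gen_closed)
  have "E.cl (free_gen R (xs @ (r \<odot>\<^bsub>M\<^esub> a) # ys)) = E.cl (r \<odot>\<^bsub>E.F\<^esub> free_gen R (xs @ a # ys))"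
  proof (rule E.class_eq)
    show "free_gen R (xs @ (r \<odot>\<^bsub>M\<^esub> a) # ys) \<ominus>\<^bsub>E.F\<^esub> r \<odot>\<^bsub>E.F\<^esub> free_gen R (xs @ a # ys)
        \<in> exterior_rels R M n"
      unfolding exterior_rels_def Let_def using assms by blast
  qed (use assms gen in \<open>auto intro!: R.free_gen_closed\<close>)
  then show ?thesis
    using assms gen by (simp add: wedge_eq_class[where n = n] exterior_power_eq_presented E.class_smult)
qed

lemma wedge_not_distinct:
  assumes "xs \<in> tuples (carrier M) n" "\<not> distinct xs"
  shows "wedge R M xs = \<zero>\<^bsub>exterior_power R M n\<^esub>"
proof -
  have "free_gen R xs \<in> exterior_rels R M n"
    unfolding exterior_rels_def Let_def using assms by blast
  then have "E.cl (free_gen R xs) = \<zero>\<^bsub>E.Q\<^esub>"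
    by (intro E.class_of_relation subsetD[OF module_span_incl])
  then show ?thesis
    using assms(1) by (simp add: wedge_eq_class[where n = n] exterior_power_eq_presented tuples_def)
qed

lemma exterior_power_induct [consumes 1, case_names gen zero add]:
  assumes x: "x \<in> carrier (exterior_power R M n)"
    and gen: "\<And>r xs. r \<in> carrier R \<Longrightarrow> xs \<in> tuples (carrier M) n \<Longrightarrow>
        P (r \<odot>\<^bsub>exterior_power R M n\<^esub> wedge R M xs)"
    and zero: "P \<zero>\<^bsub>exterior_power R M n\<^esub>"
    and add: "\<And>x y. x \<in> carrier (exterior_power R M n) \<Longrightarrow> y \<in> carrier (exterior_power R M n) \<Longrightarrow>
        P x \<Longrightarrow> P y \<Longrightarrow> P (x \<oplus>\<^bsub>exterior_power R M n\<^esub> y)"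
  shows "P x"
proof -
  have gen': "P (r \<odot>\<^bsub>E.Q\<^esub> E.cl (free_gen R xs))" if "r \<in> carrier R" "xs \<in> tuples (carrier M) n" for r xs
    using gen[OF that] that(2) by (simp add: wedge_eq_class[where n = n] exterior_power_eq_presented tuples_def)
  show ?thesis
    using x gen' zero add unfolding exterior_power_eq_presented by (rule E.presented_induct)
qed

text \<open>\<open>\<phi> xs r\<close> is the value at \<open>r (x\<^sub>1 \<and> \<dots> \<and> x\<^sub>n)\<close>; as the target has no scalar multiplication,
  homogeneity says that scalars can be moved from any entry into \<open>r\<close>.\<close>

lemma exterior_power_universal:
  assumes G: "abelian_group G"
    and \<phi>: "\<And>xs. xs \<in> tuples (carrier M) n \<Longrightarrow> \<phi> xs \<in> hom (add_monoid R) (add_monoid G)"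
    and \<phi>_add: "\<And>xs a b ys r. \<lbrakk>length xs + length ys + 1 = n; set xs \<subseteq> carrier M; set ys \<subseteq> carrier M;
        a \<in> carrier M; b \<in> carrier M; r \<in> carrier R\<rbrakk> \<Longrightarrow>
      \<phi> (xs @ (a \<oplus>\<^bsub>M\<^esub> b) # ys) r = \<phi> (xs @ a # ys) r \<oplus>\<^bsub>G\<^esub> \<phi> (xs @ b # ys) r"
    and \<phi>_smult: "\<And>xs s a ys r. \<lbrakk>length xs + length ys + 1 = n; set xs \<subseteq> carrier M; set ys \<subseteq> carrier M;
        a \<in> carrier M; s \<in> carrier R; r \<in> carrier R\<rbrakk> \<Longrightarrow>
      \<phi> (xs @ (s \<odot>\<^bsub>M\<^esub> a) # ys) r = \<phi> (xs @ a # ys) (r \<otimes> s)"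
    and \<phi>_alt: "\<And>xs r. \<lbrakk>xs \<in> tuples (carrier M) n; \<not> distinct xs; r \<in> carrier R\<rbrakk> \<Longrightarrow> \<phi> xs r = \<zero>\<^bsub>G\<^esub>"
  obtains g where "g \<in> hom (add_monoid (exterior_power R M n)) (add_monoid G)"
    "\<And>r xs. r \<in> carrier R \<Longrightarrow> xs \<in> tuples (carrier M) n \<Longrightarrow>
      g (r \<odot>\<^bsub>exterior_power R M n\<^esub> wedge R M xs) = \<phi> xs r"
proof -
  interpret G: abelian_group G by (rule G)
  have clo: "\<phi> xs r \<in> carrier G" if "xs \<in> tuples (carrier M) n" "r \<in> carrier R" for xs r
    using \<phi>[OF that(1)] that(2) by (auto simp: hom_def)
  show ?thesis
  proof (rule E.presented_universal[OF G, of \<phi>])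
    show "\<phi> s \<in> hom (add_monoid R) (add_monoid G)" if "s \<in> tuples (carrier M) n" for s by (rule \<phi>[OF that])
  next
    fix h r x
    assume h: "abelian_group_hom E.F G h"
      and hg: "\<And>r s. r \<in> carrier R \<Longrightarrow> s \<in> tuples (carrier M) n \<Longrightarrow> h (r \<odot>\<^bsub>E.F\<^esub> free_gen R s) = \<phi> s r"
      and r: "r \<in> carrier R" and x: "x \<in> exterior_rels R M n"
    consider (add) xs a b ys where "length xs + length ys + 1 = n" "set xs \<subseteq> carrier M" "set ys \<subseteq> carrier M"
        "a \<in> carrier M" "b \<in> carrier M"
        "x = free_gen R (xs @ (a \<oplus>\<^bsub>M\<^esub> b) # ys) \<ominus>\<^bsub>E.F\<^esub> free_gen R (xs @ a # ys) \<ominus>\<^bsub>E.F\<^esub> free_gen R (xs @ b # ys)"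
      | (smult) xs s a ys where "length xs + length ys + 1 = n" "set xs \<subseteq> carrier M" "set ys \<subseteq> carrier M"
        "a \<in> carrier M" "s \<in> carrier R"
        "x = free_gen R (xs @ (s \<odot>\<^bsub>M\<^esub> a) # ys) \<ominus>\<^bsub>E.F\<^esub> s \<odot>\<^bsub>E.F\<^esub> free_gen R (xs @ a # ys)"
      | (alt) xs where "xs \<in> tuples (carrier M) n" "\<not> distinct xs" "x = free_gen R xs"
      using x unfolding exterior_rels_def Let_def by blast
    then show "h (r \<odot>\<^bsub>E.F\<^esub> x) = \<zero>\<^bsub>G\<^esub>"
    proof cases
      case add
      then show ?thesis using r
        by (simp add: E.hom_smult_diff[OF h] R.free_gen_closed hg \<phi>_add G.add_diff_diff_cancel clo)
    next
      case smult
      then have "\<phi> (xs @ a # ys) (r \<otimes> s) \<in> carrier G" using r by (intro clo) auto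
      then show ?thesis using r smult
        by (simp add: E.hom_smult_diff[OF h] R.free_gen_closed hg \<phi>_smult
            E.F.smult_assoc1[symmetric] G.diff_eq_zero_iff)
    next
      case alt
      then show ?thesis using r by (simp add: hg \<phi>_alt)
    qed
  next
    fix g
    assume g: "g \<in> hom (add_monoid E.Q) (add_monoid G)"
      "\<And>r s. r \<in> carrier R \<Longrightarrow> s \<in> tuples (carrier M) n \<Longrightarrow> g (r \<odot>\<^bsub>E.Q\<^esub> E.cl (free_gen R s)) = \<phi> s r"
    show ?thesis
    proof (rule that)
      show "g \<in> hom (add_monoid (exterior_power R M n)) (add_monoid G)"
        unfolding exterior_power_eq_presented by (rule g(1))
      show "g (r \<odot>\<^bsub>exterior_power R M n\<^esub> wedge R M xs) = \<phi> xs r"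
        if "r \<in> carrier R" "xs \<in> tuples (carrier M) n" for r xs
        using g(2)[OF that] that(2)
        by (simp add: wedge_eq_class[where n = n] exterior_power_eq_presented tuples_def)
    qed
  qed
qed

end

end

section \<open>The universal property of differential forms\<close>

text \<open>Maps of tuples of 1-forms into a group without scalar multiplication: \<open>T \<omega>s r\<close> stands for
  \<open>r T(\<omega>\<^sub>1, \<dots>, \<omega>\<^sub>n)\<close>, and a scalar in any slot can be moved into \<open>r\<close>. Restricting the slots to
  differentials \<open>db\<close> turns such a map into a multiderivation in the sense below.\<close>

definition kahler_multilinear ::
  "('a, 'm) ring_scheme \<Rightarrow> ('g, 'k) ring_scheme \<Rightarrow> nat \<Rightarrow> (('a \<Rightarrow> 'a) set list \<Rightarrow> 'a \<Rightarrow> 'g) \<Rightarrow> bool" where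
  "kahler_multilinear R G n T \<longleftrightarrow>
    (\<forall>\<omega>s \<in> tuples (carrier (kahler R)) n. T \<omega>s \<in> hom (add_monoid R) (add_monoid G))
    \<and> (\<forall>xs x y ys r. length xs + length ys + 1 = n \<and> set xs \<subseteq> carrier (kahler R) \<and> set ys \<subseteq> carrier (kahler R)
        \<and> x \<in> carrier (kahler R) \<and> y \<in> carrier (kahler R) \<and> r \<in> carrier R \<longrightarrow>
        T (xs @ (x \<oplus>\<^bsub>kahler R\<^esub> y) # ys) r = T (xs @ x # ys) r \<oplus>\<^bsub>G\<^esub> T (xs @ y # ys) r)
    \<and> (\<forall>xs s x ys r. length xs + length ys + 1 = n \<and> set xs \<subseteq> carrier (kahler R) \<and> set ys \<subseteq> carrier (kahler R)
        \<and> x \<in> carrier (kahler R) \<and> s \<in> carrier R \<and> r \<in> carrier R \<longrightarrow>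
        T (xs @ (s \<odot>\<^bsub>kahler R\<^esub> x) # ys) r = T (xs @ x # ys) (r \<otimes>\<^bsub>R\<^esub> s))"

definition multiderivation ::
  "('a, 'm) ring_scheme \<Rightarrow> ('g, 'k) ring_scheme \<Rightarrow> nat \<Rightarrow> ('a list \<Rightarrow> 'a \<Rightarrow> 'g) \<Rightarrow> bool" where
  "multiderivation R G n \<phi> \<longleftrightarrow>
    (\<forall>bs \<in> tuples (carrier R) n. \<phi> bs \<in> hom (add_monoid R) (add_monoid G))
    \<and> (\<forall>xs a b ys r. length xs + length ys + 1 = n \<and> set xs \<subseteq> carrier R \<and> set ys \<subseteq> carrier R
        \<and> a \<in> carrier R \<and> b \<in> carrier R \<and> r \<in> carrier R \<longrightarrow>
        \<phi> (xs @ (a \<oplus>\<^bsub>R\<^esub> b) # ys) r = \<phi> (xs @ a # ys) r \<oplus>\<^bsub>G\<^esub> \<phi> (xs @ b # ys) r)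
    \<and> (\<forall>xs a b ys r. length xs + length ys + 1 = n \<and> set xs \<subseteq> carrier R \<and> set ys \<subseteq> carrier R
        \<and> a \<in> carrier R \<and> b \<in> carrier R \<and> r \<in> carrier R \<longrightarrow>
        \<phi> (xs @ (a \<otimes>\<^bsub>R\<^esub> b) # ys) r = \<phi> (xs @ b # ys) (r \<otimes>\<^bsub>R\<^esub> a) \<oplus>\<^bsub>G\<^esub> \<phi> (xs @ a # ys) (r \<otimes>\<^bsub>R\<^esub> b))"

lemma tuples_Cons [simp]: "x # xs \<in> tuples A (Suc n) \<longleftrightarrow> x \<in> A \<and> xs \<in> tuples A n"
  by (auto simp: tuples_def)

lemma tuples_zero [simp]: "xs \<in> tuples A 0 \<longleftrightarrow> xs = []"
  by (auto simp: tuples_def)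

lemma map_in_tuples: "(\<And>x. x \<in> A \<Longrightarrow> f x \<in> B) \<Longrightarrow> xs \<in> tuples A n \<Longrightarrow> map f xs \<in> tuples B n"
  by (auto simp: tuples_def)

lemma tuples_length: "xs \<in> tuples A n \<Longrightarrow> length xs = n"
  by (simp add: tuples_def)

lemma kahler_multilinear_hom:
  assumes "kahler_multilinear R G n T" "\<omega>s \<in> tuples (carrier (kahler R)) n"
  shows "T \<omega>s \<in> hom (add_monoid R) (add_monoid G)"
  using assms unfolding kahler_multilinear_def by blast

lemma kahler_multilinear_closed:
  assumes "kahler_multilinear R G n T" "\<omega>s \<in> tuples (carrier (kahler R)) n" "r \<in> carrier R"
  shows "T \<omega>s r \<in> carrier G"
  using kahler_multilinear_hom[OF assms(1,2)] assms(3) by (auto simp: hom_def)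

lemma kahler_multilinear_hom_add:
  assumes "kahler_multilinear R G n T" "\<omega>s \<in> tuples (carrier (kahler R)) n" "r \<in> carrier R" "s \<in> carrier R"
  shows "T \<omega>s (r \<oplus>\<^bsub>R\<^esub> s) = T \<omega>s r \<oplus>\<^bsub>G\<^esub> T \<omega>s s"
  using kahler_multilinear_hom[OF assms(1,2)] assms(3,4) by (auto simp: hom_def)

lemma kahler_multilinear_add:
  assumes "kahler_multilinear R G n T" "length xs + length ys + 1 = n" "set xs \<subseteq> carrier (kahler R)"
    "set ys \<subseteq> carrier (kahler R)" "x \<in> carrier (kahler R)" "y \<in> carrier (kahler R)" "r \<in> carrier R"
  shows "T (xs @ (x \<oplus>\<^bsub>kahler R\<^esub> y) # ys) r = T (xs @ x # ys) r \<oplus>\<^bsub>G\<^esub> T (xs @ y # ys) r"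
  using assms unfolding kahler_multilinear_def by blast

lemma kahler_multilinear_smult:
  assumes "kahler_multilinear R G n T" "length xs + length ys + 1 = n" "set xs \<subseteq> carrier (kahler R)"
    "set ys \<subseteq> carrier (kahler R)" "x \<in> carrier (kahler R)" "s \<in> carrier R" "r \<in> carrier R"
  shows "T (xs @ (s \<odot>\<^bsub>kahler R\<^esub> x) # ys) r = T (xs @ x # ys) (r \<otimes>\<^bsub>R\<^esub> s)"
  using assms unfolding kahler_multilinear_def by blast

lemma multiderivation_hom:
  assumes "multiderivation R G n \<phi>" "bs \<in> tuples (carrier R) n"
  shows "\<phi> bs \<in> hom (add_monoid R) (add_monoid G)"
  using assms unfolding multiderivation_def by blast

lemma multiderivation_add:
  assumes "multiderivation R G n \<phi>" "length xs + length ys + 1 = n" "set xs \<subseteq> carrier R"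
    "set ys \<subseteq> carrier R" "a \<in> carrier R" "b \<in> carrier R" "r \<in> carrier R"
  shows "\<phi> (xs @ (a \<oplus>\<^bsub>R\<^esub> b) # ys) r = \<phi> (xs @ a # ys) r \<oplus>\<^bsub>G\<^esub> \<phi> (xs @ b # ys) r"
  using assms unfolding multiderivation_def by blast

lemma multiderivation_mult:
  assumes "multiderivation R G n \<phi>" "length xs + length ys + 1 = n" "set xs \<subseteq> carrier R"
    "set ys \<subseteq> carrier R" "a \<in> carrier R" "b \<in> carrier R" "r \<in> carrier R"
  shows "\<phi> (xs @ (a \<otimes>\<^bsub>R\<^esub> b) # ys) r = \<phi> (xs @ b # ys) (r \<otimes>\<^bsub>R\<^esub> a) \<oplus>\<^bsub>G\<^esub> \<phi> (xs @ a # ys) (r \<otimes>\<^bsub>R\<^esub> b)"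
  using assms unfolding multiderivation_def by blast

lemma multiderivation_Cons:
  assumes "multiderivation R G (Suc n) \<phi>" "b \<in> carrier R"
  shows "multiderivation R G n (\<lambda>bs. \<phi> (b # bs))"
  unfolding multiderivation_def
proof (intro conjI allI ballI impI, goal_cases)
  case (1 bs)
  then show ?case using multiderivation_hom[OF assms(1), of "b # bs"] assms(2) by simp
next
  case (2 xs x y ys r)
  then show ?case using multiderivation_add[OF assms(1), of "b # xs" ys x y r] assms(2) by simp
next
  case (3 xs x y ys r)
  then show ?case using multiderivation_mult[OF assms(1), of "b # xs" ys x y r] assms(2) by simp
qed

text \<open>The 1-forms are sums of multiples of differentials \<open>db\<close>. Replacing the slots one after the other
  from the left by differentials keeps the remaining slots arbitrary.\<close>

lemma (in cring) kahler_slots_induct [consumes 1, case_names d smult add]: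
  assumes \<omega>s: "\<omega>s \<in> tuples (carrier (kahler R)) n"
    and d: "\<And>bs. bs \<in> tuples (carrier R) n \<Longrightarrow> P (map (kahler_d R) bs)"
    and smult: "\<And>xs s x ys. \<lbrakk>length xs + length ys + 1 = n; set xs \<subseteq> carrier (kahler R);
        set ys \<subseteq> carrier (kahler R); s \<in> carrier R; x \<in> carrier (kahler R); P (xs @ x # ys)\<rbrakk> \<Longrightarrow>
        P (xs @ (s \<odot>\<^bsub>kahler R\<^esub> x) # ys)"
    and add: "\<And>xs x y ys. \<lbrakk>length xs + length ys + 1 = n; set xs \<subseteq> carrier (kahler R);
        set ys \<subseteq> carrier (kahler R); x \<in> carrier (kahler R); y \<in> carrier (kahler R);
        P (xs @ x # ys); P (xs @ y # ys)\<rbrakk> \<Longrightarrow> P (xs @ (x \<oplus>\<^bsub>kahler R\<^esub> y) # ys)"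
  shows "P \<omega>s"
proof -
  interpret K: module R "kahler R" by (rule kahler_module)
  have "length bs + length \<omega>s = n \<Longrightarrow> set bs \<subseteq> carrier R \<Longrightarrow> set \<omega>s \<subseteq> carrier (kahler R) \<Longrightarrow>
      P (map (kahler_d R) bs @ \<omega>s)" for bs
  proof (induction \<omega>s arbitrary: bs)
    case Nil
    then show ?case using d[of bs] by (simp add: tuples_def)
  next
    case (Cons \<omega> \<omega>s)
    let ?ds = "map (kahler_d R) bs"
    have ds: "length ?ds + length \<omega>s + 1 = n" "set ?ds \<subseteq> carrier (kahler R)" "set \<omega>s \<subseteq> carrier (kahler R)"
      using Cons.prems by auto
    have db: "P (?ds @ kahler_d R b # \<omega>s)" if "b \<in> carrier R" for b
      using Cons.IH[of "bs @ [b]"] Cons.prems that by simp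
    have "\<omega> \<in> carrier (kahler R)" using Cons.prems by simp
    then show ?case
    proof (induction \<omega> rule: kahler_induct)
      case (gen r b)
      then show ?case by (intro smult ds db kahler_d_closed)
    next
      case zero
      have "P (?ds @ (\<zero> \<odot>\<^bsub>kahler R\<^esub> kahler_d R \<zero>) # \<omega>s)"
        by (intro smult ds db kahler_d_closed zero_closed)
      then show ?case by simp
    next
      case (add x y)
      then show ?case by (intro assms(4) ds)
    qed
  qed
  from this[of "[]"] show ?thesis using \<omega>s by (simp add: tuples_def)
qed

context cring
begin

lemma kahler_multilinear_unique:
  assumes T: "kahler_multilinear R G n T" and T': "kahler_multilinear R G n T'"
    and agree: "\<And>bs r. bs \<in> tuples (carrier R) n \<Longrightarrow> r \<in> carrier R \<Longrightarrow>
        T (map (kahler_d R) bs) r = T' (map (kahler_d R) bs) r"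
    and \<omega>s: "\<omega>s \<in> tuples (carrier (kahler R)) n" and r: "r \<in> carrier R"
  shows "T \<omega>s r = T' \<omega>s r"
proof -
  from \<omega>s have "\<forall>r\<in>carrier R. T \<omega>s r = T' \<omega>s r"
  proof (induction rule: kahler_slots_induct)
    case (d bs) then show ?case using agree by blast
  next
    case (smult xs s x ys)
    then show ?case by (simp add: kahler_multilinear_smult[OF T] kahler_multilinear_smult[OF T'])
  next
    case (add xs x y ys)
    then show ?case by (simp add: kahler_multilinear_add[OF T] kahler_multilinear_add[OF T'])
  qed
  then show ?thesis using r by blast
qed

lemma kahler_multilinear_sum:
  assumes G: "abelian_group G" and T: "kahler_multilinear R G n T" and T': "kahler_multilinear R G n T'"
  shows "kahler_multilinear R G n (\<lambda>\<omega>s r. T \<omega>s r \<oplus>\<^bsub>G\<^esub> T' \<omega>s r)"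
proof -
  interpret G: abelian_group G by (rule G)
  note cl = kahler_multilinear_closed[OF T] kahler_multilinear_closed[OF T']
  have shuffle: "(a \<oplus>\<^bsub>G\<^esub> b) \<oplus>\<^bsub>G\<^esub> (c \<oplus>\<^bsub>G\<^esub> e) = (a \<oplus>\<^bsub>G\<^esub> c) \<oplus>\<^bsub>G\<^esub> (b \<oplus>\<^bsub>G\<^esub> e)"
    if "a \<in> carrier G" "b \<in> carrier G" "c \<in> carrier G" "e \<in> carrier G" for a b c e
    using that by (simp add: G.a_ac)
  show ?thesis unfolding kahler_multilinear_def
  proof (intro conjI allI ballI impI, goal_cases)
    case (1 \<omega>s)
    then show ?case
      by (intro homI) (simp_all add: cl kahler_multilinear_hom_add[OF T] kahler_multilinear_hom_add[OF T'] shuffle)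
  next
    case (2 xs x y ys r)
    then show ?case by (simp add: kahler_multilinear_add[OF T] kahler_multilinear_add[OF T'] shuffle cl)
  next
    case (3 xs s x ys r)
    then show ?case by (simp add: kahler_multilinear_smult[OF T] kahler_multilinear_smult[OF T'])
  qed
qed

lemma kahler_multilinear_scale:
  assumes T: "kahler_multilinear R G n T" and a: "a \<in> carrier R"
  shows "kahler_multilinear R G n (\<lambda>\<omega>s r. T \<omega>s (r \<otimes> a))"
  unfolding kahler_multilinear_def
proof (intro conjI allI ballI impI, goal_cases)
  case (1 \<omega>s)
  then show ?case using a
    by (intro homI) (simp_all add: kahler_multilinear_closed[OF T] kahler_multilinear_hom_add[OF T] l_distr)
next
  case (2 xs x y ys r)
  then show ?case using a by (simp add: kahler_multilinear_add[OF T])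
next
  case (3 xs s x ys r)
  then show ?case using a by (simp add: kahler_multilinear_smult[OF T] m_assoc m_comm[of s a])
qed

text \<open>The slots are extended from ring elements to 1-forms one at a time. For a fixed first entry
  \<open>b\<close> the induction hypothesis extends the other slots. Since such extensions are unique, they
  depend on \<open>b\<close> as a derivation, and the universal property of the Kaehler differentials extends
  the first slot.\<close>

lemma kahler_multilinear_exists:
  assumes G: "abelian_group G"
  shows "multiderivation R G n \<phi> \<Longrightarrow>
    \<exists>T. kahler_multilinear R G n T \<and>
      (\<forall>bs\<in>tuples (carrier R) n. \<forall>r\<in>carrier R. T (map (kahler_d R) bs) r = \<phi> bs r)"
proof (induction n arbitrary: \<phi>)
  case 0
  then have "\<phi> [] \<in> hom (add_monoid R) (add_monoid G)" using multiderivation_hom by fastforce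
  then have "kahler_multilinear R G 0 (\<lambda>_. \<phi> [])" by (simp add: kahler_multilinear_def)
  then show ?case by (intro exI[of _ "\<lambda>_. \<phi> []"]) auto
next
  case (Suc n)
  interpret G: abelian_group G by (rule G)
  interpret K: module R "kahler R" by (rule kahler_module)
  have "\<forall>b\<in>carrier R. \<exists>T. kahler_multilinear R G n T \<and>
      (\<forall>bs\<in>tuples (carrier R) n. \<forall>r\<in>carrier R. T (map (kahler_d R) bs) r = \<phi> (b # bs) r)"
    using Suc.IH multiderivation_Cons[OF Suc.prems] by blast
  then obtain T where T: "\<And>b. b \<in> carrier R \<Longrightarrow> kahler_multilinear R G n (T b)"
    and Td: "\<And>b bs r. \<lbrakk>b \<in> carrier R; bs \<in> tuples (carrier R) n; r \<in> carrier R\<rbrakk> \<Longrightarrow>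
      T b (map (kahler_d R) bs) r = \<phi> (b # bs) r"
    using bchoice[of "carrier R" "\<lambda>b T. kahler_multilinear R G n T \<and>
      (\<forall>bs\<in>tuples (carrier R) n. \<forall>r\<in>carrier R. T (map (kahler_d R) bs) r = \<phi> (b # bs) r)"] by blast
  have T_add: "T (a \<oplus> b) \<omega>s r = T a \<omega>s r \<oplus>\<^bsub>G\<^esub> T b \<omega>s r"
    if ab: "a \<in> carrier R" "b \<in> carrier R" and w: "\<omega>s \<in> tuples (carrier (kahler R)) n" "r \<in> carrier R" for a b \<omega>s r
  proof (rule kahler_multilinear_unique[OF T[OF a_closed[OF ab]] kahler_multilinear_sum[OF G T[OF ab(1)] T[OF ab(2)]] _ w])
    fix bs r assume "bs \<in> tuples (carrier R) n" "r \<in> carrier R"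
    then show "T (a \<oplus> b) (map (kahler_d R) bs) r =
        T a (map (kahler_d R) bs) r \<oplus>\<^bsub>G\<^esub> T b (map (kahler_d R) bs) r"
      using multiderivation_add[OF Suc.prems, of "[]" bs a b r] ab by (simp add: Td tuples_def)
  qed
  have T_mult: "T (a \<otimes> b) \<omega>s r = T b \<omega>s (r \<otimes> a) \<oplus>\<^bsub>G\<^esub> T a \<omega>s (r \<otimes> b)"
    if ab: "a \<in> carrier R" "b \<in> carrier R" and w: "\<omega>s \<in> tuples (carrier (kahler R)) n" "r \<in> carrier R" for a b \<omega>s r
  proof (rule kahler_multilinear_unique[OF T[OF m_closed[OF ab]]
        kahler_multilinear_sum[OF G kahler_multilinear_scale[OF T[OF ab(2)] ab(1)] kahler_multilinear_scale[OF T[OF ab(1)] ab(2)]] _ w])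
    fix bs r assume "bs \<in> tuples (carrier R) n" "r \<in> carrier R"
    then show "T (a \<otimes> b) (map (kahler_d R) bs) r =
        T b (map (kahler_d R) bs) (r \<otimes> a) \<oplus>\<^bsub>G\<^esub> T a (map (kahler_d R) bs) (r \<otimes> b)"
      using multiderivation_mult[OF Suc.prems, of "[]" bs a b r] ab by (simp add: Td tuples_def)
  qed
  have "\<exists>g. g \<in> hom (add_monoid (kahler R)) (add_monoid G) \<and>
      (\<forall>r\<in>carrier R. \<forall>b\<in>carrier R. g (r \<odot>\<^bsub>kahler R\<^esub> kahler_d R b) = T b \<omega>s r)"
    if w: "\<omega>s \<in> tuples (carrier (kahler R)) n" for \<omega>s
    by (rule kahler_universal[OF G, of "\<lambda>b. T b \<omega>s"])
      (use kahler_multilinear_hom[OF T w] T_add[OF _ _ w] T_mult[OF _ _ w] in blast)+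
  then obtain E where E: "\<And>\<omega>s. \<omega>s \<in> tuples (carrier (kahler R)) n \<Longrightarrow>
      E \<omega>s \<in> hom (add_monoid (kahler R)) (add_monoid G)"
    and Ed: "\<And>\<omega>s b r. \<lbrakk>\<omega>s \<in> tuples (carrier (kahler R)) n; r \<in> carrier R; b \<in> carrier R\<rbrakk> \<Longrightarrow>
      E \<omega>s (r \<odot>\<^bsub>kahler R\<^esub> kahler_d R b) = T b \<omega>s r"
    using bchoice[of "tuples (carrier (kahler R)) n" "\<lambda>\<omega>s g. g \<in> hom (add_monoid (kahler R)) (add_monoid G) \<and>
      (\<forall>r\<in>carrier R. \<forall>b\<in>carrier R. g (r \<odot>\<^bsub>kahler R\<^esub> kahler_d R b) = T b \<omega>s r)"] by blast
  have Ecl: "E \<omega>s x \<in> carrier G" if "\<omega>s \<in> tuples (carrier (kahler R)) n" "x \<in> carrier (kahler R)" for \<omega>s x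
    using E[OF that(1)] that(2) by (auto simp: hom_def)
  have Eadd: "E \<omega>s (x \<oplus>\<^bsub>kahler R\<^esub> y) = E \<omega>s x \<oplus>\<^bsub>G\<^esub> E \<omega>s y"
    if "\<omega>s \<in> tuples (carrier (kahler R)) n" "x \<in> carrier (kahler R)" "y \<in> carrier (kahler R)" for \<omega>s x y
    using E[OF that(1)] that(2,3) by (auto simp: hom_def)
  have Ezero: "E \<omega>s \<zero>\<^bsub>kahler R\<^esub> = \<zero>\<^bsub>G\<^esub>" if "\<omega>s \<in> tuples (carrier (kahler R)) n" for \<omega>s
    using Eadd[OF that, of "\<zero>\<^bsub>kahler R\<^esub>" "\<zero>\<^bsub>kahler R\<^esub>"] Ecl[OF that, of "\<zero>\<^bsub>kahler R\<^esub>"] by simp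
  have shuffle: "(a \<oplus>\<^bsub>G\<^esub> b) \<oplus>\<^bsub>G\<^esub> (c \<oplus>\<^bsub>G\<^esub> e) = (a \<oplus>\<^bsub>G\<^esub> c) \<oplus>\<^bsub>G\<^esub> (b \<oplus>\<^bsub>G\<^esub> e)"
    if "a \<in> carrier G" "b \<in> carrier G" "c \<in> carrier G" "e \<in> carrier G" for a b c e
    using that by (simp add: G.a_ac)
  have E_slot_add: "E (xs @ (x \<oplus>\<^bsub>kahler R\<^esub> y) # ys) k = E (xs @ x # ys) k \<oplus>\<^bsub>G\<^esub> E (xs @ y # ys) k"
    if w: "length xs + length ys + 1 = n" "set xs \<subseteq> carrier (kahler R)" "set ys \<subseteq> carrier (kahler R)"
      "x \<in> carrier (kahler R)" "y \<in> carrier (kahler R)" and k: "k \<in> carrier (kahler R)" for xs x y ys k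
  proof -
    have t: "xs @ (x \<oplus>\<^bsub>kahler R\<^esub> y) # ys \<in> tuples (carrier (kahler R)) n"
      "xs @ x # ys \<in> tuples (carrier (kahler R)) n" "xs @ y # ys \<in> tuples (carrier (kahler R)) n"
      using w by auto
    from k show ?thesis
    proof (induction k rule: kahler_induct)
      case (gen r b) then show ?case using w t by (simp add: Ed kahler_multilinear_add[OF T] del: tuples_append)
    next
      case zero then show ?case using t by (simp add: Ezero del: tuples_append)
    next
      case (add k l) then show ?case using t by (simp add: Eadd shuffle Ecl del: tuples_append)
    qed
  qed
  have E_slot_smult: "E (xs @ (s \<odot>\<^bsub>kahler R\<^esub> x) # ys) k = E (xs @ x # ys) (s \<odot>\<^bsub>kahler R\<^esub> k)"
    if w: "length xs + length ys + 1 = n" "set xs \<subseteq> carrier (kahler R)" "set ys \<subseteq> carrier (kahler R)"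
      "x \<in> carrier (kahler R)" "s \<in> carrier R" and k: "k \<in> carrier (kahler R)" for xs x s ys k
  proof -
    have t: "xs @ (s \<odot>\<^bsub>kahler R\<^esub> x) # ys \<in> tuples (carrier (kahler R)) n"
      "xs @ x # ys \<in> tuples (carrier (kahler R)) n"
      using w by auto
    from k show ?thesis
    proof (induction k rule: kahler_induct)
      case (gen r b) then show ?case using w t
        by (simp add: Ed kahler_multilinear_smult[OF T] K.smult_assoc1[symmetric] m_comm del: tuples_append)
    next
      case zero then show ?case using t w by (simp add: Ezero del: tuples_append)
    next
      case (add k l) then show ?case using t w by (simp add: Eadd K.smult_r_distr del: tuples_append)
    qed
  qed
  define T' where "T' \<omega>s r = E (tl \<omega>s) (r \<odot>\<^bsub>kahler R\<^esub> hd \<omega>s)" for \<omega>s r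
  have "kahler_multilinear R G (Suc n) T'"
    unfolding kahler_multilinear_def
  proof (intro conjI allI ballI impI, goal_cases)
    case (1 \<omega>s)
    then obtain \<omega> \<omega>s' where w: "\<omega>s = \<omega> # \<omega>s'" "\<omega> \<in> carrier (kahler R)" "\<omega>s' \<in> tuples (carrier (kahler R)) n"
      by (cases \<omega>s) (auto simp: tuples_def)
    then show ?case
      by (intro homI) (simp_all add: T'_def Ecl K.smult_l_distr Eadd)
  next
    case (2 xs x y ys r)
    then show ?case
      by (cases xs) (simp_all add: T'_def K.smult_r_distr Eadd E_slot_add tuples_def)
  next
    case (3 xs s x ys r)
    then show ?case
      by (cases xs) (simp_all add: T'_def E_slot_smult tuples_def K.smult_assoc1[symmetric] m_comm)
  qed
  moreover have "T' (map (kahler_d R) bs) r = \<phi> bs r"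
    if bs: "bs \<in> tuples (carrier R) (Suc n)" and r: "r \<in> carrier R" for bs r
  proof -
    obtain b bs' where b: "bs = b # bs'" "b \<in> carrier R" "bs' \<in> tuples (carrier R) n"
      using bs by (cases bs) (auto simp: tuples_def)
    then have "map (kahler_d R) bs' \<in> tuples (carrier (kahler R)) n"
      by (intro map_in_tuples[OF kahler_d_closed])
    then show ?thesis using b r by (simp add: T'_def Ed Td)
  qed
  ultimately show ?case by blast
qed

text \<open>Vanishing on \<open>x, x\<close> is not additive in \<open>x\<close>: expanding \<open>x + y\<close> leaves the cross terms
  \<open>T(\<dots>x, y\<dots>) + T(\<dots>y, x\<dots>)\<close>. So antisymmetry has to be extended from differentials to all 1-forms
  first, and it holds for differentials because \<open>da + db = d(a + b)\<close>.\<close>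

lemma kahler_multilinear_adjacent_zero:
  assumes G: "abelian_group G" and T: "kahler_multilinear R G n T"
    and alt: "\<And>xs a ys r. \<lbrakk>length xs + length ys + 2 = n; set xs \<subseteq> carrier R; set ys \<subseteq> carrier R;
        a \<in> carrier R; r \<in> carrier R\<rbrakk> \<Longrightarrow> T (map (kahler_d R) (xs @ a # a # ys)) r = \<zero>\<^bsub>G\<^esub>"
    and xs: "length xs + length ys + 2 = n" "set xs \<subseteq> carrier (kahler R)" "set ys \<subseteq> carrier (kahler R)"
    and r: "r \<in> carrier R"
  shows "x \<in> carrier (kahler R) \<Longrightarrow> y \<in> carrier (kahler R) \<Longrightarrow>
      T (xs @ x # y # ys) r \<oplus>\<^bsub>G\<^esub> T (xs @ y # x # ys) r = \<zero>\<^bsub>G\<^esub>" (is "_ \<Longrightarrow> _ \<Longrightarrow> ?anti")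
    and "x \<in> carrier (kahler R) \<Longrightarrow> T (xs @ x # x # ys) r = \<zero>\<^bsub>G\<^esub>"
proof -
  interpret G: abelian_group G by (rule G)
  interpret K: module R "kahler R" by (rule kahler_module)
  let ?d = "kahler_d R"
  define Z where "Z xs x y ys r \<longleftrightarrow> T (xs @ x # y # ys) r \<oplus>\<^bsub>G\<^esub> T (xs @ y # x # ys) r = \<zero>\<^bsub>G\<^esub>" for xs x y ys r
  have dd1: "T (map ?d as @ ?d a # ?d a # zs) r = \<zero>\<^bsub>G\<^esub>"
    if as: "length as + length zs + 2 = n" "set as \<subseteq> carrier R" "set zs \<subseteq> carrier (kahler R)"
      "a \<in> carrier R" "r \<in> carrier R" for as a zs r
  proof -
    have "zs \<in> tuples (carrier (kahler R)) (length zs)" using as by (simp add: tuples_def)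
    then have "\<forall>r\<in>carrier R. T (map ?d as @ ?d a # ?d a # zs) r = \<zero>\<^bsub>G\<^esub>"
    proof (induction zs rule: kahler_slots_induct)
      case (d bs)
      then show ?case using alt[of as bs a] as by (simp add: tuples_def)
    next
      case (smult us s x vs)
      have ds: "set (map ?d as) \<subseteq> carrier (kahler R)" using as by auto
      show ?case
        using kahler_multilinear_smult[OF T, of "map ?d as @ ?d a # ?d a # us" vs x s] smult as ds by simp
    next
      case (add us x y vs)
      have ds: "set (map ?d as) \<subseteq> carrier (kahler R)" using as by auto
      show ?case
        using kahler_multilinear_add[OF T, of "map ?d as @ ?d a # ?d a # us" vs x y] add as ds by simp
    qed
    then show ?thesis using as by blast
  qed
  have dd2: "T (xs @ ?d a # ?d a # ys) r = \<zero>\<^bsub>G\<^esub>" if a: "a \<in> carrier R" "r \<in> carrier R" for a r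
  proof -
    have "xs \<in> tuples (carrier (kahler R)) (length xs)" using xs by (simp add: tuples_def)
    then have "\<forall>r\<in>carrier R. T (xs @ ?d a # ?d a # ys) r = \<zero>\<^bsub>G\<^esub>"
    proof (induction xs rule: kahler_slots_induct)
      case (d bs)
      then show ?case using dd1[of bs ys a] xs a by (simp add: tuples_def)
    next
      case (smult us s x vs)
      then show ?case
        using kahler_multilinear_smult[OF T, of us "vs @ ?d a # ?d a # ys" x s] a xs by simp
    next
      case (add us x y vs)
      then show ?case
        using kahler_multilinear_add[OF T, of us "vs @ ?d a # ?d a # ys" x y] a xs by simp
    qed
    then show ?thesis using a by blast
  qed
  have in_t: "xs @ x # y # ys \<in> tuples (carrier (kahler R)) n"
    if "x \<in> carrier (kahler R)" "y \<in> carrier (kahler R)" for x y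
    using that xs by simp
  have cl: "T (xs @ x # y # ys) r \<in> carrier G"
    if "x \<in> carrier (kahler R)" "y \<in> carrier (kahler R)" "r \<in> carrier R" for x y r
    using kahler_multilinear_closed[OF T in_t] that by blast
  have add1: "T (xs @ (x \<oplus>\<^bsub>kahler R\<^esub> x') # y # ys) r = T (xs @ x # y # ys) r \<oplus>\<^bsub>G\<^esub> T (xs @ x' # y # ys) r"
    if "x \<in> carrier (kahler R)" "x' \<in> carrier (kahler R)" "y \<in> carrier (kahler R)" "r \<in> carrier R" for x x' y r
    using kahler_multilinear_add[OF T, of xs "y # ys" x x' r] that xs by simp
  have add2: "T (xs @ x # (y \<oplus>\<^bsub>kahler R\<^esub> y') # ys) r = T (xs @ x # y # ys) r \<oplus>\<^bsub>G\<^esub> T (xs @ x # y' # ys) r"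
    if "x \<in> carrier (kahler R)" "y' \<in> carrier (kahler R)" "y \<in> carrier (kahler R)" "r \<in> carrier R" for x y y' r
    using kahler_multilinear_add[OF T, of "xs @ [x]" ys y y' r] that xs by simp
  have sm1: "T (xs @ (s \<odot>\<^bsub>kahler R\<^esub> x) # y # ys) r = T (xs @ x # y # ys) (r \<otimes> s)"
    if "x \<in> carrier (kahler R)" "s \<in> carrier R" "y \<in> carrier (kahler R)" "r \<in> carrier R" for x s y r
    using kahler_multilinear_smult[OF T, of xs "y # ys" x s r] that xs by simp
  have sm2: "T (xs @ x # (s \<odot>\<^bsub>kahler R\<^esub> y) # ys) r = T (xs @ x # y # ys) (r \<otimes> s)"
    if "x \<in> carrier (kahler R)" "s \<in> carrier R" "y \<in> carrier (kahler R)" "r \<in> carrier R" for x y s r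
    using kahler_multilinear_smult[OF T, of "xs @ [x]" ys y s r] that xs by simp
  have zero_hom: "T (xs @ x # y # ys) \<zero> = \<zero>\<^bsub>G\<^esub>"
    if "x \<in> carrier (kahler R)" "y \<in> carrier (kahler R)" for x y
    using kahler_multilinear_hom_add[OF T in_t[OF that], of \<zero> \<zero>] cl[OF that, of \<zero>] by simp
  have z1: "T (xs @ \<zero>\<^bsub>kahler R\<^esub> # y # ys) r = \<zero>\<^bsub>G\<^esub>" if "y \<in> carrier (kahler R)" "r \<in> carrier R" for y r
    using sm1[of "\<zero>\<^bsub>kahler R\<^esub>" \<zero> y r] that zero_hom by simp
  have z2: "T (xs @ x # \<zero>\<^bsub>kahler R\<^esub> # ys) r = \<zero>\<^bsub>G\<^esub>" if "x \<in> carrier (kahler R)" "r \<in> carrier R" for x r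
    using sm2[of x \<zero> "\<zero>\<^bsub>kahler R\<^esub>" r] that zero_hom by simp
  have shuffle: "(a \<oplus>\<^bsub>G\<^esub> b) \<oplus>\<^bsub>G\<^esub> (c \<oplus>\<^bsub>G\<^esub> e) = (a \<oplus>\<^bsub>G\<^esub> c) \<oplus>\<^bsub>G\<^esub> (b \<oplus>\<^bsub>G\<^esub> e)"
    if "a \<in> carrier G" "b \<in> carrier G" "c \<in> carrier G" "e \<in> carrier G" for a b c e
    using that by (simp add: G.a_ac)
  have ad: "T (xs @ ?d a # ?d b # ys) r \<oplus>\<^bsub>G\<^esub> T (xs @ ?d b # ?d a # ys) r = \<zero>\<^bsub>G\<^esub>"
    if "a \<in> carrier R" "b \<in> carrier R" "r \<in> carrier R" for a b r
  proof -
    have "\<zero>\<^bsub>G\<^esub> = T (xs @ ?d (a \<oplus> b) # ?d (a \<oplus> b) # ys) r" using that by (simp add: dd2)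
    also have "\<dots> = T (xs @ ?d a # ?d b # ys) r \<oplus>\<^bsub>G\<^esub> T (xs @ ?d b # ?d a # ys) r"
      using that by (simp add: kahler_d_add add1 add2 dd2 cl G.a_comm[of "T (xs @ ?d b # ?d a # ys) r"])
    finally show ?thesis by simp
  qed
  have anti: "\<forall>r\<in>carrier R. T (xs @ x # y # ys) r \<oplus>\<^bsub>G\<^esub> T (xs @ y # x # ys) r = \<zero>\<^bsub>G\<^esub>"
    if x: "x \<in> carrier (kahler R)" and y: "y \<in> carrier (kahler R)" for x y
    using x
  proof (induction x rule: kahler_induct)
    case (gen s a)
    from y show ?case
    proof (induction y rule: kahler_induct)
      case (gen t b)
      then show ?case using \<open>s \<in> carrier R\<close> \<open>a \<in> carrier R\<close> by (simp add: sm1 sm2 ad m_assoc m_comm[of t s])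
    next
      case zero
      then show ?case using gen by (simp add: z1 z2)
    next
      case (add y y')
      then show ?case using gen by (simp add: add1 add2 shuffle cl)
    qed
  next
    case zero
    then show ?case using y by (simp add: z1 z2)
  next
    case (add x x')
    show ?case
    proof
      fix r assume "r \<in> carrier R"
      then show "T (xs @ (x \<oplus>\<^bsub>kahler R\<^esub> x') # y # ys) r \<oplus>\<^bsub>G\<^esub> T (xs @ y # (x \<oplus>\<^bsub>kahler R\<^esub> x') # ys) r = \<zero>\<^bsub>G\<^esub>"
        using y add
          shuffle[of "T (xs @ x # y # ys) r" "T (xs @ x' # y # ys) r" "T (xs @ y # x # ys) r" "T (xs @ y # x' # ys) r"]
        by (simp add: add1 add2 cl)
    qed
  qed
  then show ?anti if "x \<in> carrier (kahler R)" "y \<in> carrier (kahler R)" using that r by blast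
  have "\<forall>r\<in>carrier R. T (xs @ x # x # ys) r = \<zero>\<^bsub>G\<^esub>" if "x \<in> carrier (kahler R)"
    using that
  proof (induction x rule: kahler_induct)
    case (gen s a)
    then show ?case by (simp add: sm1 sm2 dd2)
  next
    case zero
    then show ?case by (simp add: z1)
  next
    case (add x y)
    then show ?case using anti[of x y] anti[of y x] by (simp add: add1 add2 cl)
  qed
  then show "x \<in> carrier (kahler R) \<Longrightarrow> T (xs @ x # x # ys) r = \<zero>\<^bsub>G\<^esub>" using r by blast
qed

text \<open>A repeated entry is moved next to its copy by transpositions of adjacent entries.\<close>

lemma kahler_multilinear_not_distinct_zero:
  assumes G: "abelian_group G" and T: "kahler_multilinear R G n T"
    and alt: "\<And>xs a ys r. \<lbrakk>length xs + length ys + 2 = n; set xs \<subseteq> carrier R; set ys \<subseteq> carrier R;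
        a \<in> carrier R; r \<in> carrier R\<rbrakk> \<Longrightarrow> T (map (kahler_d R) (xs @ a # a # ys)) r = \<zero>\<^bsub>G\<^esub>"
    and \<omega>s: "\<omega>s \<in> tuples (carrier (kahler R)) n" "\<not> distinct \<omega>s" and r: "r \<in> carrier R"
  shows "T \<omega>s r = \<zero>\<^bsub>G\<^esub>"
proof -
  interpret G: abelian_group G by (rule G)
  obtain us y vs ws where dec: "\<omega>s = us @ [y] @ vs @ [y] @ ws"
    using not_distinct_decomp[OF \<omega>s(2)] by blast
  have "length us + length vs + length ws + 2 = n \<Longrightarrow> set us \<subseteq> carrier (kahler R) \<Longrightarrow>
      set vs \<subseteq> carrier (kahler R) \<Longrightarrow> set ws \<subseteq> carrier (kahler R) \<Longrightarrow> y \<in> carrier (kahler R) \<Longrightarrow>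
      T (us @ y # vs @ y # ws) r = \<zero>\<^bsub>G\<^esub>" for us
  proof (induction vs arbitrary: us)
    case Nil
    then show ?case using kahler_multilinear_adjacent_zero(2)[OF G T alt, of us ws r y] r by simp
  next
    case (Cons v vs)
    have "T (us @ y # v # vs @ y # ws) r \<oplus>\<^bsub>G\<^esub> T (us @ v # y # vs @ y # ws) r = \<zero>\<^bsub>G\<^esub>"
      using kahler_multilinear_adjacent_zero(1)[OF G T alt, of us "vs @ y # ws" r y v] r Cons.prems by simp
    moreover have "T (us @ v # y # vs @ y # ws) r = \<zero>\<^bsub>G\<^esub>"
      using Cons.IH[of "us @ [v]"] Cons.prems by simp
    moreover have "T (us @ y # v # vs @ y # ws) r \<in> carrier G"
      using Cons.prems r by (intro kahler_multilinear_closed[OF T]) auto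
    ultimately show ?case by simp
  qed
  then show ?thesis using dec \<omega>s by (simp add: tuples_def)
qed

lemma forms_module: "module R (forms R n)"
  unfolding forms_def by (rule module.exterior_power_module[OF kahler_module])

lemma form_wedge_closed:
  "\<omega>s \<in> tuples (carrier (kahler R)) n \<Longrightarrow> form_wedge R \<omega>s \<in> carrier (forms R n)"
  unfolding forms_def form_wedge_def by (rule module.wedge_closed[OF kahler_module])

lemma form_wedge_add:
  "\<lbrakk>length xs + length ys + 1 = n; set xs \<subseteq> carrier (kahler R); set ys \<subseteq> carrier (kahler R);
    x \<in> carrier (kahler R); y \<in> carrier (kahler R)\<rbrakk> \<Longrightarrow>
  form_wedge R (xs @ (x \<oplus>\<^bsub>kahler R\<^esub> y) # ys) =
    form_wedge R (xs @ x # ys) \<oplus>\<^bsub>forms R n\<^esub> form_wedge R (xs @ y # ys)"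
  unfolding forms_def form_wedge_def by (rule module.wedge_add[OF kahler_module])

lemma form_wedge_smult:
  "\<lbrakk>length xs + length ys + 1 = n; set xs \<subseteq> carrier (kahler R); set ys \<subseteq> carrier (kahler R);
    r \<in> carrier R; x \<in> carrier (kahler R)\<rbrakk> \<Longrightarrow>
  form_wedge R (xs @ (r \<odot>\<^bsub>kahler R\<^esub> x) # ys) = r \<odot>\<^bsub>forms R n\<^esub> form_wedge R (xs @ x # ys)"
  unfolding forms_def form_wedge_def by (rule module.wedge_smult[OF kahler_module])

lemma form_wedge_not_distinct:
  "\<omega>s \<in> tuples (carrier (kahler R)) n \<Longrightarrow> \<not> distinct \<omega>s \<Longrightarrow> form_wedge R \<omega>s = \<zero>\<^bsub>forms R n\<^esub>"
  unfolding forms_def form_wedge_def by (rule module.wedge_not_distinct[OF kahler_module])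

lemma forms_induct [consumes 1, case_names gen zero add]:
  assumes x: "x \<in> carrier (forms R n)"
    and gen: "\<And>r bs. r \<in> carrier R \<Longrightarrow> bs \<in> tuples (carrier R) n \<Longrightarrow>
        P (r \<odot>\<^bsub>forms R n\<^esub> form_wedge R (map (kahler_d R) bs))"
    and zero: "P \<zero>\<^bsub>forms R n\<^esub>"
    and add: "\<And>x y. x \<in> carrier (forms R n) \<Longrightarrow> y \<in> carrier (forms R n) \<Longrightarrow>
        P x \<Longrightarrow> P y \<Longrightarrow> P (x \<oplus>\<^bsub>forms R n\<^esub> y)"
  shows "P x"
proof -
  interpret W: module R "forms R n" by (rule forms_module)
  have "P (r \<odot>\<^bsub>forms R n\<^esub> form_wedge R \<omega>s)" if "r \<in> carrier R" and w: "\<omega>s \<in> tuples (carrier (kahler R)) n" for r \<omega>s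
  proof -
    from w have "\<forall>r\<in>carrier R. P (r \<odot>\<^bsub>forms R n\<^esub> form_wedge R \<omega>s)"
    proof (induction rule: kahler_slots_induct)
      case (d bs) then show ?case using gen by blast
    next
      case (smult xs s x ys)
      have "form_wedge R (xs @ x # ys) \<in> carrier (forms R n)"
        using smult by (intro form_wedge_closed) auto
      then show ?case using smult by (simp add: form_wedge_smult W.smult_assoc1[symmetric])
    next
      case (add xs x y ys)
      have "form_wedge R (xs @ x # ys) \<in> carrier (forms R n)" "form_wedge R (xs @ y # ys) \<in> carrier (forms R n)"
        using add by (auto intro!: form_wedge_closed)
      then show ?case using add by (simp add: form_wedge_add W.smult_r_distr assms(4))
    qed
    then show ?thesis using that by blast
  qed
  then show ?thesis
    using x module.exterior_power_induct[OF kahler_module, of x n P] zero add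
    unfolding forms_def form_wedge_def by blast
qed

text \<open>Definitions by values on \<open>r db\<^sub>1 \<and> \<dots> \<and> db\<^sub>n\<close> only have to be checked for additivity, for the
  Leibniz rule in each \<open>b\<^sub>i\<close> and for vanishing on equal neighbours.\<close>

lemma forms_universal:
  assumes G: "abelian_group G" and \<phi>: "multiderivation R G n \<phi>"
    and alt: "\<And>xs a ys r. \<lbrakk>length xs + length ys + 2 = n; set xs \<subseteq> carrier R; set ys \<subseteq> carrier R;
        a \<in> carrier R; r \<in> carrier R\<rbrakk> \<Longrightarrow> \<phi> (xs @ a # a # ys) r = \<zero>\<^bsub>G\<^esub>"
  shows "\<exists>g. g \<in> hom (add_monoid (forms R n)) (add_monoid G) \<and>
    (\<forall>r\<in>carrier R. \<forall>bs\<in>tuples (carrier R) n.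
      g (r \<odot>\<^bsub>forms R n\<^esub> form_wedge R (map (kahler_d R) bs)) = \<phi> bs r)"
proof -
  obtain T where T: "kahler_multilinear R G n T"
    and Td: "\<And>bs r. bs \<in> tuples (carrier R) n \<Longrightarrow> r \<in> carrier R \<Longrightarrow> T (map (kahler_d R) bs) r = \<phi> bs r"
    using kahler_multilinear_exists[OF G \<phi>] by blast
  have alt': "T (map (kahler_d R) (xs @ a # a # ys)) r = \<zero>\<^bsub>G\<^esub>"
    if "length xs + length ys + 2 = n" "set xs \<subseteq> carrier R" "set ys \<subseteq> carrier R"
        "a \<in> carrier R" "r \<in> carrier R" for xs a ys r
    using Td[of "xs @ a # a # ys" r] alt[of xs ys a r] that by simp
  have nd: "T xs r = \<zero>\<^bsub>G\<^esub>"
    if "xs \<in> tuples (carrier (kahler R)) n" "\<not> distinct xs" "r \<in> carrier R" for xs r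
    by (rule kahler_multilinear_not_distinct_zero[OF G T alt' that])
  obtain g where g: "g \<in> hom (add_monoid (forms R n)) (add_monoid G)"
    "\<And>r xs. r \<in> carrier R \<Longrightarrow> xs \<in> tuples (carrier (kahler R)) n \<Longrightarrow>
      g (r \<odot>\<^bsub>forms R n\<^esub> form_wedge R xs) = T xs r"
    unfolding forms_def form_wedge_def
    by (rule module.exterior_power_universal[OF kahler_module G, of n T], erule kahler_multilinear_hom[OF T],
        erule (5) kahler_multilinear_add[OF T], erule (5) kahler_multilinear_smult[OF T], erule (2) nd, blast)
  have "g (r \<odot>\<^bsub>forms R n\<^esub> form_wedge R (map (kahler_d R) bs)) = \<phi> bs r"
    if "r \<in> carrier R" "bs \<in> tuples (carrier R) n" for r bs
    using g(2)[of r "map (kahler_d R) bs"] map_in_tuples[OF kahler_d_closed that(2)] Td that by simp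
  then show ?thesis using g(1) by blast
qed

end

section \<open>Functoriality and the de Rham differential\<close>

context cring
begin

lemma kahler_d_one: "kahler_d R \<one> = \<zero>\<^bsub>kahler R\<^esub>"
proof -
  interpret K: module R "kahler R" by (rule kahler_module)
  have "kahler_d R \<one> = kahler_d R \<one> \<oplus>\<^bsub>kahler R\<^esub> kahler_d R \<one>"
    using kahler_d_mult[of \<one> \<one>] by simp
  then show ?thesis using K.M.add.r_cancel_one'[of "kahler_d R \<one>" "kahler_d R \<one>"] by simp
qed

lemma kahler_d_zero: "kahler_d R \<zero> = \<zero>\<^bsub>kahler R\<^esub>"
proof -
  interpret K: module R "kahler R" by (rule kahler_module)
  show ?thesis using kahler_d_mult[of \<zero> \<zero>] by simp
qed

lemma kahler_d_minus: "a \<in> carrier R \<Longrightarrow> kahler_d R (\<ominus> a) = \<ominus>\<^bsub>kahler R\<^esub> kahler_d R a"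
proof -
  interpret K: module R "kahler R" by (rule kahler_module)
  assume a: "a \<in> carrier R"
  have "kahler_d R (\<ominus> a) \<oplus>\<^bsub>kahler R\<^esub> kahler_d R a = \<zero>\<^bsub>kahler R\<^esub>"
    using kahler_d_add[of "\<ominus> a" a] a by (simp add: l_neg kahler_d_zero)
  then show ?thesis using K.M.minus_equality a by simp
qed

lemma kahler_d_inv:
  assumes "c \<in> Units R"
  shows "kahler_d R (inv c) = \<ominus>\<^bsub>kahler R\<^esub> ((inv c \<otimes> inv c) \<odot>\<^bsub>kahler R\<^esub> kahler_d R c)"
proof -
  interpret K: module R "kahler R" by (rule kahler_module)
  let ?d = "kahler_d R"
  have c: "c \<in> carrier R" "inv c \<in> carrier R" using assms by auto
  have "inv c \<odot>\<^bsub>kahler R\<^esub> (?d (c \<otimes> inv c)) =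
      inv c \<odot>\<^bsub>kahler R\<^esub> (c \<odot>\<^bsub>kahler R\<^esub> ?d (inv c)) \<oplus>\<^bsub>kahler R\<^esub>
      inv c \<odot>\<^bsub>kahler R\<^esub> (inv c \<odot>\<^bsub>kahler R\<^esub> ?d c)"
    using c by (simp only: kahler_d_mult K.smult_r_distr K.smult_closed kahler_d_closed)
  then have "\<zero>\<^bsub>kahler R\<^esub> = ?d (inv c) \<oplus>\<^bsub>kahler R\<^esub> (inv c \<otimes> inv c) \<odot>\<^bsub>kahler R\<^esub> ?d c"
    using assms c by (simp add: K.smult_assoc1[symmetric] kahler_d_one)
  then show ?thesis using K.M.minus_equality[of "?d (inv c)" "(inv c \<otimes> inv c) \<odot>\<^bsub>kahler R\<^esub> ?d c"] c by simp
qed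

lemma dlog_closed [simp]: "c \<in> Units R \<Longrightarrow> dlog R c \<in> carrier (kahler R)"
  unfolding dlog_def by (intro module.smult_closed[OF kahler_module]) auto

lemma dlog_mult:
  assumes "a \<in> Units R" "b \<in> Units R"
  shows "dlog R (a \<otimes> b) = dlog R a \<oplus>\<^bsub>kahler R\<^esub> dlog R b"
proof -
  interpret K: module R "kahler R" by (rule kahler_module)
  have c: "a \<in> carrier R" "b \<in> carrier R" "inv a \<in> carrier R" "inv b \<in> carrier R" using assms by auto
  have "(a \<otimes> b) \<otimes> (inv a \<otimes> inv b) = (a \<otimes> inv a) \<otimes> (b \<otimes> inv b)"
    using c by (simp only: m_assoc m_lcomm m_closed)
  then have inv: "inv (a \<otimes> b) = inv a \<otimes> inv b"
    using assms c by (intro comm_inv_char) simp_all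
  have "inv a \<otimes> inv b \<otimes> a = (a \<otimes> inv a) \<otimes> inv b" "inv a \<otimes> inv b \<otimes> b = inv a \<otimes> (b \<otimes> inv b)"
    using c by (simp_all only: m_assoc m_lcomm m_comm m_closed)
  then have "inv a \<otimes> inv b \<otimes> a = inv b" "inv a \<otimes> inv b \<otimes> b = inv a"
    using assms c by simp_all
  then show ?thesis
    unfolding dlog_def inv kahler_d_mult[OF c(1,2)]
    using c by (simp add: K.smult_r_distr K.smult_assoc1[symmetric] K.M.a_comm)
qed

lemma dlog_one: "dlog R \<one> = \<zero>\<^bsub>kahler R\<^esub>"
  unfolding dlog_def using kahler_d_one module.smult_r_null[OF kahler_module] by simp

lemma form_wedge_swap:
  assumes "length xs + length ys + length zs + 2 = n" "set xs \<subseteq> carrier (kahler R)" "set ys \<subseteq> carrier (kahler R)"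
    "set zs \<subseteq> carrier (kahler R)" "x \<in> carrier (kahler R)" "y \<in> carrier (kahler R)"
  shows "form_wedge R (xs @ x # ys @ y # zs) = \<ominus>\<^bsub>forms R n\<^esub> form_wedge R (xs @ y # ys @ x # zs)"
proof -
  interpret K: module R "kahler R" by (rule kahler_module)
  interpret W: module R "forms R n" by (rule forms_module)
  let ?w = "\<lambda>a b. form_wedge R (xs @ a # ys @ b # zs)"
  have cl: "?w a b \<in> carrier (forms R n)" if "a \<in> carrier (kahler R)" "b \<in> carrier (kahler R)" for a b
    using assms that by (intro form_wedge_closed) simp
  have z: "?w a a = \<zero>\<^bsub>forms R n\<^esub>" if "a \<in> carrier (kahler R)" for a
    using assms that by (intro form_wedge_not_distinct) simp_all
  have a1: "?w (a \<oplus>\<^bsub>kahler R\<^esub> a') b = ?w a b \<oplus>\<^bsub>forms R n\<^esub> ?w a' b"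
    if "a \<in> carrier (kahler R)" "a' \<in> carrier (kahler R)" "b \<in> carrier (kahler R)" for a a' b
    using form_wedge_add[of xs "ys @ b # zs" n a a'] assms that by simp
  have a2: "?w a (b \<oplus>\<^bsub>kahler R\<^esub> b') = ?w a b \<oplus>\<^bsub>forms R n\<^esub> ?w a b'"
    if "a \<in> carrier (kahler R)" "b' \<in> carrier (kahler R)" "b \<in> carrier (kahler R)" for a b b'
    using form_wedge_add[of "xs @ a # ys" zs n b b'] assms that by simp
  have "\<zero>\<^bsub>forms R n\<^esub> = ?w (x \<oplus>\<^bsub>kahler R\<^esub> y) (x \<oplus>\<^bsub>kahler R\<^esub> y)"
    using assms(5,6) z[of "x \<oplus>\<^bsub>kahler R\<^esub> y"] by simp
  also have "\<dots> = ?w x y \<oplus>\<^bsub>forms R n\<^esub> ?w y x"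
    using assms(5,6) by (simp add: a1 a2 z[OF assms(5)] z[OF assms(6)] cl W.M.a_comm[of "?w y x"])
  finally show ?thesis using W.M.minus_equality[of "?w x y" "?w y x"] assms(5,6) cl by simp
qed

lemma form_wedge_move:
  assumes "length zs + length xs + length ys + 1 = n" "set zs \<subseteq> carrier (kahler R)" "set xs \<subseteq> carrier (kahler R)"
    "set ys \<subseteq> carrier (kahler R)" "x \<in> carrier (kahler R)"
  shows "form_wedge R (zs @ xs @ x # ys) =
    ((\<ominus> \<one>) [^] length xs) \<odot>\<^bsub>forms R n\<^esub> form_wedge R (zs @ x # xs @ ys)"
  using assms
proof (induction xs arbitrary: zs)
  case Nil
  interpret W: module R "forms R n" by (rule forms_module)
  show ?case using Nil form_wedge_closed[of "zs @ x # ys" n] by simp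
next
  case (Cons z xs)
  interpret W: module R "forms R n" by (rule forms_module)
  have cl: "form_wedge R (zs @ x # z # xs @ ys) \<in> carrier (forms R n)"
    using Cons.prems by (intro form_wedge_closed) simp
  have "form_wedge R (zs @ (z # xs) @ x # ys) =
      ((\<ominus> \<one>) [^] length xs) \<odot>\<^bsub>forms R n\<^esub> form_wedge R (zs @ z # x # xs @ ys)"
    using Cons.IH[of "zs @ [z]"] Cons.prems by simp
  also have "form_wedge R (zs @ z # x # xs @ ys) = \<ominus>\<^bsub>forms R n\<^esub> form_wedge R (zs @ x # z # xs @ ys)"
    using form_wedge_swap[of zs "[]" "xs @ ys" n z x] Cons.prems by simp
  also have "\<dots> = (\<ominus> \<one>) \<odot>\<^bsub>forms R n\<^esub> form_wedge R (zs @ x # z # xs @ ys)"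
    using cl by (simp add: W.smult_l_minus)
  finally show ?case using cl by (simp add: W.smult_assoc1[symmetric])
qed

lemma forms_hom_unique:
  assumes G: "abelian_group G"
    and g: "g \<in> hom (add_monoid (forms R n)) (add_monoid G)"
    and h: "h \<in> hom (add_monoid (forms R n)) (add_monoid G)"
    and eq: "\<And>a bs. a \<in> carrier R \<Longrightarrow> bs \<in> tuples (carrier R) n \<Longrightarrow>
      g (a \<odot>\<^bsub>forms R n\<^esub> form_wedge R (map (kahler_d R) bs)) =
      h (a \<odot>\<^bsub>forms R n\<^esub> form_wedge R (map (kahler_d R) bs))"
    and x: "x \<in> carrier (forms R n)"
  shows "g x = h x"
proof -
  interpret W: module R "forms R n" by (rule forms_module)
  interpret g: abelian_group_hom "forms R n" G g
    by (rule abelian_group_hom_of_hom[OF W.M.abelian_group_axioms G g])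
  interpret h: abelian_group_hom "forms R n" G h
    by (rule abelian_group_hom_of_hom[OF W.M.abelian_group_axioms G h])
  from x show ?thesis by (induction rule: forms_induct) (simp_all add: eq)
qed

text \<open>The maps on forms are given by definite descriptions. Uniqueness holds because the forms
  \<open>a db\<^sub>1 \<and> \<dots> \<and> db\<^sub>n\<close> generate additively and values outside the carrier are fixed, so
  existence of one map with the prescribed values suffices.\<close>

lemma forms_hom_the:
  fixes G :: "('g, 'k) ring_scheme"
  assumes G: "abelian_group G"
    and ex: "\<exists>g. g \<in> hom (add_monoid (forms R n)) (add_monoid G) \<and>
      (\<forall>a\<in>carrier R. \<forall>bs\<in>tuples (carrier R) n.
        g (a \<odot>\<^bsub>forms R n\<^esub> form_wedge R (map (kahler_d R) bs)) = v a bs)"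
  defines "P \<equiv> \<lambda>\<phi>. \<phi> \<in> hom (add_monoid (forms R n)) (add_monoid G) \<and> \<phi> \<in> extensional (carrier (forms R n)) \<and>
      (\<forall>a\<in>carrier R. \<forall>bs\<in>tuples (carrier R) n.
        \<phi> (a \<odot>\<^bsub>forms R n\<^esub> form_wedge R (map (kahler_d R) bs)) = v a bs)"
  shows "P (THE \<phi>. P \<phi>)"
proof -
  interpret W: module R "forms R n" by (rule forms_module)
  obtain g where g: "g \<in> hom (add_monoid (forms R n)) (add_monoid G)"
    and gv: "\<And>a bs. a \<in> carrier R \<Longrightarrow> bs \<in> tuples (carrier R) n \<Longrightarrow>
        g (a \<odot>\<^bsub>forms R n\<^esub> form_wedge R (map (kahler_d R) bs)) = v a bs"
    using ex by blast
  have gen: "a \<odot>\<^bsub>forms R n\<^esub> form_wedge R (map (kahler_d R) bs) \<in> carrier (forms R n)"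
    if "a \<in> carrier R" "bs \<in> tuples (carrier R) n" for a bs
    using that by (intro W.smult_closed form_wedge_closed map_in_tuples[OF kahler_d_closed])
  have ex: "P (restrict g (carrier (forms R n)))"
    unfolding P_def
  proof (intro conjI ballI)
    show "restrict g (carrier (forms R n)) \<in> hom (add_monoid (forms R n)) (add_monoid G)"
      using g by (auto simp: hom_def)
  qed (use gv gen in simp_all)
  have uniq: "\<phi> = \<psi>" if \<phi>: "P \<phi>" and \<psi>: "P \<psi>" for \<phi> \<psi>
  proof (rule extensionalityI)
    show "\<phi> \<in> extensional (carrier (forms R n))" "\<psi> \<in> extensional (carrier (forms R n))"
      using \<phi> \<psi> unfolding P_def by blast+
    show "\<phi> x = \<psi> x" if "x \<in> carrier (forms R n)" for x
    proof (rule forms_hom_unique[OF G _ _ _ that])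
      show "\<phi> \<in> hom (add_monoid (forms R n)) (add_monoid G)" "\<psi> \<in> hom (add_monoid (forms R n)) (add_monoid G)"
        using \<phi> \<psi> unfolding P_def by blast+
    qed (use \<phi> \<psi> in \<open>simp add: P_def\<close>)
  qed
  show ?thesis by (rule theI[of P, OF ex uniq[OF _ ex]])
qed

lemma form_wedge_d_map_closed:
  "bs \<in> tuples (carrier R) n \<Longrightarrow> form_wedge R (map (kahler_d R) bs) \<in> carrier (forms R n)"
  by (intro form_wedge_closed map_in_tuples[OF kahler_d_closed])

lemma forms_map_properties:
  assumes S: "cring S" and f: "f \<in> ring_hom R S"
  shows "forms_map R S f n \<in> hom (add_monoid (forms R n)) (add_monoid (forms S n))"
    and "\<And>a bs. a \<in> carrier R \<Longrightarrow> bs \<in> tuples (carrier R) n \<Longrightarrow>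
      forms_map R S f n (a \<odot>\<^bsub>forms R n\<^esub> form_wedge R (map (kahler_d R) bs)) =
      f a \<odot>\<^bsub>forms S n\<^esub> form_wedge S (map (\<lambda>b. kahler_d S (f b)) bs)"
proof -
  interpret S: cring S by (rule S)
  interpret KS: module S "kahler S" by (rule S.kahler_module)
  interpret WS: module S "forms S n" by (rule S.forms_module)
  let ?d = "\<lambda>b. kahler_d S (f b)"
  let ?\<phi> = "\<lambda>bs r. f r \<odot>\<^bsub>forms S n\<^esub> form_wedge S (map ?d bs)"
  have fc: "a \<in> carrier R \<Longrightarrow> f a \<in> carrier S" for a using f by (rule ring_hom_closed)
  have dc: "?d b \<in> carrier (kahler S)" if "b \<in> carrier R" for b using fc that by simp
  have dcs: "set (map ?d bs) \<subseteq> carrier (kahler S)" if "set bs \<subseteq> carrier R" for bs using dc that by auto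
  have wc: "form_wedge S (map ?d bs) \<in> carrier (forms S n)" if "bs \<in> tuples (carrier R) n" for bs
    using that by (intro S.form_wedge_closed map_in_tuples[OF dc])
  have fr: "f (a \<oplus> b) = f a \<oplus>\<^bsub>S\<^esub> f b" "f (a \<otimes> b) = f a \<otimes>\<^bsub>S\<^esub> f b"
    if "a \<in> carrier R" "b \<in> carrier R" for a b
    using f that by (auto simp: ring_hom_add ring_hom_mult)
  have md: "multiderivation R (forms S n) n ?\<phi>"
    unfolding multiderivation_def
  proof (intro conjI allI ballI impI, goal_cases)
    case (1 bs)
    then show ?case using wc[of bs]
      by (intro homI) (simp_all add: fc fr WS.smult_l_distr)
  next
    case (2 xs a b ys r)
    then have "form_wedge S (map ?d (xs @ a # ys)) \<in> carrier (forms S n)"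
      "form_wedge S (map ?d (xs @ b # ys)) \<in> carrier (forms S n)" by (intro wc, simp)+
    then show ?case
      using S.form_wedge_add[of "map ?d xs" "map ?d ys" n "?d a" "?d b"] 2 dcs[of xs] dcs[of ys]
      by (simp add: fr fc S.kahler_d_add WS.smult_r_distr)
  next
    case (3 xs a b ys r)
    then have w: "form_wedge S (map ?d (xs @ a # ys)) \<in> carrier (forms S n)"
      "form_wedge S (map ?d (xs @ b # ys)) \<in> carrier (forms S n)" by (intro wc, simp)+
    have "form_wedge S (map ?d (xs @ (a \<otimes> b) # ys)) =
        f a \<odot>\<^bsub>forms S n\<^esub> form_wedge S (map ?d (xs @ b # ys)) \<oplus>\<^bsub>forms S n\<^esub>
        f b \<odot>\<^bsub>forms S n\<^esub> form_wedge S (map ?d (xs @ a # ys))"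
      using S.form_wedge_add[of "map ?d xs" "map ?d ys" n "f a \<odot>\<^bsub>kahler S\<^esub> ?d b" "f b \<odot>\<^bsub>kahler S\<^esub> ?d a"]
        S.form_wedge_smult[of "map ?d xs" "map ?d ys" n "f a" "?d b"]
        S.form_wedge_smult[of "map ?d xs" "map ?d ys" n "f b" "?d a"] 3 dcs[of xs] dcs[of ys]
      by (simp add: fr fc S.kahler_d_mult)
    then show ?case using 3 w
      by (simp add: fr fc WS.smult_r_distr WS.smult_assoc1)
  qed
  have alt: "?\<phi> (xs @ a # a # ys) r = \<zero>\<^bsub>forms S n\<^esub>"
    if "length xs + length ys + 2 = n" "set xs \<subseteq> carrier R" "set ys \<subseteq> carrier R"
      "a \<in> carrier R" "r \<in> carrier R" for xs a ys r
  proof -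
    have "map ?d (xs @ a # a # ys) \<in> tuples (carrier (kahler S)) n"
      using that dcs[of xs] dcs[of ys] dc by simp
    then have "form_wedge S (map ?d (xs @ a # a # ys)) = \<zero>\<^bsub>forms S n\<^esub>"
      by (rule S.form_wedge_not_distinct) simp
    then show ?thesis using that fc by simp
  qed
  note * = forms_hom_the[OF WS.M.abelian_group_axioms forms_universal[OF WS.M.abelian_group_axioms md alt]]
  show "forms_map R S f n \<in> hom (add_monoid (forms R n)) (add_monoid (forms S n))"
    and "\<And>a bs. a \<in> carrier R \<Longrightarrow> bs \<in> tuples (carrier R) n \<Longrightarrow>
      forms_map R S f n (a \<odot>\<^bsub>forms R n\<^esub> form_wedge R (map (kahler_d R) bs)) =
      f a \<odot>\<^bsub>forms S n\<^esub> form_wedge S (map (\<lambda>b. kahler_d S (f b)) bs)"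
    using * unfolding forms_map_def by blast+
qed

text \<open>The Leibniz rule in \<open>b\<^sub>i\<close> for \<open>(r, b\<^sub>1, \<dots>, b\<^sub>n) \<mapsto> dr \<and> db\<^sub>1 \<and> \<dots> \<and> db\<^sub>n\<close> compares \<open>dr \<and> d(ab)\<close> with
  \<open>d(ra) \<and> db + d(rb) \<and> da\<close>; the surplus \<open>r (da \<and> db + db \<and> da)\<close> is zero.\<close>

lemma de_rham_properties:
  shows "de_rham R n \<in> hom (add_monoid (forms R n)) (add_monoid (forms R (Suc n)))"
    and "\<And>a bs. a \<in> carrier R \<Longrightarrow> bs \<in> tuples (carrier R) n \<Longrightarrow>
      de_rham R n (a \<odot>\<^bsub>forms R n\<^esub> form_wedge R (map (kahler_d R) bs)) =
      form_wedge R (map (kahler_d R) (a # bs))"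
proof -
  interpret K: module R "kahler R" by (rule kahler_module)
  interpret W: module R "forms R (Suc n)" by (rule forms_module)
  let ?d = "kahler_d R"
  let ?\<phi> = "\<lambda>bs r. form_wedge R (map ?d (r # bs))"
  have dcs: "set (map ?d bs) \<subseteq> carrier (kahler R)" if "set bs \<subseteq> carrier R" for bs using that by auto
  have wc: "form_wedge R (map ?d bs) \<in> carrier (forms R (Suc n))" if "bs \<in> tuples (carrier R) (Suc n)" for bs
    using that by (rule form_wedge_d_map_closed)
  have md: "multiderivation R (forms R (Suc n)) n ?\<phi>"
    unfolding multiderivation_def
  proof (intro conjI allI ballI impI, goal_cases)
    case (1 bs)
    then have bs: "length bs = n" "set bs \<subseteq> carrier R" by (auto simp: tuples_def)
    show ?case
    proof (rule homI)
      fix r assume "r \<in> carrier (add_monoid R)"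
      then show "?\<phi> bs r \<in> carrier (add_monoid (forms R (Suc n)))" using wc[of "r # bs"] 1 by simp
    next
      fix r s assume "r \<in> carrier (add_monoid R)" "s \<in> carrier (add_monoid R)"
      then show "?\<phi> bs (r \<otimes>\<^bsub>add_monoid R\<^esub> s) = ?\<phi> bs r \<otimes>\<^bsub>add_monoid (forms R (Suc n))\<^esub> ?\<phi> bs s"
        using form_wedge_add[of "[]" "map ?d bs" "Suc n" "?d r" "?d s"] bs dcs[of bs]
        by (simp add: kahler_d_add)
    qed
  next
    case (2 xs a b ys r)
    then show ?case
      using form_wedge_add[of "?d r # map ?d xs" "map ?d ys" "Suc n" "?d a" "?d b"] dcs[of xs] dcs[of ys]
      by (simp add: kahler_d_add)
  next
    case (3 xs a b ys r)
    let ?w = "\<lambda>u v. form_wedge R (u # map ?d xs @ v # map ?d ys)"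
    have wcl: "?w u v \<in> carrier (forms R (Suc n))" if "u \<in> carrier (kahler R)" "v \<in> carrier (kahler R)" for u v
      using that 3 dcs[of xs] dcs[of ys] by (intro form_wedge_closed) simp
    have a1: "?w (u \<oplus>\<^bsub>kahler R\<^esub> u') v = ?w u v \<oplus>\<^bsub>forms R (Suc n)\<^esub> ?w u' v"
      if "u \<in> carrier (kahler R)" "u' \<in> carrier (kahler R)" "v \<in> carrier (kahler R)" for u u' v
      using form_wedge_add[of "[]" "map ?d xs @ v # map ?d ys" "Suc n" u u'] that 3 dcs[of xs] dcs[of ys] by simp
    have a2: "?w u (v \<oplus>\<^bsub>kahler R\<^esub> v') = ?w u v \<oplus>\<^bsub>forms R (Suc n)\<^esub> ?w u v'"
      if "u \<in> carrier (kahler R)" "v' \<in> carrier (kahler R)" "v \<in> carrier (kahler R)" for u v v'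
      using form_wedge_add[of "u # map ?d xs" "map ?d ys" "Suc n" v v'] that 3 dcs[of xs] dcs[of ys] by simp
    have s1: "?w (s \<odot>\<^bsub>kahler R\<^esub> u) v = s \<odot>\<^bsub>forms R (Suc n)\<^esub> ?w u v"
      if "u \<in> carrier (kahler R)" "s \<in> carrier R" "v \<in> carrier (kahler R)" for u s v
      using form_wedge_smult[of "[]" "map ?d xs @ v # map ?d ys" "Suc n" s u] that 3 dcs[of xs] dcs[of ys] by simp
    have s2: "?w u (s \<odot>\<^bsub>kahler R\<^esub> v) = s \<odot>\<^bsub>forms R (Suc n)\<^esub> ?w u v"
      if "u \<in> carrier (kahler R)" "s \<in> carrier R" "v \<in> carrier (kahler R)" for u s v
      using form_wedge_smult[of "u # map ?d xs" "map ?d ys" "Suc n" s v] that 3 dcs[of xs] dcs[of ys] by simp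
    have sw: "?w (?d a) (?d b) = \<ominus>\<^bsub>forms R (Suc n)\<^esub> ?w (?d b) (?d a)"
      using form_wedge_swap[of "[]" "map ?d xs" "map ?d ys" "Suc n" "?d a" "?d b"] 3 dcs[of xs] dcs[of ys] by simp
    define A where "A = a \<odot>\<^bsub>forms R (Suc n)\<^esub> ?w (?d r) (?d b)"
    define B where "B = b \<odot>\<^bsub>forms R (Suc n)\<^esub> ?w (?d r) (?d a)"
    define C where "C = r \<odot>\<^bsub>forms R (Suc n)\<^esub> ?w (?d b) (?d a)"
    have ABC: "A \<in> carrier (forms R (Suc n))" "B \<in> carrier (forms R (Suc n))" "C \<in> carrier (forms R (Suc n))"
      using 3 unfolding A_def B_def C_def by (simp_all add: wcl)
    have "?w (?d r) (?d (a \<otimes> b)) = A \<oplus>\<^bsub>forms R (Suc n)\<^esub> B"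
      using 3 by (simp add: kahler_d_mult a2 s2 A_def B_def)
    moreover have "?w (?d (r \<otimes> a)) (?d b) = \<ominus>\<^bsub>forms R (Suc n)\<^esub> C \<oplus>\<^bsub>forms R (Suc n)\<^esub> A"
      using 3 by (simp add: kahler_d_mult a1 s1 A_def C_def sw W.smult_r_minus wcl)
    moreover have "?w (?d (r \<otimes> b)) (?d a) = C \<oplus>\<^bsub>forms R (Suc n)\<^esub> B"
      using 3 by (simp add: kahler_d_mult a1 s1 B_def C_def)
    moreover have "(\<ominus>\<^bsub>forms R (Suc n)\<^esub> C \<oplus>\<^bsub>forms R (Suc n)\<^esub> A) \<oplus>\<^bsub>forms R (Suc n)\<^esub> (C \<oplus>\<^bsub>forms R (Suc n)\<^esub> B)
        = A \<oplus>\<^bsub>forms R (Suc n)\<^esub> B"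
      using ABC by (simp add: W.M.a_comm[of "\<ominus>\<^bsub>forms R (Suc n)\<^esub> C"] W.M.a_assoc W.M.r_neg1)
    ultimately show ?case by simp
  qed
  have alt: "?\<phi> (xs @ a # a # ys) r = \<zero>\<^bsub>forms R (Suc n)\<^esub>"
    if "length xs + length ys + 2 = n" "set xs \<subseteq> carrier R" "set ys \<subseteq> carrier R"
      "a \<in> carrier R" "r \<in> carrier R" for xs a ys r
  proof (rule form_wedge_not_distinct)
    show "map ?d (r # xs @ a # a # ys) \<in> tuples (carrier (kahler R)) (Suc n)"
      using that dcs[of xs] dcs[of ys] by simp
  qed simp
  note * = forms_hom_the[OF W.M.abelian_group_axioms forms_universal[OF W.M.abelian_group_axioms md alt]]
  show "de_rham R n \<in> hom (add_monoid (forms R n)) (add_monoid (forms R (Suc n)))"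
    and "\<And>a bs. a \<in> carrier R \<Longrightarrow> bs \<in> tuples (carrier R) n \<Longrightarrow>
      de_rham R n (a \<odot>\<^bsub>forms R n\<^esub> form_wedge R (map (kahler_d R) bs)) =
      form_wedge R (map (kahler_d R) (a # bs))"
    using * unfolding de_rham_def Suc_eq_plus1 by blast+
qed

text \<open>The forms \<open>dc/c\<close> are closed: rewriting them as \<open>c\<inverse> dc\<close>, the differential of the
  coefficient \<open>c\<inverse>\<close> is a multiple of \<open>dc\<close> and is killed by the factor \<open>dc\<close>.\<close>

lemma de_rham_dlog:
  assumes "a \<in> carrier R" "set cs \<subseteq> Units R" "length cs = n"
  shows "de_rham R n (a \<odot>\<^bsub>forms R n\<^esub> form_wedge R (map (dlog R) cs)) =
    form_wedge R (kahler_d R a # map (dlog R) cs)"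
proof -
  interpret K: module R "kahler R" by (rule kahler_module)
  interpret W: module R "forms R n" by (rule forms_module)
  interpret W': module R "forms R (Suc n)" by (rule forms_module)
  let ?d = "kahler_d R"
  have "a \<in> carrier R \<Longrightarrow> set bs \<subseteq> carrier R \<Longrightarrow> set cs \<subseteq> Units R \<Longrightarrow> length bs + length cs = n \<Longrightarrow>
     de_rham R n (a \<odot>\<^bsub>forms R n\<^esub> form_wedge R (map ?d bs @ map (dlog R) cs)) =
     form_wedge R (?d a # map ?d bs @ map (dlog R) cs)" for bs
  proof (induction cs arbitrary: a bs)
    case Nil
    then show ?case using de_rham_properties(2)[of a bs n] by (simp add: tuples_def)
  next
    case (Cons c cs)
    have c: "c \<in> Units R" "c \<in> carrier R" "inv c \<in> carrier R" using Cons.prems by auto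
    have ds: "set (map ?d bs) \<subseteq> carrier (kahler R)" "set (map (dlog R) cs) \<subseteq> carrier (kahler R)"
      using Cons.prems dlog_closed by auto
    let ?B = "map ?d bs" and ?C = "map (dlog R) cs"
    let ?w = "\<lambda>u. form_wedge R (u # ?B @ ?d c # ?C)"
    have wcl: "?w u \<in> carrier (forms R (Suc n))" if "u \<in> carrier (kahler R)" for u
      using that Cons.prems c ds by (intro form_wedge_closed) simp
    have wcl': "form_wedge R (?B @ ?d c # ?C) \<in> carrier (forms R n)"
      using Cons.prems c ds by (intro form_wedge_closed) simp
    have "a \<odot>\<^bsub>forms R n\<^esub> form_wedge R (?B @ dlog R c # ?C) =
        (a \<otimes> inv c) \<odot>\<^bsub>forms R n\<^esub> form_wedge R (map ?d (bs @ [c]) @ ?C)"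
      using form_wedge_smult[of ?B ?C n "inv c" "?d c"] Cons.prems c ds wcl'
      by (simp add: dlog_def W.smult_assoc1)
    also have "de_rham R n \<dots> = form_wedge R (?d (a \<otimes> inv c) # map ?d (bs @ [c]) @ ?C)"
      using Cons.prems c by (intro Cons.IH) auto
    also have "\<dots> = ?w (a \<odot>\<^bsub>kahler R\<^esub> ?d (inv c) \<oplus>\<^bsub>kahler R\<^esub> inv c \<odot>\<^bsub>kahler R\<^esub> ?d a)"
      using Cons.prems c by (simp add: kahler_d_mult)
    also have "\<dots> = a \<odot>\<^bsub>forms R (Suc n)\<^esub> ?w (?d (inv c)) \<oplus>\<^bsub>forms R (Suc n)\<^esub> inv c \<odot>\<^bsub>forms R (Suc n)\<^esub> ?w (?d a)"
      using form_wedge_add[of "[]" "?B @ ?d c # ?C" "Suc n" "a \<odot>\<^bsub>kahler R\<^esub> ?d (inv c)" "inv c \<odot>\<^bsub>kahler R\<^esub> ?d a"]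
        form_wedge_smult[of "[]" "?B @ ?d c # ?C" "Suc n" a "?d (inv c)"]
        form_wedge_smult[of "[]" "?B @ ?d c # ?C" "Suc n" "inv c" "?d a"] Cons.prems c ds
      by simp
    also have "?w (?d (inv c)) = \<zero>\<^bsub>forms R (Suc n)\<^esub>"
    proof -
      have "?w (?d (inv c)) = ?w ((\<ominus> (inv c \<otimes> inv c)) \<odot>\<^bsub>kahler R\<^esub> ?d c)"
        using c by (simp add: kahler_d_inv K.smult_l_minus)
      also have "\<dots> = (\<ominus> (inv c \<otimes> inv c)) \<odot>\<^bsub>forms R (Suc n)\<^esub> ?w (?d c)"
        using form_wedge_smult[of "[]" "?B @ ?d c # ?C" "Suc n" "\<ominus> (inv c \<otimes> inv c)" "?d c"] Cons.prems c ds by simp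
      also have "?w (?d c) = \<zero>\<^bsub>forms R (Suc n)\<^esub>"
        using Cons.prems c ds by (intro form_wedge_not_distinct) auto
      finally show ?thesis using c by simp
    qed
    also have "a \<odot>\<^bsub>forms R (Suc n)\<^esub> \<zero>\<^bsub>forms R (Suc n)\<^esub> \<oplus>\<^bsub>forms R (Suc n)\<^esub> inv c \<odot>\<^bsub>forms R (Suc n)\<^esub> ?w (?d a)
        = form_wedge R (?d a # ?B @ dlog R c # ?C)"
      using form_wedge_smult[of "?d a # ?B" ?C "Suc n" "inv c" "?d c"] Cons.prems c ds wcl
      by (simp add: dlog_def)
    finally show ?case by simp
  qed
  from this[of "[]"] show ?thesis using assms by simp
qed

lemma forms_map_smult:
  assumes S: "cring S" and f: "f \<in> ring_hom R S" and r: "r \<in> carrier R" and x: "x \<in> carrier (forms R n)"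
  shows "forms_map R S f n (r \<odot>\<^bsub>forms R n\<^esub> x) = f r \<odot>\<^bsub>forms S n\<^esub> forms_map R S f n x"
proof -
  interpret S: cring S by (rule S)
  interpret W: module R "forms R n" by (rule forms_module)
  interpret WS: module S "forms S n" by (rule S.forms_module)
  interpret h: abelian_group_hom "forms R n" "forms S n" "forms_map R S f n"
    by (rule abelian_group_hom_of_hom[OF W.M.abelian_group_axioms WS.M.abelian_group_axioms
          forms_map_properties(1)[OF S f]])
  have fc: "a \<in> carrier R \<Longrightarrow> f a \<in> carrier S" for a using f by (rule ring_hom_closed)
  from x show ?thesis
  proof (induction x rule: forms_induct)
    case (gen a bs)
    have "form_wedge S (map (\<lambda>b. kahler_d S (f b)) bs) \<in> carrier (forms S n)"
      using gen fc by (intro S.form_wedge_closed map_in_tuples[of "carrier R"]) auto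
    then show ?case
      using gen r fc by (simp add: forms_map_properties(2)[OF S f] form_wedge_d_map_closed
          W.smult_assoc1[symmetric] WS.smult_assoc1[symmetric] ring_hom_mult[OF f])
  next
    case zero then show ?case using r fc by simp
  next
    case (add x y) then show ?case using r fc by (simp add: W.smult_r_distr WS.smult_r_distr)
  qed
qed

lemma forms_map_de_rham:
  assumes S: "cring S" and f: "f \<in> ring_hom R S" and x: "x \<in> carrier (forms R n)"
  shows "forms_map R S f (Suc n) (de_rham R n x) = de_rham S n (forms_map R S f n x)"
proof -
  interpret S: cring S by (rule S)
  interpret W: module R "forms R n" by (rule forms_module)
  interpret W': module R "forms R (Suc n)" by (rule forms_module)
  interpret WS: module S "forms S n" by (rule S.forms_module)
  interpret WS': module S "forms S (Suc n)" by (rule S.forms_module)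
  interpret h: abelian_group_hom "forms R n" "forms S n" "forms_map R S f n"
    by (rule abelian_group_hom_of_hom[OF W.M.abelian_group_axioms WS.M.abelian_group_axioms
          forms_map_properties(1)[OF S f]])
  interpret h': abelian_group_hom "forms R (Suc n)" "forms S (Suc n)" "forms_map R S f (Suc n)"
    by (rule abelian_group_hom_of_hom[OF W'.M.abelian_group_axioms WS'.M.abelian_group_axioms
          forms_map_properties(1)[OF S f]])
  interpret d: abelian_group_hom "forms R n" "forms R (Suc n)" "de_rham R n"
    by (rule abelian_group_hom_of_hom[OF W.M.abelian_group_axioms W'.M.abelian_group_axioms
          de_rham_properties(1)])
  interpret dS: abelian_group_hom "forms S n" "forms S (Suc n)" "de_rham S n"
    by (rule abelian_group_hom_of_hom[OF WS.M.abelian_group_axioms WS'.M.abelian_group_axioms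
          S.de_rham_properties(1)])
  have fc: "a \<in> carrier R \<Longrightarrow> f a \<in> carrier S" for a using f by (rule ring_hom_closed)
  from x show ?thesis
  proof (induction x rule: forms_induct)
    case (gen a bs)
    have ab: "a # bs \<in> tuples (carrier R) (Suc n)" using gen by simp
    have fbs: "map f bs \<in> tuples (carrier S) n" using gen fc by (intro map_in_tuples[of "carrier R"]) auto
    have "form_wedge S (map (\<lambda>b. kahler_d S (f b)) (a # bs)) \<in> carrier (forms S (Suc n))"
      using ab fc by (intro S.form_wedge_closed map_in_tuples[of "carrier R"]) auto
    then have "forms_map R S f (Suc n) (form_wedge R (map (kahler_d R) (a # bs))) =
        form_wedge S (map (\<lambda>b. kahler_d S (f b)) (a # bs))"
      using forms_map_properties(2)[OF S f one_closed ab] form_wedge_d_map_closed[OF ab] ring_hom_one[OF f]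
      by (simp del: list.map)
    moreover have "de_rham S n (f a \<odot>\<^bsub>forms S n\<^esub> form_wedge S (map (\<lambda>b. kahler_d S (f b)) bs)) =
        form_wedge S (map (kahler_d S) (f a # map f bs))"
      using S.de_rham_properties(2)[OF fc fbs, of a] gen by (simp add: comp_def)
    ultimately show ?case
      using gen by (simp add: forms_map_properties(2)[OF S f] de_rham_properties(2) comp_def)
  qed simp_all
qed

end

section \<open>Additivity of the truncated logarithm\<close>

text \<open>Ring homomorphisms from a ring given by a type class into the ring \<open>R\<close> with its carrier.
  Polynomial identities are proved in type classes and transported along such maps.\<close>

definition eval_hom :: "('a, 'm) ring_scheme \<Rightarrow> ('c::comm_ring_1 \<Rightarrow> 'a) \<Rightarrow> bool" where
  "eval_hom R \<phi> \<longleftrightarrow> (\<forall>c. \<phi> c \<in> carrier R) \<and> (\<forall>c d. \<phi> (c + d) = \<phi> c \<oplus>\<^bsub>R\<^esub> \<phi> d)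
     \<and> (\<forall>c d. \<phi> (c * d) = \<phi> c \<otimes>\<^bsub>R\<^esub> \<phi> d) \<and> \<phi> 1 = \<one>\<^bsub>R\<^esub>"

definition poly_eval :: "('a, 'm) ring_scheme \<Rightarrow> ('c::comm_ring_1 \<Rightarrow> 'a) \<Rightarrow> 'a \<Rightarrow> 'c poly \<Rightarrow> 'a" where
  "poly_eval R \<phi> x p = fold_coeffs (\<lambda>c v. \<phi> c \<oplus>\<^bsub>R\<^esub> x \<otimes>\<^bsub>R\<^esub> v) p \<zero>\<^bsub>R\<^esub>"

abbreviation (in cring) nat_one :: "nat \<Rightarrow> 'a" where
  "nat_one k \<equiv> add_pow R k \<one>"

context cring
begin

lemma nat_mult_one: "nat_one (m * n) = nat_one m \<otimes> nat_one n"
  using add_pow_ldistr[of \<one> "nat_one n" m] add.nat_pow_pow[of \<one> m n] by (simp add: mult.commute)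

lemma int_eval_hom: "eval_hom R (\<lambda>z::int. add_pow R z \<one>)"
  unfolding eval_hom_def
proof (intro conjI allI)
  fix c d :: int
  show "add_pow R (c + d) \<one> = add_pow R c \<one> \<oplus> add_pow R d \<one>" by (rule add.int_pow_mult) simp
  show "add_pow R (c * d) \<one> = add_pow R c \<one> \<otimes> add_pow R d \<one>"
    using add_pow_ldistr_int[of \<one> "add_pow R d \<one>" c] add.int_pow_pow[of \<one> c d] by (simp add: mult.commute)
qed simp_all

context
  fixes \<phi> :: "'c::comm_ring_1 \<Rightarrow> 'a"
  assumes \<phi>: "eval_hom R \<phi>"
begin

lemma eval_closed [simp]: "\<phi> c \<in> carrier R"
  and eval_add: "\<phi> (c + d) = \<phi> c \<oplus> \<phi> d"
  and eval_mult: "\<phi> (c * d) = \<phi> c \<otimes> \<phi> d"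
  and eval_one: "\<phi> 1 = \<one>"
  using \<phi> unfolding eval_hom_def by blast+

lemma eval_zero: "\<phi> 0 = \<zero>"
  using eval_add[of 0 0] add.r_cancel_one'[of "\<phi> 0" "\<phi> 0"] by simp

lemma eval_minus: "\<phi> (- c) = \<ominus> \<phi> c"
  using eval_add[of "- c" c] minus_equality[of "\<phi> (- c)" "\<phi> c"] eval_zero by simp

lemma eval_diff: "\<phi> (c - d) = \<phi> c \<ominus> \<phi> d"
  using eval_add[of c "- d"] eval_minus by (simp add: minus_eq)

lemma eval_power: "\<phi> (c ^ k) = \<phi> c [^] k"
  by (induction k) (simp_all add: eval_one eval_mult m_comm)

lemma eval_of_nat: "\<phi> (of_nat k) = nat_one k"
  by (induction k) (simp_all add: eval_zero eval_add eval_one a_comm)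

lemma eval_sum: "finite A \<Longrightarrow> \<phi> (sum f A) = (\<Oplus>i\<in>A. \<phi> (f i))"
  by (induction A rule: finite_induct) (simp_all add: eval_zero eval_add)

lemma poly_eval_0: "poly_eval R \<phi> x 0 = \<zero>"
  by (simp add: poly_eval_def)

lemma poly_eval_pCons: "x \<in> carrier R \<Longrightarrow> poly_eval R \<phi> x (pCons c p) = \<phi> c \<oplus> x \<otimes> poly_eval R \<phi> x p"
  by (cases "c = 0 \<and> p = 0") (auto simp: poly_eval_def eval_zero)

lemma poly_eval_hom:
  assumes x: "x \<in> carrier R"
  shows "eval_hom R (poly_eval R \<phi> x)"
proof -
  note ev = poly_eval_0 poly_eval_pCons[OF x]
  have cl [simp]: "poly_eval R \<phi> x p \<in> carrier R" for p
    by (induction p) (use x in \<open>simp_all add: ev\<close>)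
  have ad: "poly_eval R \<phi> x (p + q) = poly_eval R \<phi> x p \<oplus> poly_eval R \<phi> x q" for p q
  proof (induction p q rule: poly_induct2)
    case (pCons a p b q)
    then show ?case using x by (simp add: ev eval_add r_distr a_ac)
  qed (simp add: ev)
  have sm: "poly_eval R \<phi> x (Polynomial.smult c p) = \<phi> c \<otimes> poly_eval R \<phi> x p" for c p
    by (induction p) (use x in \<open>simp_all add: ev eval_mult r_distr m_ac\<close>)
  have mu: "poly_eval R \<phi> x (p * q) = poly_eval R \<phi> x p \<otimes> poly_eval R \<phi> x q" for p q
  proof (induction p)
    case (pCons a p)
    then show ?case using x by (simp add: ev ad sm eval_zero l_distr m_assoc)
  qed (simp add: ev)
  show ?thesis unfolding eval_hom_def
    using cl ad mu x by (simp add: one_pCons ev eval_one)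
qed

end

end

text \<open>The factor \<open>(N - 1)!\<close> makes the truncated logarithm an integer polynomial.\<close>

definition scaled_log :: "nat \<Rightarrow> 'c::comm_ring_1 \<Rightarrow> 'c" where
  "scaled_log N z = (\<Sum>k\<in>{1..<N}. (-1) ^ (k + 1) * of_nat (fact (N - 1) div k) * z ^ k)"

lemma pderiv_minus_one_power: "pderiv ((-1) ^ k :: 'c::idom poly) = 0"
  by (cases "even k") (simp_all add: pderiv_minus)

lemma pderiv_scaled_log:
  fixes z :: "'c::idom poly"
  assumes "N \<ge> 1"
  shows "(1 + z) * pderiv (scaled_log N z) = of_nat (fact (N - 1)) * (1 - (- z) ^ (N - 1)) * pderiv z"
proof -
  have summand: "pderiv ((-1) ^ (k + 1) * of_nat (fact (N - 1) div k) * z ^ k) =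
      of_nat (fact (N - 1)) * (- z) ^ (k - 1) * pderiv z" if k: "k \<in> {1..<N}" for k
  proof -
    obtain j where j: "k = Suc j" using k by (cases k) auto
    have "k dvd (fact (N - 1) :: nat)" using k by (intro dvd_fact) auto
    then have D: "(of_nat (fact (N - 1)) :: 'c poly) = of_nat (fact (N - 1) div k) * of_nat k"
      by (metis dvd_div_mult_self of_nat_mult)
    have "pderiv (z ^ k) = of_nat k * z ^ j * pderiv z"
      unfolding j pderiv_power_Suc by (simp add: of_nat_poly del: of_nat_Suc)
    moreover have "pderiv ((-1) ^ (k + 1) * of_nat (fact (N - 1) div k) :: 'c poly) = 0"
      unfolding pderiv_mult pderiv_minus_one_power by (simp add: of_nat_poly pderiv_pCons)
    ultimately have "pderiv ((-1) ^ (k + 1) * of_nat (fact (N - 1) div k) * z ^ k) =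
        (-1) ^ (k + 1) * of_nat (fact (N - 1) div k) * (of_nat k * z ^ j * pderiv z)"
      by (simp only: pderiv_mult mult_zero_right add_0_right)
    also have "\<dots> = of_nat (fact (N - 1)) * ((-1) ^ j * z ^ j) * pderiv z"
      unfolding D j by (simp add: algebra_simps)
    also have "(-1) ^ j * z ^ j = (- z) ^ (k - 1)"
      unfolding j by (simp add: power_mult_distrib[symmetric])
    finally show ?thesis .
  qed
  have "pderiv (scaled_log N z) =
      (\<Sum>k\<in>{1..<N}. pderiv ((-1) ^ (k + 1) * of_nat (fact (N - 1) div k) * z ^ k))"
    unfolding scaled_log_def using higher_pderiv_sum[of 1] by simp
  also have "\<dots> = (\<Sum>k\<in>{1..<N}. of_nat (fact (N - 1)) * (- z) ^ (k - 1) * pderiv z)"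
    using summand by (rule sum.cong[OF refl])
  also have "\<dots> = (\<Sum>j<N - 1. of_nat (fact (N - 1)) * (- z) ^ j * pderiv z)"
    by (rule sum.reindex_bij_witness[of _ Suc "\<lambda>k. k - 1"]) auto
  also have "\<dots> = of_nat (fact (N - 1)) * (\<Sum>j<N - 1. (- z) ^ j) * pderiv z"
    by (simp add: sum_distrib_left sum_distrib_right)
  finally have "(1 + z) * pderiv (scaled_log N z) =
      of_nat (fact (N - 1)) * ((1 - (- z)) * (\<Sum>j<N - 1. (- z) ^ j)) * pderiv z"
    by (simp add: mult_ac)
  then show ?thesis unfolding one_diff_power_eq[symmetric] .
qed

text \<open>Divisibility of the \<open>i\<close>-th coefficient by \<open>Y\<^bsup>M-i\<^esup>\<close> says that a polynomial in \<open>X\<close> and \<open>Y\<close>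
  has no terms of total degree less than \<open>M\<close>.\<close>

definition order_ge :: "nat \<Rightarrow> int poly poly \<Rightarrow> bool" where
  "order_ge M p \<longleftrightarrow> (\<forall>i. monom 1 (M - i) dvd coeff p i)"

lemma monom_dvd_mono: "m \<le> n \<Longrightarrow> monom 1 m dvd (monom 1 n :: int poly)"
  by (simp add: monom_1_dvd_iff')

lemma order_ge_diff: "order_ge M p \<Longrightarrow> order_ge M q \<Longrightarrow> order_ge M (p - q)"
  unfolding order_ge_def by (simp add: dvd_diff)

lemma order_ge_add: "order_ge M p \<Longrightarrow> order_ge M q \<Longrightarrow> order_ge M (p + q)"
  unfolding order_ge_def by (simp add: dvd_add)

lemma order_ge_minus: "order_ge M p \<Longrightarrow> order_ge M (- p)"
  unfolding order_ge_def by simp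

lemma order_ge_mult:
  assumes "order_ge M p" "order_ge L q"
  shows "order_ge (M + L) (p * q)"
  unfolding order_ge_def coeff_mult
proof (intro allI dvd_sum)
  fix i k :: nat assume "k \<in> {..i}"
  have "monom 1 (M - k) * monom 1 (L - (i - k)) dvd coeff p k * coeff q (i - k)"
    using assms unfolding order_ge_def by (intro mult_dvd_mono) auto
  moreover have "monom 1 (M + L - i) dvd (monom 1 (M - k) * monom 1 (L - (i - k)) :: int poly)"
    using \<open>k \<in> {..i}\<close> unfolding mult_monom by (simp add: monom_dvd_mono)
  ultimately show "monom 1 (M + L - i) dvd coeff p k * coeff q (i - k)" by (rule dvd_trans[rotated])
qed

lemma order_ge_0: "order_ge 0 p"
  unfolding order_ge_def by (simp add: monom_1_dvd_iff')

lemma order_ge_power: "order_ge 1 p \<Longrightarrow> order_ge k (p ^ k)"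
  by (induction k) (use order_ge_mult[of 1 p] in \<open>auto simp: order_ge_0\<close>)

lemma order_ge_cancel:
  assumes "order_ge M ((1 + [:0, 1:]) * p)"
  shows "order_ge M p"
  unfolding order_ge_def
proof
  fix i
  show "monom 1 (M - i) dvd coeff p i"
  proof (induction i)
    case 0
    then show ?case using assms unfolding order_ge_def by (auto simp: distrib_right dest: spec[of _ 0])
  next
    case (Suc i)
    have "monom 1 (M - Suc i) dvd coeff p (Suc i) + coeff p i"
      using assms unfolding order_ge_def by (auto simp: distrib_right dest: spec[of _ "Suc i"])
    moreover have "monom 1 (M - Suc i) dvd coeff p i"
      by (rule dvd_trans[OF _ Suc.IH]) (simp add: monom_dvd_mono)
    ultimately show ?case using dvd_add_left_iff by blast
  qed
qed

text \<open>The defect of additivity vanishes for \<open>X = 0\<close>. Since \<open>log\<close> has derivative \<open>1/(1 + z)\<close> up to the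
  truncation error, \<open>1 + X\<close> times its derivative in \<open>X\<close> is \<open>(N - 1)!\<close> times a difference of two
  \<open>(N - 1)\<close>-st powers of polynomials without constant term.\<close>

lemma scaled_log_defect:
  fixes X Y :: "int poly poly"
  assumes N: "N \<ge> 1"
  defines "X \<equiv> [:0, 1:]" and "Y \<equiv> [:[:0, 1:]:]"
  shows "order_ge N (scaled_log N (X + Y + X * Y) - scaled_log N X - scaled_log N Y)"
proof -
  let ?Z = "X + Y + X * Y"
  let ?D = "of_nat (fact (N - 1)) :: int poly poly"
  define G where "G = scaled_log N ?Z - scaled_log N X - scaled_log N Y"
  have oX: "order_ge 1 X"
    unfolding order_ge_def X_def
  proof
    fix i show "monom 1 (1 - i) dvd coeff [:0, 1 :: int poly:] i"
      by (cases i) (simp_all add: monom_1_dvd_iff')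
  qed
  have oY: "order_ge 1 Y"
    unfolding order_ge_def Y_def
  proof
    fix i show "monom 1 (1 - i) dvd coeff [:[:0, 1 :: int:]:] i"
      by (cases i) (simp_all add: monom_1_dvd_iff')
  qed
  have "order_ge 2 (X * Y)" using order_ge_mult[OF oX oY] by (simp add: numeral_2_eq_2)
  then have "order_ge 1 (X * Y)"
    unfolding order_ge_def by (meson diff_le_mono dvd_trans monom_dvd_mono one_le_numeral)
  then have oZ: "order_ge 1 ?Z" using oX oY by (intro order_ge_add)
  have dX: "pderiv X = 1" and dY: "pderiv Y = 0" unfolding X_def Y_def by (simp_all add: pderiv_pCons)
  have dZ: "pderiv ?Z = 1 + Y" by (simp add: pderiv_add pderiv_mult dX dY)
  (* The argument Z of the logarithm of the product satisfies 1 + Z = (1 + X) (1 + Y). The factor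
     1 + Y also occurs in the derivative of Z and is cancelled. *)
  have Y1: "1 + Y \<noteq> 0" unfolding Y_def by (simp add: one_pCons)
  have "(1 + Y) * ((1 + X) * pderiv (scaled_log N ?Z)) = (1 + ?Z) * pderiv (scaled_log N ?Z)"
    unfolding distrib_left distrib_right mult_1 mult_1_right by (simp only: ac_simps)
  also have "\<dots> = (1 + Y) * (?D * (1 - (- ?Z) ^ (N - 1)))"
    unfolding pderiv_scaled_log[OF N] dZ by (simp only: mult_ac)
  finally have 1: "(1 + X) * pderiv (scaled_log N ?Z) = ?D * (1 - (- ?Z) ^ (N - 1))"
    unfolding mult_cancel_left using Y1 by blast
  have 2: "(1 + X) * pderiv (scaled_log N X) = ?D * (1 - (- X) ^ (N - 1))"
    unfolding pderiv_scaled_log[OF N] dX by (rule mult_1_right)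
  have "(1 + Y) * pderiv (scaled_log N Y) = 0"
    unfolding pderiv_scaled_log[OF N] dY by simp
  then have 3: "pderiv (scaled_log N Y) = 0" using Y1 by simp
  have eq: "(1 + X) * pderiv G = ?D * ((- X) ^ (N - 1) - (- ?Z) ^ (N - 1))"
    unfolding G_def pderiv_diff 3 right_diff_distrib 1 2 by simp
  have "order_ge (N - 1) ((- X) ^ (N - 1) - (- ?Z) ^ (N - 1))"
    by (intro order_ge_diff order_ge_power order_ge_minus oX oZ)
  then have "order_ge (0 + (N - 1)) (?D * ((- X) ^ (N - 1) - (- ?Z) ^ (N - 1)))"
    by (intro order_ge_mult order_ge_0)
  then have "order_ge (N - 1) ((1 + X) * pderiv G)" unfolding eq add_0 .
  then have dG: "order_ge (N - 1) (pderiv G)" unfolding X_def by (rule order_ge_cancel)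
  have G0: "coeff G 0 = 0"
  proof -
    have h: "poly (scaled_log N z) 0 = scaled_log N (poly z 0)" for z :: "int poly poly"
      by (simp add: scaled_log_def poly_sum)
    have "scaled_log N (0 :: int poly) = 0" by (auto simp: scaled_log_def intro!: sum.neutral)
    then have "poly G 0 = 0" by (simp add: G_def h X_def Y_def)
    then show ?thesis by (simp add: poly_0_coeff_0)
  qed
  have "monom 1 (N - i) dvd coeff G i" for i
  proof (cases i)
    case 0 then show ?thesis by (simp add: G0)
  next
    case (Suc j)
    have "monom 1 (N - 1 - j) dvd of_nat (Suc j) * coeff G (Suc j)"
      using dG unfolding order_ge_def coeff_pderiv by blast
    then show ?thesis
      unfolding Suc monom_1_dvd_iff' by (simp add: of_nat_poly del: of_nat_Suc)
  qed
  then show ?thesis unfolding order_ge_def G_def by blast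
qed

context cring
begin

lemma ideal_power_ideal:
  assumes "ideal I R"
  shows "ideal (I [^]\<^bsub>ideals_set R\<^esub> (k::nat)) R"
  by (induction k) (auto simp: ideals_set_def nat_pow_def intro: oneideal ideal_prod_is_ideal assms)

lemma one_ideals_set: "\<one>\<^bsub>ideals_set R\<^esub> = carrier R"
  by (simp add: ideals_set_def)

lemma ideal_power_Suc: "I [^]\<^bsub>ideals_set R\<^esub> Suc k = (I [^]\<^bsub>ideals_set R\<^esub> k) \<cdot> I"
  by (simp add: ideals_set_def nat_pow_def)

lemma ideal_power_mult:
  assumes "ideal I R" "x \<in> I" "y \<in> I [^]\<^bsub>ideals_set R\<^esub> k"
  shows "x \<otimes> y \<in> I [^]\<^bsub>ideals_set R\<^esub> Suc k"
proof -
  have "x \<in> carrier R" "y \<in> carrier R"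
    using assms ideal.Icarr ideal_power_ideal by metis+
  then show ?thesis
    unfolding ideal_power_Suc using ideal_prod.prod[OF assms(3,2), of R] by (simp add: m_comm)
qed

lemma ideal_power_pow:
  assumes "ideal I R" "x \<in> I"
  shows "x [^] (k::nat) \<in> I [^]\<^bsub>ideals_set R\<^esub> k"
proof (induction k)
  case 0 then show ?case by (simp add: one_ideals_set)
next
  case (Suc k)
  have "x \<in> carrier R" using assms ideal.Icarr by metis
  then show ?case using ideal_power_mult[OF assms Suc.IH] by (simp add: m_comm)
qed

text \<open>The coefficients may themselves be evaluations of polynomials in further elements of \<open>I\<close>; then
  the bound on them and the exponent of \<open>x\<close> add up to the total degree.\<close>

lemma poly_eval_in_ideal_power:
  fixes \<phi> :: "'c::comm_ring_1 \<Rightarrow> 'a"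
  assumes I: "ideal I R" and \<phi>: "eval_hom R \<phi>" and x: "x \<in> I"
  shows "(\<And>i. \<phi> (coeff p i) \<in> I [^]\<^bsub>ideals_set R\<^esub> (M - i)) \<Longrightarrow>
    poly_eval R \<phi> x p \<in> I [^]\<^bsub>ideals_set R\<^esub> M"
proof (induction p arbitrary: M)
  case 0
  interpret J: ideal "I [^]\<^bsub>ideals_set R\<^esub> M" R by (rule ideal_power_ideal[OF I])
  show ?case by (simp add: poly_eval_0[OF \<phi>])
next
  case (pCons c p)
  have xc: "x \<in> carrier R" using I x ideal.Icarr by metis
  interpret J: ideal "I [^]\<^bsub>ideals_set R\<^esub> M" R by (rule ideal_power_ideal[OF I])
  have pc: "poly_eval R \<phi> x p \<in> carrier R" by (rule eval_closed[OF poly_eval_hom[OF \<phi> xc]])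
  show ?case
  proof (cases M)
    case 0
    then show ?thesis using xc pc by (simp add: one_ideals_set poly_eval_pCons[OF \<phi>] eval_closed[OF \<phi>])
  next
    case (Suc L)
    have "\<phi> (coeff p i) \<in> I [^]\<^bsub>ideals_set R\<^esub> (L - i)" for i
      using pCons.prems[of "Suc i"] Suc by simp
    then have "x \<otimes> poly_eval R \<phi> x p \<in> I [^]\<^bsub>ideals_set R\<^esub> M"
      unfolding Suc by (intro ideal_power_mult I x pCons.IH)
    moreover have "\<phi> c \<in> I [^]\<^bsub>ideals_set R\<^esub> M" using pCons.prems[of 0] by simp
    ultimately show ?thesis by (simp add: poly_eval_pCons[OF \<phi> xc])
  qed
qed

lemma nil_log_closed:
  assumes "\<And>k. 1 \<le> k \<Longrightarrow> k < N \<Longrightarrow> nat_one k \<in> Units R" "x \<in> carrier R"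
  shows "nil_log R N x \<in> carrier R"
  unfolding nil_log_def using assms by (intro finsum_closed) auto

lemma eval_scaled_log:
  fixes \<phi> :: "'c::comm_ring_1 \<Rightarrow> 'a"
  assumes \<phi>: "eval_hom R \<phi>" and u: "\<And>k. 1 \<le> k \<Longrightarrow> k < N \<Longrightarrow> nat_one k \<in> Units R"
  shows "\<phi> (scaled_log N z) = nat_one (fact (N - 1)) \<otimes> nil_log R N (\<phi> z)"
proof -
  let ?D = "fact (N - 1) :: nat"
  note ev = eval_closed[OF \<phi>] eval_one[OF \<phi>] eval_mult[OF \<phi>] eval_minus[OF \<phi>] eval_power[OF \<phi>]
    eval_of_nat[OF \<phi>]
  have "\<phi> (scaled_log N z) = (\<Oplus>k\<in>{1..<N}. \<phi> ((-1) ^ (k + 1) * of_nat (?D div k) * z ^ k))"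
    unfolding scaled_log_def by (rule eval_sum[OF \<phi>]) simp
  also have "\<dots> = (\<Oplus>k\<in>{1..<N}. nat_one ?D \<otimes>
      ((\<ominus> \<one>) [^] (k + 1) \<otimes> (inv (nat_one k) \<otimes> \<phi> z [^] k)))"
  proof (rule finsum_cong')
    fix k assume k: "k \<in> {1..<N}"
    have uk: "nat_one k \<in> Units R" using u k by simp
    have "k dvd ?D" using k by (intro dvd_fact) auto
    then have "?D = ?D div k * k" by simp
    then have D: "nat_one ?D = nat_one (?D div k) \<otimes> nat_one k" by (metis nat_mult_one)
    define e w i m q where "e = (\<ominus> \<one>) [^] (k + 1)" and "w = \<phi> z [^] k" and "i = inv (nat_one k)"
      and "m = nat_one (?D div k)" and "q = nat_one k"
    have c: "e \<in> carrier R" "w \<in> carrier R" "i \<in> carrier R" "m \<in> carrier R" "q \<in> carrier R"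
      using uk by (auto simp: e_def w_def i_def m_def q_def ev)
    have "q \<otimes> i = \<one>" unfolding q_def i_def using uk by simp
    moreover have "m \<otimes> q \<otimes> (e \<otimes> (i \<otimes> w)) = (q \<otimes> i) \<otimes> (e \<otimes> m \<otimes> w)"
      using c by (simp add: m_ac)
    ultimately have "e \<otimes> m \<otimes> w = m \<otimes> q \<otimes> (e \<otimes> (i \<otimes> w))" using c by simp
    moreover have "\<phi> ((-1) ^ (k + 1) * of_nat (?D div k) * z ^ k) = e \<otimes> m \<otimes> w"
      unfolding e_def m_def w_def by (simp only: ev)
    ultimately show "\<phi> ((-1) ^ (k + 1) * of_nat (?D div k) * z ^ k) =
        nat_one ?D \<otimes> ((\<ominus> \<one>) [^] (k + 1) \<otimes> (inv (nat_one k) \<otimes> \<phi> z [^] k))"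
      unfolding D e_def m_def w_def i_def q_def by simp
  qed (use u ev in auto)
  also have "\<dots> = nat_one ?D \<otimes> nil_log R N (\<phi> z)"
    unfolding nil_log_def using u ev by (intro finsum_rdistr[symmetric]) auto
  finally show ?thesis .
qed

text \<open>Substituting \<open>x\<close> and \<open>y\<close> into the defect of additivity gives an element of \<open>I\<^sup>N = 0\<close>, and
  \<open>(N - 1)!\<close> can be cancelled.\<close>

lemma nil_log_add:
  assumes I: "ideal I R" and N: "N \<ge> 1" and nil: "I [^]\<^bsub>ideals_set R\<^esub> N = {\<zero>}"
    and u: "\<And>k. 1 \<le> k \<Longrightarrow> k < N \<Longrightarrow> nat_one k \<in> Units R"
    and D: "nat_one (fact (N - 1)) \<in> Units R"
    and x: "x \<in> I" and y: "y \<in> I"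
  shows "nil_log R N (x \<oplus> y \<oplus> x \<otimes> y) = nil_log R N x \<oplus> nil_log R N y"
proof -
  have xy: "x \<in> carrier R" "y \<in> carrier R" using I x y ideal.Icarr by metis+
  define \<phi>0 :: "int \<Rightarrow> 'a" where "\<phi>0 = (\<lambda>z. add_pow R z \<one>)"
  define \<phi>1 where "\<phi>1 = poly_eval R \<phi>0 y"
  define \<phi>2 where "\<phi>2 = poly_eval R \<phi>1 x"
  have h0: "eval_hom R \<phi>0" unfolding \<phi>0_def by (rule int_eval_hom)
  have h1: "eval_hom R \<phi>1" unfolding \<phi>1_def by (rule poly_eval_hom[OF h0 xy(2)])
  have h2: "eval_hom R \<phi>2" unfolding \<phi>2_def by (rule poly_eval_hom[OF h1 xy(1)])
  define X Y :: "int poly poly" where "X = [:0, 1:]" and "Y = [:[:0, 1:]:]"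
  have eY: "\<phi>1 [:0, 1:] = y"
    using xy by (simp add: \<phi>1_def poly_eval_pCons[OF h0] poly_eval_0[OF h0] eval_zero[OF h0] eval_one[OF h0])
  have \<phi>X: "\<phi>2 X = x"
    using xy by (simp add: X_def \<phi>2_def poly_eval_pCons[OF h1] poly_eval_0[OF h1] eval_zero[OF h1] eval_one[OF h1])
  have \<phi>Y: "\<phi>2 Y = y"
    using xy by (simp add: Y_def \<phi>2_def poly_eval_pCons[OF h1] poly_eval_0[OF h1] eY)
  define G where "G = scaled_log N (X + Y + X * Y) - scaled_log N X - scaled_log N Y"
  have "order_ge N G" unfolding G_def X_def Y_def by (rule scaled_log_defect[OF N])
  have "\<phi>1 (coeff G i) \<in> I [^]\<^bsub>ideals_set R\<^esub> (N - i)" for i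
  proof -
    obtain q where q: "coeff G i = monom 1 (N - i) * q"
      using \<open>order_ge N G\<close> unfolding order_ge_def dvd_def by blast
    interpret J: ideal "I [^]\<^bsub>ideals_set R\<^esub> (N - i)" R by (rule ideal_power_ideal[OF I])
    have "monom 1 (N - i) = [:0, 1 :: int:] ^ (N - i)" by (simp add: monom_altdef)
    then have "\<phi>1 (coeff G i) = y [^] (N - i) \<otimes> \<phi>1 q"
      unfolding q by (simp add: eval_mult[OF h1] eval_power[OF h1] eY)
    then show ?thesis
      using ideal_power_pow[OF I y] eval_closed[OF h1] by (simp add: J.I_r_closed)
  qed
  then have "\<phi>2 G \<in> I [^]\<^bsub>ideals_set R\<^esub> N"
    unfolding \<phi>2_def by (intro poly_eval_in_ideal_power[OF I h1 x])
  then have "\<phi>2 G = \<zero>" using nil by simp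
  define d L A B where "d = nat_one (fact (N - 1))" and "L = nil_log R N (x \<oplus> y \<oplus> x \<otimes> y)"
    and "A = nil_log R N x" and "B = nil_log R N y"
  have c: "L \<in> carrier R" "A \<in> carrier R" "B \<in> carrier R" "d \<in> carrier R"
    using xy by (auto simp: L_def A_def B_def d_def intro!: nil_log_closed u)
  have "\<phi>2 G = d \<otimes> L \<ominus> d \<otimes> A \<ominus> d \<otimes> B"
    by (simp add: G_def eval_diff[OF h2] eval_scaled_log[OF h2 u] eval_add[OF h2] eval_mult[OF h2] \<phi>X \<phi>Y
        d_def L_def A_def B_def)
  also have "\<dots> = d \<otimes> (L \<ominus> (A \<oplus> B))"
    using c by (simp add: minus_eq r_distr r_minus minus_add a_assoc)
  finally have "d \<otimes> (L \<ominus> (A \<oplus> B)) = \<phi>2 G" by (rule sym)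
  then have "d \<otimes> (L \<ominus> (A \<oplus> B)) = d \<otimes> \<zero>" using c(4) \<open>\<phi>2 G = \<zero>\<close> by (simp only: r_null)
  moreover have "d \<in> Units R" using D by (simp add: d_def)
  ultimately have "L \<ominus> (A \<oplus> B) = \<zero>" using c Units_l_cancel[of d "L \<ominus> (A \<oplus> B)" \<zero>] by blast
  then show ?thesis using c diff_eq_zero_iff by (simp add: L_def A_def B_def)
qed

end

section \<open>Differentials of logarithms and the dilogarithm\<close>

context cring
begin

interpretation K: module R "kahler R"
  by (rule kahler_module)

lemma kahler_minus_zero: "\<ominus>\<^bsub>kahler R\<^esub> \<zero>\<^bsub>kahler R\<^esub> = \<zero>\<^bsub>kahler R\<^esub>"
  using K.M.minus_equality[of "\<zero>\<^bsub>kahler R\<^esub>" "\<zero>\<^bsub>kahler R\<^esub>"] by simp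

lemma kahler_d_const_mult:
  assumes "kahler_d R c = \<zero>\<^bsub>kahler R\<^esub>" "c \<in> carrier R" "a \<in> carrier R"
  shows "kahler_d R (c \<otimes> a) = c \<odot>\<^bsub>kahler R\<^esub> kahler_d R a"
  using assms by (simp add: kahler_d_mult)

lemma kahler_d_nat_one: "kahler_d R (nat_one k) = \<zero>\<^bsub>kahler R\<^esub>"
  by (induction k) (simp_all add: kahler_d_zero kahler_d_add kahler_d_one)

lemma kahler_d_inv_nat_one:
  "nat_one k \<in> Units R \<Longrightarrow> kahler_d R (inv (nat_one k)) = \<zero>\<^bsub>kahler R\<^esub>"
  by (simp add: kahler_d_inv kahler_d_nat_one kahler_minus_zero)

lemma kahler_d_sign: "kahler_d R ((\<ominus> \<one>) [^] (k::nat)) = \<zero>\<^bsub>kahler R\<^esub>"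
  by (induction k) (simp_all add: kahler_d_mult kahler_d_minus kahler_d_one kahler_minus_zero)

lemma kahler_d_pow:
  assumes x: "x \<in> carrier R"
  shows "kahler_d R (x [^] Suc k) = (nat_one (Suc k) \<otimes> x [^] k) \<odot>\<^bsub>kahler R\<^esub> kahler_d R x"
proof (induction k)
  case 0
  then show ?case using x by simp
next
  case (Suc k)
  have "kahler_d R (x [^] Suc (Suc k)) =
      x [^] Suc k \<odot>\<^bsub>kahler R\<^esub> kahler_d R x \<oplus>\<^bsub>kahler R\<^esub>
      x \<odot>\<^bsub>kahler R\<^esub> ((nat_one (Suc k) \<otimes> x [^] k) \<odot>\<^bsub>kahler R\<^esub> kahler_d R x)"
    using kahler_d_mult[of "x [^] Suc k" x] Suc x by simp
  also have "\<dots> = (x [^] Suc k \<oplus> x \<otimes> (nat_one (Suc k) \<otimes> x [^] k)) \<odot>\<^bsub>kahler R\<^esub> kahler_d R x"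
    using x by (simp add: K.smult_l_distr K.smult_assoc1)
  also have "x \<otimes> (nat_one (Suc k) \<otimes> x [^] k) = nat_one (Suc k) \<otimes> x [^] Suc k"
    using x by (simp add: m_ac del: add.nat_pow_Suc)
  also have "x [^] Suc k \<oplus> nat_one (Suc k) \<otimes> x [^] Suc k = nat_one (Suc (Suc k)) \<otimes> x [^] Suc k"
  proof -
    have "nat_one (Suc (Suc k)) = \<one> \<oplus> nat_one (Suc k)" by (simp add: a_comm)
    then show ?thesis using x by (simp add: l_distr del: add.nat_pow_Suc)
  qed
  finally show ?case .
qed

lemma pow_d_zero:
  assumes x: "x \<in> carrier R" "x [^] Suc k = \<zero>" and u: "nat_one (Suc k) \<in> Units R"
  shows "x [^] k \<odot>\<^bsub>kahler R\<^esub> kahler_d R x = \<zero>\<^bsub>kahler R\<^esub>"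
proof -
  have e: "(nat_one (Suc k) \<otimes> x [^] k) \<odot>\<^bsub>kahler R\<^esub> kahler_d R x = \<zero>\<^bsub>kahler R\<^esub>"
    using kahler_d_pow[OF x(1), of k] unfolding x(2) kahler_d_zero by (rule sym)
  have "inv (nat_one (Suc k)) \<odot>\<^bsub>kahler R\<^esub> ((nat_one (Suc k) \<otimes> x [^] k) \<odot>\<^bsub>kahler R\<^esub> kahler_d R x) = \<zero>\<^bsub>kahler R\<^esub>"
    unfolding e using u by (intro K.smult_r_null Units_inv_closed)
  moreover have "inv (nat_one (Suc k)) \<otimes> (nat_one (Suc k) \<otimes> x [^] k) = x [^] k"
    using x u by (simp add: m_assoc[symmetric] del: add.nat_pow_Suc)
  ultimately show ?thesis using x u by (simp add: K.smult_assoc1[symmetric] del: add.nat_pow_Suc)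
qed

lemma nil_log_Suc_0: "nil_log R (Suc 0) x = \<zero>"
  by (simp add: nil_log_def)

lemma nil_log_Suc_Suc:
  assumes u: "\<And>j. 1 \<le> j \<Longrightarrow> j \<le> Suc k \<Longrightarrow> nat_one j \<in> Units R" and x: "x \<in> carrier R"
  shows "nil_log R (Suc (Suc k)) x = nil_log R (Suc k) x \<oplus>
    (\<ominus> \<one>) [^] k \<otimes> (inv (nat_one (Suc k)) \<otimes> x [^] Suc k)"
proof -
  have "{1..<Suc (Suc k)} = insert (Suc k) {1..<Suc k}" by auto
  then have "nil_log R (Suc (Suc k)) x =
      (\<ominus> \<one>) [^] (Suc k + 1) \<otimes> (inv (nat_one (Suc k)) \<otimes> x [^] Suc k) \<oplus> nil_log R (Suc k) x"
    unfolding nil_log_def using u x by (simp add: Pi_def del: nat_pow_Suc add.nat_pow_Suc)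
  moreover have "(\<ominus> \<one>) [^] (Suc k + 1) = (\<ominus> \<one>) [^] k"
    by (simp add: l_minus r_minus)
  moreover have "nil_log R (Suc k) x \<in> carrier R" using u x by (intro nil_log_closed) auto
  ultimately show ?thesis using u[of "Suc k"] x by (simp add: a_comm del: nat_pow_Suc add.nat_pow_Suc)
qed

lemma inv_mult_cancel: "n \<in> Units R \<Longrightarrow> w \<in> carrier R \<Longrightarrow> inv n \<otimes> (n \<otimes> w) = w"
  by (simp add: m_assoc[symmetric] Units_closed)

text \<open>The differential of the truncated series is \<open>g dx\<close> with \<open>(1 + x) g = 1 - (-x)\<^bsup>N-1\<^esup>\<close>, and
  \<open>x\<^bsup>N-1\<^esup> dx = 0\<close> because \<open>N\<close> times it is \<open>d(x\<^sup>N)\<close>.\<close>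

lemma kahler_d_nil_log:
  assumes N: "N \<ge> 1" and x: "x \<in> carrier R" "x [^] N = \<zero>"
    and u: "\<And>j. 1 \<le> j \<Longrightarrow> j \<le> N \<Longrightarrow> nat_one j \<in> Units R" and x1: "\<one> \<oplus> x \<in> Units R"
  shows "kahler_d R (nil_log R N x) = dlog R (\<one> \<oplus> x)"
proof -
  let ?dx = "kahler_d R x"
  have "\<exists>g\<in>carrier R. kahler_d R (nil_log R (Suc k) x) = g \<odot>\<^bsub>kahler R\<^esub> ?dx \<and>
      (\<one> \<oplus> x) \<otimes> g = \<one> \<ominus> (\<ominus> \<one>) [^] k \<otimes> x [^] k" if "Suc k \<le> N" for k
    using that
  proof (induction k)
    case 0
    then show ?case using x
      by (intro bexI[of _ \<zero>]) (simp_all add: nil_log_Suc_0 kahler_d_zero minus_eq r_neg)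
  next
    case (Suc k)
    then obtain g where g: "g \<in> carrier R" "kahler_d R (nil_log R (Suc k) x) = g \<odot>\<^bsub>kahler R\<^esub> ?dx"
      "(\<one> \<oplus> x) \<otimes> g = \<one> \<ominus> (\<ominus> \<one>) [^] k \<otimes> x [^] k" by auto
    define e w i where "e = (\<ominus> \<one>) [^] k" and "w = x [^] k" and "i = inv (nat_one (Suc k))"
    have uk: "nat_one (Suc k) \<in> Units R" using Suc.prems by (intro u) auto
    have c: "e \<in> carrier R" "w \<in> carrier R" "i \<in> carrier R"
      using x uk by (auto simp: e_def w_def i_def simp del: add.nat_pow_Suc)
    have Lc: "nil_log R (Suc k) x \<in> carrier R" using u x Suc.prems by (intro nil_log_closed) auto
    have "kahler_d R (e \<otimes> (i \<otimes> x [^] Suc k)) = (e \<otimes> w) \<odot>\<^bsub>kahler R\<^esub> ?dx"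
    proof -
      have "kahler_d R (e \<otimes> (i \<otimes> x [^] Suc k)) = e \<odot>\<^bsub>kahler R\<^esub> (i \<odot>\<^bsub>kahler R\<^esub> kahler_d R (x [^] Suc k))"
        using c x kahler_d_sign[of k] kahler_d_inv_nat_one[OF uk]
        by (simp add: kahler_d_const_mult e_def i_def del: nat_pow_Suc add.nat_pow_Suc)
      also have "\<dots> = (e \<otimes> (i \<otimes> (nat_one (Suc k) \<otimes> w))) \<odot>\<^bsub>kahler R\<^esub> ?dx"
        unfolding kahler_d_pow[OF x(1)] w_def[symmetric]
        using c x by (simp add: K.smult_assoc1 del: nat_pow_Suc add.nat_pow_Suc)
      also have "i \<otimes> (nat_one (Suc k) \<otimes> w) = w"
        unfolding i_def by (rule inv_mult_cancel[OF uk c(2)])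
      finally show ?thesis .
    qed
    then have "kahler_d R (nil_log R (Suc (Suc k)) x) = (g \<oplus> e \<otimes> w) \<odot>\<^bsub>kahler R\<^esub> ?dx"
      using c x g Lc u Suc.prems unfolding e_def i_def
      by (subst nil_log_Suc_Suc) (simp_all add: kahler_d_add K.smult_l_distr del: nat_pow_Suc add.nat_pow_Suc)
    moreover have "(\<one> \<oplus> x) \<otimes> (g \<oplus> e \<otimes> w) = \<one> \<ominus> (\<ominus> \<one>) [^] Suc k \<otimes> x [^] Suc k"
    proof -
      have "(\<one> \<oplus> x) \<otimes> (g \<oplus> e \<otimes> w) = (\<one> \<ominus> e \<otimes> w) \<oplus> (\<one> \<oplus> x) \<otimes> (e \<otimes> w)"
        using g c x by (simp add: r_distr e_def w_def)
      also have "\<dots> = \<one> \<oplus> (x \<otimes> (e \<otimes> w))"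
        using c x by (simp add: l_distr minus_eq a_assoc r_neg1 r_neg2)
      also have "\<dots> = \<one> \<ominus> (\<ominus> e) \<otimes> (w \<otimes> x)"
      proof -
        have "x \<otimes> (e \<otimes> w) = e \<otimes> (w \<otimes> x)" using c x by (simp add: m_ac)
        then show ?thesis using c x by (simp add: minus_eq l_minus)
      qed
      finally show ?thesis using c x by (simp add: e_def w_def r_minus)
    qed
    ultimately show ?case using g c by (intro bexI[of _ "g \<oplus> e \<otimes> w"]) auto
  qed
  from this[of "N - 1"] N obtain g where g: "g \<in> carrier R"
    "kahler_d R (nil_log R N x) = g \<odot>\<^bsub>kahler R\<^esub> ?dx"
    "(\<one> \<oplus> x) \<otimes> g = \<one> \<ominus> (\<ominus> \<one>) [^] (N - 1) \<otimes> x [^] (N - 1)" by auto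
  have z: "x [^] (N - 1) \<odot>\<^bsub>kahler R\<^esub> ?dx = \<zero>\<^bsub>kahler R\<^esub>"
    using pow_d_zero[of x "N - 1"] x u N by simp
  have "(\<one> \<oplus> x) \<odot>\<^bsub>kahler R\<^esub> (g \<odot>\<^bsub>kahler R\<^esub> ?dx) = ((\<one> \<oplus> x) \<otimes> g) \<odot>\<^bsub>kahler R\<^esub> ?dx"
    using g(1) x(1) by (simp add: K.smult_assoc1)
  also have "\<dots> = ?dx"
    unfolding g(3) minus_eq using x z
    by (simp add: K.smult_l_distr K.smult_l_minus K.smult_assoc1 kahler_minus_zero)
  finally have "inv (\<one> \<oplus> x) \<odot>\<^bsub>kahler R\<^esub> ((\<one> \<oplus> x) \<odot>\<^bsub>kahler R\<^esub> (g \<odot>\<^bsub>kahler R\<^esub> ?dx)) = inv (\<one> \<oplus> x) \<odot>\<^bsub>kahler R\<^esub> ?dx"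
    by simp
  then have "g \<odot>\<^bsub>kahler R\<^esub> ?dx = inv (\<one> \<oplus> x) \<odot>\<^bsub>kahler R\<^esub> ?dx"
    using g(1) x(1) x1 by (simp add: K.smult_assoc1[symmetric] m_assoc[symmetric])
  then show ?thesis using g x by (simp add: dlog_def kahler_d_add kahler_d_one)
qed

text \<open>The ring identity behind the inductive step for \<open>dC\<close> in the next lemma; \<open>n = k + 1\<close>,
  \<open>E = (-1)\<^sup>n\<close>, \<open>P = p\<^sup>n\<close>, \<open>Q = q\<^sup>n\<close>, and \<open>i\<close>, \<open>i'\<close> are the inverses of \<open>n\<close> and \<open>n + 1\<close>.\<close>

lemma dilog_step:
  assumes c: "p \<in> carrier R" "q \<in> carrier R" "C \<in> carrier R" "E \<in> carrier R" "i \<in> carrier R" "P \<in> carrier R"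
    "n \<in> carrier R" "i' \<in> carrier R" "Q \<in> carrier R"
    and ni: "n \<otimes> i = \<one>" and ni': "(n \<oplus> \<one>) \<otimes> i' = \<one>"
    and C': "C' = q \<otimes> C \<oplus> E \<otimes> (i \<otimes> (P \<otimes> q))"
  shows "q \<otimes> (n \<otimes> C' \<oplus> p \<otimes> Q) \<oplus> (C \<otimes> (q \<otimes> q) \<oplus> E \<otimes> (i \<otimes> (P \<otimes> (q \<otimes> q) \<ominus> q \<otimes> (n \<otimes> (P \<otimes> p))))) =
    (n \<oplus> \<one>) \<otimes> (q \<otimes> C' \<oplus> (\<ominus> E) \<otimes> (i' \<otimes> ((P \<otimes> p) \<otimes> q))) \<oplus> p \<otimes> (Q \<otimes> q)"
proof -
  define W where "W = E \<otimes> (P \<otimes> (p \<otimes> q))"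
  have cc: "C' \<in> carrier R" "W \<in> carrier R" unfolding C' W_def using c by auto
  have "E \<otimes> (i \<otimes> (P \<otimes> (q \<otimes> q) \<ominus> q \<otimes> (n \<otimes> (P \<otimes> p)))) =
      E \<otimes> (i \<otimes> (P \<otimes> (q \<otimes> q))) \<ominus> (n \<otimes> i) \<otimes> W"
    unfolding W_def using c by (simp add: minus_eq r_distr r_minus m_ac)
  also have "\<dots> = E \<otimes> (i \<otimes> (P \<otimes> (q \<otimes> q))) \<ominus> W" using ni cc by simp
  finally have 1: "C \<otimes> (q \<otimes> q) \<oplus> E \<otimes> (i \<otimes> (P \<otimes> (q \<otimes> q) \<ominus> q \<otimes> (n \<otimes> (P \<otimes> p)))) = q \<otimes> C' \<ominus> W"
    unfolding C' using c cc by (simp add: minus_eq r_distr m_ac a_ac)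
  have "(n \<oplus> \<one>) \<otimes> ((\<ominus> E) \<otimes> (i' \<otimes> ((P \<otimes> p) \<otimes> q))) = \<ominus> (((n \<oplus> \<one>) \<otimes> i') \<otimes> W)"
    unfolding W_def using c by (simp add: l_minus r_minus m_ac)
  then have 2: "(n \<oplus> \<one>) \<otimes> ((\<ominus> E) \<otimes> (i' \<otimes> ((P \<otimes> p) \<otimes> q))) = \<ominus> W" using ni' cc by simp
  have "q \<otimes> (n \<otimes> C' \<oplus> p \<otimes> Q) \<oplus> (q \<otimes> C' \<ominus> W) =
      (n \<oplus> \<one>) \<otimes> (q \<otimes> C') \<oplus> \<ominus> W \<oplus> p \<otimes> (Q \<otimes> q)"
    using c cc by (simp add: minus_eq r_distr l_distr m_ac a_ac)
  also have "(n \<oplus> \<one>) \<otimes> (q \<otimes> C') \<oplus> \<ominus> W =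
      (n \<oplus> \<one>) \<otimes> (q \<otimes> C' \<oplus> (\<ominus> E) \<otimes> (i' \<otimes> ((P \<otimes> p) \<otimes> q)))"
    unfolding 2[symmetric] using c cc by (subst r_distr) simp_all
  finally show ?thesis unfolding 1 .
qed

text \<open>The function wanted is the dilogarithm \<open>f = - \<integral> log(1 + px)/(b - x) dx\<close>, where \<open>p = 1/a\<close> and
  \<open>q = 1/b\<close>. The coefficients of \<open>- log(1 + px)/(b - x) = \<Sum> C\<^sub>k x\<^sup>k\<close> satisfy
  \<open>C\<^bsub>k+1\<^esub> = q C\<^sub>k + (-1)\<^bsup>k+1\<^esup> p\<^bsup>k+1\<^esup> q/(k + 1)\<close> and \<open>C\<^sub>0 = 0\<close>. Here \<open>f\<close> is the sum of
  \<open>C\<^sub>j x\<^bsup>j+1\<^esup>/(j + 1)\<close> for \<open>j < k\<close>, \<open>S\<close> that of \<open>C\<^bsub>j+1\<^esub> x\<^bsup>j+1\<^esup>\<close>, \<open>T\<close> that of \<open>C\<^sub>j x\<^sup>j\<close>, and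
  \<open>C = C\<^sub>k\<close>. The induction works because \<open>dC\<^sub>k = ((k + 1) C\<^bsub>k+1\<^esub> + p q\<^bsup>k+1\<^esup>) da\<close>. Thus
  differentiating \<open>f\<close> in \<open>x\<close> gives \<open>T\<close>, and differentiating its coefficients, which depend on \<open>a\<close>,
  gives \<open>S\<close> and the partial sum of \<open>- p log(1 - qx)\<close>. As \<open>C\<^sub>0 = 0\<close>, the sums \<open>S\<close> and \<open>T\<close> belong to the
  same series and differ in one term.\<close>

lemma dilog_partial_sums:
  assumes I: "ideal I R" and x: "x \<in> I" and a: "a \<in> Units R" and b: "b \<in> Units R" and ab: "a \<oplus> b = \<one>"
    and u: "\<And>j. 1 \<le> j \<Longrightarrow> j \<le> N \<Longrightarrow> nat_one j \<in> Units R"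
  defines "p \<equiv> inv a" and "q \<equiv> inv b"
  shows "Suc k \<le> N \<Longrightarrow> \<exists>f\<in>I. \<exists>S\<in>carrier R. \<exists>T\<in>carrier R. \<exists>C\<in>carrier R.
    kahler_d R f = (S \<ominus> p \<otimes> nil_log R (Suc k) (\<ominus> (q \<otimes> x))) \<odot>\<^bsub>kahler R\<^esub> kahler_d R a
      \<oplus>\<^bsub>kahler R\<^esub> T \<odot>\<^bsub>kahler R\<^esub> kahler_d R x \<and>
    S = T \<oplus> C \<otimes> x [^] k \<and>
    S \<otimes> (b \<ominus> x) = \<ominus> nil_log R (Suc k) (p \<otimes> x) \<ominus> C \<otimes> x [^] Suc k \<and>
    kahler_d R C = (nat_one (Suc k) \<otimes> (q \<otimes> C \<oplus> (\<ominus> \<one>) [^] Suc k \<otimes> (inv (nat_one (Suc k)) \<otimes> (p [^] Suc k \<otimes> q)))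
      \<oplus> p \<otimes> q [^] Suc k) \<odot>\<^bsub>kahler R\<^esub> kahler_d R a"
proof (induction k)
  case 0
  interpret I: ideal I R by (rule I)
  have c: "x \<in> carrier R" "a \<in> carrier R" "b \<in> carrier R" "p \<in> carrier R" "q \<in> carrier R"
    using x a b by (auto simp: p_def q_def)
  have z: "\<ominus> \<one> \<otimes> (inv \<one> \<otimes> (p \<otimes> q)) \<oplus> p \<otimes> q = \<zero>"
    using c by (simp add: l_minus l_neg)
  show ?case
    using c z
    by (intro bexI[of _ \<zero>] conjI) (simp_all add: nil_log_Suc_0 kahler_d_zero minus_eq)
next
  case (Suc k)
  interpret I: ideal I R by (rule I)
  let ?d = "kahler_d R"
  have c: "x \<in> carrier R" "a \<in> carrier R" "b \<in> carrier R" "p \<in> carrier R" "q \<in> carrier R"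
    using x a b by (auto simp: p_def q_def)
  define E n i i' P Q w where "E = (\<ominus> \<one>) [^] Suc k" and "n = nat_one (Suc k)" and "i = inv n"
    and "i' = inv (nat_one (Suc (Suc k)))" and "P = p [^] Suc k" and "Q = q [^] Suc k" and "w = x [^] Suc k"
  have un: "n \<in> Units R" unfolding n_def using Suc.prems by (intro u) auto
  have n': "nat_one (Suc (Suc k)) = n \<oplus> \<one>" unfolding n_def by simp
  have un': "n \<oplus> \<one> \<in> Units R" unfolding n'[symmetric] by (rule u) (use Suc.prems in simp_all)
  have cc: "E \<in> carrier R" "n \<in> carrier R" "i \<in> carrier R" "i' \<in> carrier R" "P \<in> carrier R" "Q \<in> carrier R"
    "w \<in> carrier R"
    using c Units_closed[OF un] Units_inv_closed[OF un] Units_inv_closed[OF un']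
    unfolding E_def i_def i'_def P_def Q_def w_def n' by (simp_all only: nat_pow_closed a_inv_closed one_closed)
  have ni: "n \<otimes> i = \<one>" "(n \<oplus> \<one>) \<otimes> i' = \<one>" unfolding i_def i'_def n' using un un' by (simp_all only: Units_r_inv)
  have wI: "w \<in> I" unfolding w_def using x c by (simp add: I.I_l_closed)
  obtain f S T C where f: "f \<in> I" and STC: "S \<in> carrier R" "T \<in> carrier R" "C \<in> carrier R"
    and df: "?d f = (S \<ominus> p \<otimes> nil_log R (Suc k) (\<ominus> (q \<otimes> x))) \<odot>\<^bsub>kahler R\<^esub> ?d a
      \<oplus>\<^bsub>kahler R\<^esub> T \<odot>\<^bsub>kahler R\<^esub> ?d x"
    and ST: "S = T \<oplus> C \<otimes> x [^] k"
    and Sb: "S \<otimes> (b \<ominus> x) = \<ominus> nil_log R (Suc k) (p \<otimes> x) \<ominus> C \<otimes> w"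
    and dC: "?d C = (n \<otimes> (q \<otimes> C \<oplus> E \<otimes> (i \<otimes> (P \<otimes> q))) \<oplus> p \<otimes> Q) \<odot>\<^bsub>kahler R\<^esub> ?d a"
    using Suc.IH[OF Suc_leD[OF Suc.prems]] unfolding E_def n_def i_def P_def Q_def w_def by blast
  (* Primes denote the coefficient and the partial sums for k + 1. *)
  define C' where "C' = q \<otimes> C \<oplus> E \<otimes> (i \<otimes> (P \<otimes> q))"
  define S' where "S' = S \<oplus> C' \<otimes> w"
  define T' where "T' = T \<oplus> C \<otimes> x [^] k"
  define f' where "f' = f \<oplus> i \<otimes> (C \<otimes> w)"
  define L V where "L = nil_log R (Suc k) (p \<otimes> x)" and "V = nil_log R (Suc k) (\<ominus> (q \<otimes> x))"
  have LV: "L \<in> carrier R" "V \<in> carrier R"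
    unfolding L_def V_def using c u Suc.prems by (auto intro!: nil_log_closed)
  have c': "C' \<in> carrier R" "S' \<in> carrier R" "T' \<in> carrier R" "f \<in> carrier R"
    unfolding C'_def S'_def T'_def using c cc STC f by auto
  have uu: "1 \<le> j \<Longrightarrow> j \<le> Suc k \<Longrightarrow> nat_one j \<in> Units R" for j using u Suc.prems by simp
  have L': "nil_log R (Suc (Suc k)) (p \<otimes> x) = L \<ominus> E \<otimes> (i \<otimes> (P \<otimes> w))"
  proof -
    have "(\<ominus> \<one>) [^] k = \<ominus> E" unfolding E_def by (simp add: r_minus)
    moreover have "(p \<otimes> x) [^] Suc k = P \<otimes> w" unfolding P_def w_def using c by (intro nat_pow_distrib)
    ultimately show ?thesis
      using nil_log_Suc_Suc[OF uu, of k "p \<otimes> x"] c cc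
      by (simp add: L_def minus_eq l_minus i_def n_def del: nat_pow_Suc add.nat_pow_Suc)
  qed
  have V': "nil_log R (Suc (Suc k)) (\<ominus> (q \<otimes> x)) = V \<ominus> i \<otimes> (Q \<otimes> w)"
  proof -
    have ee: "(\<ominus> \<one>) [^] k = \<ominus> E" unfolding E_def by (simp add: r_minus)
    have "\<ominus> (q \<otimes> x) = (\<ominus> \<one>) \<otimes> (q \<otimes> x)" using c by (simp add: l_minus)
    then have "(\<ominus> (q \<otimes> x)) [^] Suc k = E \<otimes> (Q \<otimes> w)"
      unfolding E_def Q_def w_def using c
      by (simp only: nat_pow_distrib a_inv_closed one_closed m_closed)
    moreover have EE: "E \<otimes> E = \<one>"
      unfolding E_def using nat_pow_distrib[of "\<ominus> \<one>" "\<ominus> \<one>" "Suc k"]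
      by (simp add: l_minus r_minus nat_pow_one del: nat_pow_Suc)
    moreover have "(\<ominus> E) \<otimes> (i \<otimes> (E \<otimes> (Q \<otimes> w))) = \<ominus> ((E \<otimes> E) \<otimes> (i \<otimes> (Q \<otimes> w)))"
      using cc by (simp add: l_minus r_minus m_ac)
    ultimately show ?thesis
      using nil_log_Suc_Suc[OF uu, of k "\<ominus> (q \<otimes> x)"] c cc
      by (simp add: V_def minus_eq ee i_def n_def del: nat_pow_Suc add.nat_pow_Suc)
  qed
  have dw: "?d w = (n \<otimes> x [^] k) \<odot>\<^bsub>kahler R\<^esub> ?d x"
    unfolding w_def n_def by (rule kahler_d_pow[OF c(1)])
  have di: "?d i = \<zero>\<^bsub>kahler R\<^esub>" unfolding i_def n_def using un by (intro kahler_d_inv_nat_one) (simp add: n_def)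
  have dE: "?d E = \<zero>\<^bsub>kahler R\<^esub>" unfolding E_def by (rule kahler_d_sign)
  have "?d (i \<otimes> (C \<otimes> w)) = i \<odot>\<^bsub>kahler R\<^esub> (C \<odot>\<^bsub>kahler R\<^esub> ?d w \<oplus>\<^bsub>kahler R\<^esub> w \<odot>\<^bsub>kahler R\<^esub> ?d C)"
    using STC cc by (simp add: kahler_d_mult di)
  also have "\<dots> = (i \<otimes> (C \<otimes> (n \<otimes> x [^] k))) \<odot>\<^bsub>kahler R\<^esub> ?d x \<oplus>\<^bsub>kahler R\<^esub>
      (i \<otimes> (w \<otimes> (n \<otimes> C' \<oplus> p \<otimes> Q))) \<odot>\<^bsub>kahler R\<^esub> ?d a"
    unfolding dw dC C'_def[symmetric] using STC cc c c' by (simp add: K.smult_r_distr K.smult_assoc1)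
  also have "i \<otimes> (C \<otimes> (n \<otimes> x [^] k)) = (n \<otimes> i) \<otimes> (C \<otimes> x [^] k)"
    using STC cc c by (simp add: m_ac)
  also have "\<dots> = C \<otimes> x [^] k" using ni STC c by simp
  also have "i \<otimes> (w \<otimes> (n \<otimes> C' \<oplus> p \<otimes> Q)) = (n \<otimes> i) \<otimes> (C' \<otimes> w) \<oplus> p \<otimes> (i \<otimes> (Q \<otimes> w))"
    using cc c c' by (simp add: r_distr m_ac)
  also have "\<dots> = C' \<otimes> w \<oplus> p \<otimes> (i \<otimes> (Q \<otimes> w))" using ni cc c' by simp
  finally have dnew: "?d (i \<otimes> (C \<otimes> w)) = (C \<otimes> x [^] k) \<odot>\<^bsub>kahler R\<^esub> ?d x \<oplus>\<^bsub>kahler R\<^esub>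
      (C' \<otimes> w \<oplus> p \<otimes> (i \<otimes> (Q \<otimes> w))) \<odot>\<^bsub>kahler R\<^esub> ?d a" .
  have df': "?d f' = (S' \<ominus> p \<otimes> nil_log R (Suc (Suc k)) (\<ominus> (q \<otimes> x))) \<odot>\<^bsub>kahler R\<^esub> ?d a
      \<oplus>\<^bsub>kahler R\<^esub> T' \<odot>\<^bsub>kahler R\<^esub> ?d x"
  proof -
    have "S' \<ominus> p \<otimes> (V \<ominus> i \<otimes> (Q \<otimes> w)) = (S \<ominus> p \<otimes> V) \<oplus> (C' \<otimes> w \<oplus> p \<otimes> (i \<otimes> (Q \<otimes> w)))"
      unfolding S'_def using STC LV c cc c' by (simp add: minus_eq r_distr r_minus minus_add a_ac)
    then have "(S' \<ominus> p \<otimes> (V \<ominus> i \<otimes> (Q \<otimes> w))) \<odot>\<^bsub>kahler R\<^esub> ?d a \<oplus>\<^bsub>kahler R\<^esub> T' \<odot>\<^bsub>kahler R\<^esub> ?d x =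
        ((S \<ominus> p \<otimes> V) \<odot>\<^bsub>kahler R\<^esub> ?d a \<oplus>\<^bsub>kahler R\<^esub> (C' \<otimes> w \<oplus> p \<otimes> (i \<otimes> (Q \<otimes> w))) \<odot>\<^bsub>kahler R\<^esub> ?d a)
        \<oplus>\<^bsub>kahler R\<^esub> (T \<odot>\<^bsub>kahler R\<^esub> ?d x \<oplus>\<^bsub>kahler R\<^esub> (C \<otimes> x [^] k) \<odot>\<^bsub>kahler R\<^esub> ?d x)"
      unfolding T'_def using STC LV c cc c' by (simp only: K.smult_l_distr minus_closed m_closed a_closed
          nat_pow_closed kahler_d_closed)
    also have "\<dots> = ?d f \<oplus>\<^bsub>kahler R\<^esub> ?d (i \<otimes> (C \<otimes> w))"
      unfolding dnew df V_def[symmetric] using STC LV c cc c'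
      by (simp add: K.M.a_ac)
    also have "\<dots> = ?d f'" unfolding f'_def using c' cc STC by (simp add: kahler_d_add)
    finally show ?thesis unfolding V' by simp
  qed
  have ST': "S' = T' \<oplus> C' \<otimes> x [^] Suc k"
    unfolding S'_def T'_def ST[symmetric] w_def ..
  have Sb': "S' \<otimes> (b \<ominus> x) = \<ominus> nil_log R (Suc (Suc k)) (p \<otimes> x) \<ominus> C' \<otimes> x [^] Suc (Suc k)"
  proof -
    have wx: "x [^] Suc (Suc k) = w \<otimes> x" unfolding w_def by simp
    have "b \<otimes> q = \<one>" unfolding q_def using b by simp
    moreover have "b \<otimes> C' = (b \<otimes> q) \<otimes> (C \<oplus> E \<otimes> (i \<otimes> P))"
      unfolding C'_def using c cc STC by (simp add: r_distr m_ac)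
    ultimately have bC: "b \<otimes> C' = C \<oplus> E \<otimes> (i \<otimes> P)" using STC cc by simp
    have "S' \<otimes> (b \<ominus> x) = S \<otimes> (b \<ominus> x) \<oplus> ((b \<otimes> C') \<otimes> w \<ominus> C' \<otimes> (w \<otimes> x))"
      unfolding S'_def using STC c cc c' by (simp add: l_distr minus_eq r_distr r_minus m_ac a_ac)
    also have "\<dots> = (\<ominus> L \<ominus> C \<otimes> w) \<oplus> ((C \<otimes> w \<oplus> E \<otimes> (i \<otimes> (P \<otimes> w))) \<ominus> C' \<otimes> (w \<otimes> x))"
      unfolding Sb bC L_def using STC cc by (simp add: l_distr m_assoc)
    also have "\<dots> = (\<ominus> L \<oplus> E \<otimes> (i \<otimes> (P \<otimes> w))) \<ominus> C' \<otimes> (w \<otimes> x)"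
      using STC cc c c' LV by (simp add: minus_eq a_assoc r_neg1 r_neg2)
    also have "\<ominus> L \<oplus> E \<otimes> (i \<otimes> (P \<otimes> w)) = \<ominus> (L \<ominus> E \<otimes> (i \<otimes> (P \<otimes> w)))"
      using LV cc by (simp add: minus_eq minus_add)
    finally show ?thesis unfolding L' wx .
  qed
  have db: "?d b = \<ominus>\<^bsub>kahler R\<^esub> ?d a"
  proof -
    have "?d b \<oplus>\<^bsub>kahler R\<^esub> ?d a = \<zero>\<^bsub>kahler R\<^esub>"
      using kahler_d_add[OF c(2,3)] ab c by (simp add: kahler_d_one K.M.a_comm)
    then show ?thesis using K.M.minus_equality c by simp
  qed
  have dq: "?d q = (q \<otimes> q) \<odot>\<^bsub>kahler R\<^esub> ?d a"
    unfolding q_def kahler_d_inv[OF b] db using b c by (simp add: K.smult_r_minus)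
  have dp: "?d p = (\<ominus> (p \<otimes> p)) \<odot>\<^bsub>kahler R\<^esub> ?d a"
    unfolding p_def kahler_d_inv[OF a] using a c by (simp add: K.smult_l_minus)
  have dP: "?d P = (\<ominus> (n \<otimes> (P \<otimes> p))) \<odot>\<^bsub>kahler R\<^esub> ?d a"
  proof -
    have "?d P = (n \<otimes> p [^] k \<otimes> (\<ominus> (p \<otimes> p))) \<odot>\<^bsub>kahler R\<^esub> ?d a"
      unfolding P_def kahler_d_pow[OF c(4)] dp n_def[symmetric] using c cc by (simp add: K.smult_assoc1)
    also have "n \<otimes> p [^] k \<otimes> (\<ominus> (p \<otimes> p)) = \<ominus> (n \<otimes> (P \<otimes> p))"
      unfolding P_def using c cc by (simp add: r_minus m_ac)
    finally show ?thesis .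
  qed
  have "?d C' = q \<odot>\<^bsub>kahler R\<^esub> ?d C \<oplus>\<^bsub>kahler R\<^esub> C \<odot>\<^bsub>kahler R\<^esub> ?d q \<oplus>\<^bsub>kahler R\<^esub>
      E \<odot>\<^bsub>kahler R\<^esub> (i \<odot>\<^bsub>kahler R\<^esub> (P \<odot>\<^bsub>kahler R\<^esub> ?d q \<oplus>\<^bsub>kahler R\<^esub> q \<odot>\<^bsub>kahler R\<^esub> ?d P))"
    unfolding C'_def using c cc STC
    by (simp add: kahler_d_add kahler_d_mult[of q C] kahler_d_const_mult[OF dE] kahler_d_const_mult[OF di]
        kahler_d_mult[of P q])
  also have "\<dots> = (q \<otimes> (n \<otimes> C' \<oplus> p \<otimes> Q) \<oplus>
      (C \<otimes> (q \<otimes> q) \<oplus> E \<otimes> (i \<otimes> (P \<otimes> (q \<otimes> q) \<ominus> q \<otimes> (n \<otimes> (P \<otimes> p)))))) \<odot>\<^bsub>kahler R\<^esub> ?d a"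
    unfolding dC dq dP C'_def[symmetric] using c cc c' STC
    by (simp add: K.smult_l_distr K.smult_assoc1 minus_eq K.smult_l_minus K.smult_r_distr K.smult_r_minus
        K.M.a_assoc)
  also have "\<dots> = ((n \<oplus> \<one>) \<otimes> (q \<otimes> C' \<oplus> (\<ominus> E) \<otimes> (i' \<otimes> ((P \<otimes> p) \<otimes> q))) \<oplus> p \<otimes> (Q \<otimes> q)) \<odot>\<^bsub>kahler R\<^esub> ?d a"
    unfolding dilog_step[OF c(4,5) STC(3) cc(1,3,5,2,4,6) ni C'_def] ..
  also have "\<ominus> E = (\<ominus> \<one>) [^] Suc (Suc k)" unfolding E_def by (simp add: r_minus)
  finally have dC': "?d C' = (nat_one (Suc (Suc k)) \<otimes> (q \<otimes> C' \<oplus> (\<ominus> \<one>) [^] Suc (Suc k) \<otimes>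
      (inv (nat_one (Suc (Suc k))) \<otimes> (p [^] Suc (Suc k) \<otimes> q))) \<oplus> p \<otimes> q [^] Suc (Suc k)) \<odot>\<^bsub>kahler R\<^esub> ?d a"
    unfolding i'_def P_def Q_def n' by simp
  have "f' \<in> I" unfolding f'_def using f wI cc STC by (intro I.a_closed I.I_l_closed)
  then show ?case using c' df' ST' Sb' dC' by blast
qed

text \<open>For \<open>k = N - 1\<close> the error terms of the partial sums disappear: \<open>x\<^sup>N = 0\<close> gives
  \<open>S = - log(1 + x/a)/(b - x)\<close> exactly, and \<open>x\<^bsup>N-1\<^esup> dx = 0\<close> gives \<open>S dx = T dx\<close>. Together with
  \<open>d(b - x) = - (da + dx)\<close> this identifies \<open>df\<close>.\<close>

lemma steinberg_form_exact:
  assumes I: "ideal I R" and x: "x \<in> I" "x [^] N = \<zero>" and N: "N \<ge> 1"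
    and a: "a \<in> Units R" and b: "b \<in> Units R" and ab: "a \<oplus> b = \<one>"
    and u: "\<And>j. 1 \<le> j \<Longrightarrow> j \<le> N \<Longrightarrow> nat_one j \<in> Units R" and bx: "b \<ominus> x \<in> Units R"
  shows "\<exists>f\<in>I. kahler_d R f = nil_log R N (inv a \<otimes> x) \<odot>\<^bsub>kahler R\<^esub> dlog R (b \<ominus> x)
    \<ominus>\<^bsub>kahler R\<^esub> nil_log R N (\<ominus> (inv b \<otimes> x)) \<odot>\<^bsub>kahler R\<^esub> dlog R a"
proof -
  interpret I: ideal I R by (rule I)
  let ?d = "kahler_d R"
  have c: "x \<in> carrier R" "a \<in> carrier R" "b \<in> carrier R" "inv a \<in> carrier R" "inv b \<in> carrier R"
    using x a b by auto
  obtain k where k: "N = Suc k" using N by (cases N) auto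
  define L V where "L = nil_log R N (inv a \<otimes> x)" and "V = nil_log R N (\<ominus> (inv b \<otimes> x))"
  have LV: "L \<in> carrier R" "V \<in> carrier R"
    unfolding L_def V_def using c u by (auto intro!: nil_log_closed)
  obtain f S T C where f: "f \<in> I" and STC: "S \<in> carrier R" "T \<in> carrier R" "C \<in> carrier R"
    and df: "?d f = (S \<ominus> inv a \<otimes> V) \<odot>\<^bsub>kahler R\<^esub> ?d a \<oplus>\<^bsub>kahler R\<^esub> T \<odot>\<^bsub>kahler R\<^esub> ?d x"
    and ST: "S = T \<oplus> C \<otimes> x [^] k"
    and Sb: "S \<otimes> (b \<ominus> x) = \<ominus> L \<ominus> C \<otimes> x [^] Suc k"
    using dilog_partial_sums[OF I x(1) a b ab, where N = N and k = k] u unfolding L_def V_def k by blast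
  have Sb': "S \<otimes> (b \<ominus> x) = \<ominus> L" using Sb x(2) LV STC unfolding k by (simp add: minus_eq)
  have z: "x [^] k \<odot>\<^bsub>kahler R\<^esub> ?d x = \<zero>\<^bsub>kahler R\<^esub>"
    using pow_d_zero[of x k] x(2) c u[of "Suc k"] unfolding k by simp
  have Sx: "S \<odot>\<^bsub>kahler R\<^esub> ?d x = T \<odot>\<^bsub>kahler R\<^esub> ?d x"
    unfolding ST using STC c z by (simp add: K.smult_l_distr K.smult_assoc1)
  have dbx: "?d (b \<ominus> x) = \<ominus>\<^bsub>kahler R\<^esub> (?d a \<oplus>\<^bsub>kahler R\<^esub> ?d x)"
  proof -
    have "b \<ominus> x \<oplus> (a \<oplus> x) = (a \<oplus> b) \<oplus> (x \<oplus> \<ominus> x)" using c by (simp add: minus_eq a_ac)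
    then have e: "b \<ominus> x \<oplus> (a \<oplus> x) = \<one>" using c ab by (simp add: r_neg)
    have "?d (b \<ominus> x) \<oplus>\<^bsub>kahler R\<^esub> (?d a \<oplus>\<^bsub>kahler R\<^esub> ?d x) = ?d (b \<ominus> x \<oplus> (a \<oplus> x))"
      using c by (simp only: kahler_d_add a_closed minus_closed)
    then have "?d (b \<ominus> x) \<oplus>\<^bsub>kahler R\<^esub> (?d a \<oplus>\<^bsub>kahler R\<^esub> ?d x) = \<zero>\<^bsub>kahler R\<^esub>"
      unfolding e kahler_d_one .
    then show ?thesis using K.M.minus_equality[of "?d (b \<ominus> x)" "?d a \<oplus>\<^bsub>kahler R\<^esub> ?d x"] c by simp
  qed
  define v where "v = inv (b \<ominus> x)"
  have v: "v \<in> carrier R" "(b \<ominus> x) \<otimes> v = \<one>" unfolding v_def using bx by auto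
  have "L \<odot>\<^bsub>kahler R\<^esub> dlog R (b \<ominus> x) = (L \<otimes> v) \<odot>\<^bsub>kahler R\<^esub> (\<ominus>\<^bsub>kahler R\<^esub> (?d a \<oplus>\<^bsub>kahler R\<^esub> ?d x))"
    unfolding dlog_def dbx v_def[symmetric] using LV v c by (simp add: K.smult_assoc1)
  also have "\<dots> = ((\<ominus> L) \<otimes> v) \<odot>\<^bsub>kahler R\<^esub> (?d a \<oplus>\<^bsub>kahler R\<^esub> ?d x)"
    using LV v c by (simp add: l_minus K.smult_r_minus K.smult_l_minus)
  also have "(\<ominus> L) \<otimes> v = S \<otimes> ((b \<ominus> x) \<otimes> v)"
    unfolding Sb'[symmetric] using STC v c by (simp add: m_assoc)
  also have "\<dots> = S" using v STC by simp
  finally have "L \<odot>\<^bsub>kahler R\<^esub> dlog R (b \<ominus> x) = S \<odot>\<^bsub>kahler R\<^esub> ?d a \<oplus>\<^bsub>kahler R\<^esub> T \<odot>\<^bsub>kahler R\<^esub> ?d x"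
    using STC c by (simp add: K.smult_r_distr Sx)
  moreover have "V \<odot>\<^bsub>kahler R\<^esub> dlog R a = (inv a \<otimes> V) \<odot>\<^bsub>kahler R\<^esub> ?d a"
    unfolding dlog_def using LV c by (simp add: K.smult_assoc1[symmetric] m_comm)
  ultimately have "?d f = L \<odot>\<^bsub>kahler R\<^esub> dlog R (b \<ominus> x) \<ominus>\<^bsub>kahler R\<^esub> V \<odot>\<^bsub>kahler R\<^esub> dlog R a"
    unfolding df using STC LV c
    by (simp add: minus_eq K.M.minus_eq K.smult_l_distr K.smult_l_minus K.M.a_ac)
  then show ?thesis using f unfolding L_def V_def by blast
qed

end

section \<open>Homomorphisms out of Milnor K-groups\<close>

lemma quotient_by_generated_universal:
  assumes A: "comm_group A" and G: "group G" and h: "h \<in> hom A G"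
    and X: "X \<subseteq> carrier A" and van: "\<And>x. x \<in> X \<Longrightarrow> h x = \<one>\<^bsub>G\<^esub>"
  obtains g where "g \<in> hom (A Mod generate A X) G"
    "\<And>x. x \<in> carrier A \<Longrightarrow> g (generate A X #>\<^bsub>A\<^esub> x) = h x"
proof -
  interpret A: comm_group A by (rule A)
  interpret h: group_hom A G h
    by (intro group_hom.intro group_hom_axioms.intro A.is_group G h)
  have "generate A X \<subseteq> kernel A G h"
    using X van by (intro A.generate_subgroup_incl h.subgroup_kernel) (auto simp: kernel_def)
  then show ?thesis
    using h.FactGroup_universal_kernel[OF A.subgroup_imp_normal[OF A.generate_is_subgroup[OF X]]] that
    by blast
qed

text \<open>The relations of the tensor power and the Steinberg relations are divided out one after the
  other, by the same lemma.\<close>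

lemma milnor_K_universal:
  assumes R: "cring R" and G: "comm_group G"
    and cl: "\<And>rs. rs \<in> tuples (Units R) n \<Longrightarrow> \<beta> rs \<in> carrier G"
    and mult: "\<And>xs a b ys. \<lbrakk>length xs + length ys + 1 = n; set xs \<subseteq> Units R; set ys \<subseteq> Units R;
        a \<in> Units R; b \<in> Units R\<rbrakk> \<Longrightarrow> \<beta> (xs @ (a \<otimes>\<^bsub>R\<^esub> b) # ys) = \<beta> (xs @ a # ys) \<otimes>\<^bsub>G\<^esub> \<beta> (xs @ b # ys)"
    and steinberg: "\<And>xs r ys. \<lbrakk>length xs + length ys + 2 = n; set xs \<subseteq> Units R; set ys \<subseteq> Units R;
        r \<in> Units R; \<one>\<^bsub>R\<^esub> \<ominus>\<^bsub>R\<^esub> r \<in> Units R\<rbrakk> \<Longrightarrow> \<beta> (xs @ [r, \<one>\<^bsub>R\<^esub> \<ominus>\<^bsub>R\<^esub> r] @ ys) = \<one>\<^bsub>G\<^esub>"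
  obtains B where "B \<in> hom (milnor_K R n) G"
    "\<And>rs. rs \<in> tuples (Units R) n \<Longrightarrow> B (milnor_symbol R rs) = \<beta> rs"
proof -
  interpret R: cring R by (rule R)
  interpret G: comm_group G by (rule G)
  define S where "S = tuples (Units R) n"
  define A where "A = free_Abelian_group S"
  interpret A: comm_group A unfolding A_def by (rule abelian_free_Abelian_group)
  have carr: "carrier (units_of R) = Units R" and mu: "monoid.mult (units_of R) = monoid.mult R"
    by (rule units_of_carrier, rule units_of_mult)
  have fr: "frag_of rs \<in> carrier A" if "rs \<in> S" for rs using that unfolding A_def by simp
  define X where "X = {frag_of (xs @ (a \<otimes>\<^bsub>R\<^esub> b) # ys) - frag_of (xs @ a # ys) - frag_of (xs @ b # ys) | xs a b ys.
        length xs + length ys + 1 = n \<and> set xs \<subseteq> Units R \<and> set ys \<subseteq> Units R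
        \<and> a \<in> Units R \<and> b \<in> Units R}"
  have rel: "tensor_relations (units_of R) n = generate A X"
    unfolding tensor_relations_def carr mu A_def X_def S_def ..
  have minus: "x - y = x \<otimes>\<^bsub>A\<^esub> inv\<^bsub>A\<^esub> y" if "y \<in> carrier A" for x y
    using that unfolding A_def by (simp add: carrier_free_Abelian_group_iff)
  obtain h where h: "h \<in> hom A G" and h\<beta>: "\<And>rs. rs \<in> S \<Longrightarrow> h (frag_of rs) = \<beta> rs"
    unfolding A_def by (rule G.free_Abelian_group_universal[of \<beta> S]) (use cl in \<open>auto simp: S_def\<close>)
  interpret h: group_hom A G h by (intro group_hom.intro group_hom_axioms.intro A.is_group G.is_group h)
  have XA: "X \<subseteq> carrier A"
  proof
    fix z assume "z \<in> X"
    then obtain xs a b ys where z: "z = frag_of (xs @ (a \<otimes>\<^bsub>R\<^esub> b) # ys) - frag_of (xs @ a # ys) - frag_of (xs @ b # ys)"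
      and t: "xs @ (a \<otimes>\<^bsub>R\<^esub> b) # ys \<in> S" "xs @ a # ys \<in> S" "xs @ b # ys \<in> S"
      unfolding X_def S_def by auto
    show "z \<in> carrier A" unfolding z using t by (simp add: minus fr)
  qed
  have hX: "h z = \<one>\<^bsub>G\<^esub>" if "z \<in> X" for z
  proof -
    from that obtain xs a b ys where z: "z = frag_of (xs @ (a \<otimes>\<^bsub>R\<^esub> b) # ys) - frag_of (xs @ a # ys) - frag_of (xs @ b # ys)"
      and w: "length xs + length ys + 1 = n" "set xs \<subseteq> Units R" "set ys \<subseteq> Units R" "a \<in> Units R" "b \<in> Units R"
      unfolding X_def by blast
    have t: "xs @ (a \<otimes>\<^bsub>R\<^esub> b) # ys \<in> S" "xs @ a # ys \<in> S" "xs @ b # ys \<in> S"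
      unfolding S_def using w by auto
    have c: "\<beta> (xs @ a # ys) \<in> carrier G" "\<beta> (xs @ b # ys) \<in> carrier G"
      using cl t unfolding S_def by blast+
    have "h z = \<beta> (xs @ (a \<otimes>\<^bsub>R\<^esub> b) # ys) \<otimes>\<^bsub>G\<^esub> inv\<^bsub>G\<^esub> \<beta> (xs @ a # ys) \<otimes>\<^bsub>G\<^esub> inv\<^bsub>G\<^esub> \<beta> (xs @ b # ys)"
      unfolding z using t by (simp add: minus fr h\<beta>)
    also have "\<dots> = \<one>\<^bsub>G\<^esub>"
      unfolding mult[OF w] using c by (simp add: G.m_comm[of "\<beta> (xs @ a # ys)"] G.m_assoc)
    finally show ?thesis .
  qed
  obtain g where g: "g \<in> hom (tensor_power (units_of R) n) G"
    and gx: "\<And>x. x \<in> carrier A \<Longrightarrow> g (tensor_relations (units_of R) n #>\<^bsub>A\<^esub> x) = h x"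
    unfolding tensor_power_def carr S_def[symmetric] A_def[symmetric] rel
    by (rule quotient_by_generated_universal[OF A.comm_group_axioms G.is_group h XA], erule hX, blast)
  define T where "T = tensor_power (units_of R) n"
  have T: "comm_group T"
    unfolding T_def tensor_power_def carr S_def[symmetric] A_def[symmetric] rel
    by (rule A.abelian_FactGroup[OF A.generate_is_subgroup[OF XA]])
  have pure: "pure_tensor (units_of R) rs = tensor_relations (units_of R) n #>\<^bsub>A\<^esub> frag_of rs" if "rs \<in> S" for rs
    using that unfolding pure_tensor_def carr A_def S_def by (simp add: tuples_length)
  have pureT: "pure_tensor (units_of R) rs \<in> carrier T" if "rs \<in> S" for rs
    unfolding pure[OF that] T_def tensor_power_def carr S_def[symmetric] A_def[symmetric] carrier_FactGroup
    using fr[OF that] by blast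
  have gpure: "g (pure_tensor (units_of R) rs) = \<beta> rs" if "rs \<in> S" for rs
    unfolding pure[OF that] using gx[OF fr[OF that]] h\<beta>[OF that] by simp
  define Y where "Y = {pure_tensor (units_of R) (rs @ [r, \<one>\<^bsub>R\<^esub> \<ominus>\<^bsub>R\<^esub> r] @ ss) | rs r ss.
        length rs + length ss + 2 = n \<and> set rs \<subseteq> Units R \<and> set ss \<subseteq> Units R
        \<and> r \<in> Units R \<and> \<one>\<^bsub>R\<^esub> \<ominus>\<^bsub>R\<^esub> r \<in> Units R}"
  have st: "steinberg R n = generate T Y" unfolding steinberg_def T_def Y_def ..
  have YS: "rs @ [r, \<one>\<^bsub>R\<^esub> \<ominus>\<^bsub>R\<^esub> r] @ ss \<in> S"
    if "length rs + length ss + 2 = n" "set rs \<subseteq> Units R" "set ss \<subseteq> Units R"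
      "r \<in> Units R" "\<one>\<^bsub>R\<^esub> \<ominus>\<^bsub>R\<^esub> r \<in> Units R" for rs r ss
    using that unfolding S_def by simp
  have YT: "Y \<subseteq> carrier T" unfolding Y_def using pureT YS by blast
  have gY: "g y = \<one>\<^bsub>G\<^esub>" if "y \<in> Y" for y
  proof -
    from that obtain rs r ss where y: "y = pure_tensor (units_of R) (rs @ [r, \<one>\<^bsub>R\<^esub> \<ominus>\<^bsub>R\<^esub> r] @ ss)"
      and w: "length rs + length ss + 2 = n" "set rs \<subseteq> Units R" "set ss \<subseteq> Units R"
        "r \<in> Units R" "\<one>\<^bsub>R\<^esub> \<ominus>\<^bsub>R\<^esub> r \<in> Units R"
      unfolding Y_def by blast
    show ?thesis unfolding y gpure[OF YS[OF w]] by (rule steinberg[OF w])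
  qed
  obtain B where B: "B \<in> hom (milnor_K R n) G"
    and Bx: "\<And>x. x \<in> carrier T \<Longrightarrow> B (steinberg R n #>\<^bsub>T\<^esub> x) = g x"
    unfolding milnor_K_def T_def[symmetric] st
    by (rule quotient_by_generated_universal[OF T G.is_group g[folded T_def] YT], erule gY, blast)
  have "B (milnor_symbol R rs) = \<beta> rs" if "rs \<in> tuples (Units R) n" for rs
  proof -
    have rs: "rs \<in> S" using that by (simp add: S_def)
    have "milnor_symbol R rs = steinberg R n #>\<^bsub>T\<^esub> pure_tensor (units_of R) rs"
      using that unfolding milnor_symbol_def T_def by (simp add: tuples_length)
    then show ?thesis using Bx[OF pureT[OF rs]] gpure[OF rs] by simp
  qed
  then show ?thesis using B that by blast
qed

section \<open>Relative forms modulo exact forms\<close>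

locale ideal_in_cring = cring R for R (structure) +
  fixes I :: "'a set"
  assumes I: "ideal I R"
begin

sublocale I: ideal I R by (rule I)

lemma quot_cring: "cring (R Quot I)"
  by (rule I.quotient_is_cring[OF is_cring])

lemma quot_zero: "x \<in> I \<Longrightarrow> I +> x = \<zero>\<^bsub>R Quot I\<^esub>"
  by (simp add: FactRing_def I.a_rcos_const)

sublocale W: module R "forms R n" for n
  by (rule forms_module)

lemma forms_map_group_hom:
  "abelian_group_hom (forms R n) (forms (R Quot I) n) (forms_map R (R Quot I) (\<lambda>a. I +> a) n)"
  using module.axioms(2)[OF cring.forms_module[OF quot_cring]]
  by (intro abelian_group_hom_of_hom W.M.abelian_group_axioms
      forms_map_properties(1)[OF quot_cring I.rcos_ring_hom])

lemma de_rham_group_hom: "abelian_group_hom (forms R n) (forms R (Suc n)) (de_rham R n)"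
  using de_rham_properties(1)[of n]
  by (intro abelian_group_hom_of_hom W.M.abelian_group_axioms) simp

lemma forms_rel_iff: "x \<in> forms_rel R I n \<longleftrightarrow> x \<in> carrier (forms R n) \<and>
    forms_map R (R Quot I) (\<lambda>a. I +> a) n x = \<zero>\<^bsub>forms (R Quot I) n\<^esub>"
  unfolding forms_rel_def a_kernel_def' by blast

lemma forms_rel_carrier: "x \<in> forms_rel R I n \<Longrightarrow> x \<in> carrier (forms R n)"
  by (simp add: forms_rel_iff)

lemma forms_rel_zero: "\<zero>\<^bsub>forms R n\<^esub> \<in> forms_rel R I n"
  and forms_rel_add: "x \<in> forms_rel R I n \<Longrightarrow> y \<in> forms_rel R I n \<Longrightarrow> x \<oplus>\<^bsub>forms R n\<^esub> y \<in> forms_rel R I n"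
  and forms_rel_minus: "x \<in> forms_rel R I n \<Longrightarrow> \<ominus>\<^bsub>forms R n\<^esub> x \<in> forms_rel R I n"
proof -
  interpret h: abelian_group_hom "forms R n" "forms (R Quot I) n" "forms_map R (R Quot I) (\<lambda>a. I +> a) n"
    by (rule forms_map_group_hom)
  have z: "\<ominus>\<^bsub>forms (R Quot I) n\<^esub> \<zero>\<^bsub>forms (R Quot I) n\<^esub> = \<zero>\<^bsub>forms (R Quot I) n\<^esub>"
    using h.H.minus_equality[of "\<zero>\<^bsub>forms (R Quot I) n\<^esub>" "\<zero>\<^bsub>forms (R Quot I) n\<^esub>"] by simp
  show "\<zero>\<^bsub>forms R n\<^esub> \<in> forms_rel R I n"
    and "x \<in> forms_rel R I n \<Longrightarrow> y \<in> forms_rel R I n \<Longrightarrow> x \<oplus>\<^bsub>forms R n\<^esub> y \<in> forms_rel R I n"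
    and "x \<in> forms_rel R I n \<Longrightarrow> \<ominus>\<^bsub>forms R n\<^esub> x \<in> forms_rel R I n"
    by (simp_all add: forms_rel_iff z)
qed

lemma smult_in_forms_rel:
  assumes r: "r \<in> I" and x: "x \<in> carrier (forms R n)"
  shows "r \<odot>\<^bsub>forms R n\<^esub> x \<in> forms_rel R I n"
proof -
  interpret WQ: module "R Quot I" "forms (R Quot I) n" by (rule cring.forms_module[OF quot_cring])
  interpret h: abelian_group_hom "forms R n" "forms (R Quot I) n" "forms_map R (R Quot I) (\<lambda>a. I +> a) n"
    by (rule forms_map_group_hom)
  have rc: "r \<in> carrier R" using r by simp
  show ?thesis
    using forms_map_smult[OF quot_cring I.rcos_ring_hom rc x] r rc x
    by (simp add: forms_rel_iff quot_zero)
qed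

lemma de_rham_forms_rel:
  assumes "x \<in> forms_rel R I n"
  shows "de_rham R n x \<in> forms_rel R I (Suc n)"
proof -
  interpret d: abelian_group_hom "forms R n" "forms R (Suc n)" "de_rham R n" by (rule de_rham_group_hom)
  interpret Q: ideal_in_cring "R Quot I" "carrier (R Quot I)"
    using quot_cring by (intro ideal_in_cring.intro ideal_in_cring_axioms.intro ring.oneideal cring.axioms(1))
  interpret dQ: abelian_group_hom "forms (R Quot I) n" "forms (R Quot I) (Suc n)" "de_rham (R Quot I) n"
    by (rule Q.de_rham_group_hom)
  show ?thesis
    using assms forms_map_de_rham[OF quot_cring I.rcos_ring_hom, of x n] by (simp add: forms_rel_iff)
qed

lemma forms_rel_comm_group: "comm_group (forms_rel_group R I n)"
  unfolding forms_rel_group_def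
proof (rule comm_groupI, simp_all)
  fix x y z assume "x \<in> forms_rel R I n" "y \<in> forms_rel R I n" "z \<in> forms_rel R I n"
  then show "x \<oplus>\<^bsub>forms R n\<^esub> y \<oplus>\<^bsub>forms R n\<^esub> z = x \<oplus>\<^bsub>forms R n\<^esub> (y \<oplus>\<^bsub>forms R n\<^esub> z)"
    by (simp add: forms_rel_carrier W.M.a_assoc)
next
  fix x y assume "x \<in> forms_rel R I n" "y \<in> forms_rel R I n"
  then show "x \<oplus>\<^bsub>forms R n\<^esub> y = y \<oplus>\<^bsub>forms R n\<^esub> x" by (simp add: forms_rel_carrier W.M.a_comm)
next
  fix x assume x: "x \<in> forms_rel R I n"
  show "\<exists>y\<in>forms_rel R I n. y \<oplus>\<^bsub>forms R n\<^esub> x = \<zero>\<^bsub>forms R n\<^esub>"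
    using x by (intro bexI[of _ "\<ominus>\<^bsub>forms R n\<^esub> x"] forms_rel_minus) (simp_all add: forms_rel_carrier W.M.l_neg)
qed (simp_all add: forms_rel_zero forms_rel_add forms_rel_carrier)

lemma forms_rel_group_simps:
  "carrier (forms_rel_group R I n) = forms_rel R I n"
  "monoid.mult (forms_rel_group R I n) = add (forms R n)"
  "one (forms_rel_group R I n) = \<zero>\<^bsub>forms R n\<^esub>"
  by (simp_all add: forms_rel_group_def)

lemma forms_rel_group_inv:
  assumes x: "x \<in> forms_rel R I n"
  shows "inv\<^bsub>forms_rel_group R I n\<^esub> x = \<ominus>\<^bsub>forms R n\<^esub> x"
proof -
  interpret G: comm_group "forms_rel_group R I n" by (rule forms_rel_comm_group)
  show ?thesis
    using x by (intro G.inv_equality) (simp_all add: forms_rel_group_simps forms_rel_minus forms_rel_carrier W.M.l_neg)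
qed

lemma exact_rel_subset: "exact_rel R I n \<subseteq> forms_rel R I n"
  by (cases n) (auto simp: exact_rel_def forms_rel_zero de_rham_forms_rel)

lemma exact_rel_zero: "\<zero>\<^bsub>forms R n\<^esub> \<in> exact_rel R I n"
  and exact_rel_add: "x \<in> exact_rel R I n \<Longrightarrow> y \<in> exact_rel R I n \<Longrightarrow> x \<oplus>\<^bsub>forms R n\<^esub> y \<in> exact_rel R I n"
  and exact_rel_minus: "x \<in> exact_rel R I n \<Longrightarrow> \<ominus>\<^bsub>forms R n\<^esub> x \<in> exact_rel R I n"
proof -
  have "\<zero>\<^bsub>forms R n\<^esub> \<in> exact_rel R I n \<and>
      (x \<in> exact_rel R I n \<longrightarrow> y \<in> exact_rel R I n \<longrightarrow> x \<oplus>\<^bsub>forms R n\<^esub> y \<in> exact_rel R I n) \<and>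
      (x \<in> exact_rel R I n \<longrightarrow> \<ominus>\<^bsub>forms R n\<^esub> x \<in> exact_rel R I n)"
  proof (cases n)
    case 0
    have "\<ominus>\<^bsub>forms R 0\<^esub> \<zero>\<^bsub>forms R 0\<^esub> = \<zero>\<^bsub>forms R 0\<^esub>"
      by (rule W.M.minus_equality) simp_all
    then show ?thesis unfolding 0 by (simp add: exact_rel_def)
  next
    case (Suc m)
    interpret d: abelian_group_hom "forms R m" "forms R (Suc m)" "de_rham R m" by (rule de_rham_group_hom)
    have E: "exact_rel R I (Suc m) = de_rham R m ` forms_rel R I m" unfolding exact_rel_def by simp
    have "\<zero>\<^bsub>forms R n\<^esub> \<in> exact_rel R I n"
      unfolding Suc E by (rule image_eqI[of _ _ "\<zero>\<^bsub>forms R m\<^esub>"]) (simp_all add: forms_rel_zero)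
    moreover have "x \<oplus>\<^bsub>forms R n\<^esub> y \<in> exact_rel R I n" if xy: "x \<in> exact_rel R I n" "y \<in> exact_rel R I n"
    proof -
      obtain u v where u: "u \<in> forms_rel R I m" "x = de_rham R m u" and v: "v \<in> forms_rel R I m" "y = de_rham R m v"
        using xy unfolding Suc E by blast
      show ?thesis unfolding Suc E u(2) v(2)
        using u(1) v(1) by (intro image_eqI[of _ _ "u \<oplus>\<^bsub>forms R m\<^esub> v"]) (simp_all add: forms_rel_carrier forms_rel_add)
    qed
    moreover have "\<ominus>\<^bsub>forms R n\<^esub> x \<in> exact_rel R I n" if x: "x \<in> exact_rel R I n"
    proof -
      obtain u where u: "u \<in> forms_rel R I m" "x = de_rham R m u"
        using x unfolding Suc E by blast
      show ?thesis unfolding Suc E u(2)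
        using u(1) by (intro image_eqI[of _ _ "\<ominus>\<^bsub>forms R m\<^esub> u"]) (simp_all add: forms_rel_carrier forms_rel_minus)
    qed
    ultimately show ?thesis by blast
  qed
  then show "\<zero>\<^bsub>forms R n\<^esub> \<in> exact_rel R I n"
    and "x \<in> exact_rel R I n \<Longrightarrow> y \<in> exact_rel R I n \<Longrightarrow> x \<oplus>\<^bsub>forms R n\<^esub> y \<in> exact_rel R I n"
    and "x \<in> exact_rel R I n \<Longrightarrow> \<ominus>\<^bsub>forms R n\<^esub> x \<in> exact_rel R I n"
    by blast+
qed

lemma exact_rel_subgroup: "subgroup (exact_rel R I n) (forms_rel_group R I n)"
proof
  show "inv\<^bsub>forms_rel_group R I n\<^esub> x \<in> exact_rel R I n" if "x \<in> exact_rel R I n" for x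
    using that exact_rel_subset[of n] forms_rel_group_inv[of x n] exact_rel_minus[of x n] by auto
qed (use exact_rel_subset exact_rel_zero exact_rel_add in \<open>auto simp: forms_rel_group_simps\<close>)

lemma forms_quotient_comm_group: "comm_group (forms_rel_group R I n Mod exact_rel R I n)"
  by (rule comm_group.abelian_FactGroup[OF forms_rel_comm_group exact_rel_subgroup])

lemma form_class_closed:
  "x \<in> forms_rel R I n \<Longrightarrow>
    exact_rel R I n #>\<^bsub>forms_rel_group R I n\<^esub> x \<in> carrier (forms_rel_group R I n Mod exact_rel R I n)"
  by (auto simp: carrier_FactGroup forms_rel_group_simps)

lemma form_class_add:
  assumes "x \<in> forms_rel R I n" "y \<in> forms_rel R I n"
  shows "exact_rel R I n #>\<^bsub>forms_rel_group R I n\<^esub> (x \<oplus>\<^bsub>forms R n\<^esub> y) =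
    (exact_rel R I n #>\<^bsub>forms_rel_group R I n\<^esub> x) \<otimes>\<^bsub>forms_rel_group R I n Mod exact_rel R I n\<^esub>
    (exact_rel R I n #>\<^bsub>forms_rel_group R I n\<^esub> y)"
proof -
  interpret N: normal "exact_rel R I n" "forms_rel_group R I n"
    by (rule comm_group.subgroup_imp_normal[OF forms_rel_comm_group exact_rel_subgroup])
  show ?thesis
    using N.rcos_sum[of x y] assms by (simp add: forms_rel_group_simps)
qed

lemma form_class_exact:
  "x \<in> exact_rel R I n \<Longrightarrow> exact_rel R I n #>\<^bsub>forms_rel_group R I n\<^esub> x =
    \<one>\<^bsub>forms_rel_group R I n Mod exact_rel R I n\<^esub>"
  using subgroup.rcos_const[OF exact_rel_subgroup comm_group.axioms(2)[OF forms_rel_comm_group]] by simp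

lemma form_class_add_exact:
  assumes "x \<in> forms_rel R I n" "e \<in> exact_rel R I n"
  shows "exact_rel R I n #>\<^bsub>forms_rel_group R I n\<^esub> (x \<oplus>\<^bsub>forms R n\<^esub> e) =
    exact_rel R I n #>\<^bsub>forms_rel_group R I n\<^esub> x"
proof -
  interpret Q: comm_group "forms_rel_group R I n Mod exact_rel R I n" by (rule forms_quotient_comm_group)
  have "e \<in> forms_rel R I n" using assms(2) exact_rel_subset by blast
  then show ?thesis
    using assms(1) Q.r_one[OF form_class_closed[OF assms(1)]]
    by (simp only: form_class_add form_class_exact[OF assms(2)])
qed

lemma dlogs_closed: "set cs \<subseteq> Units R \<Longrightarrow> set (map (dlog R) cs) \<subseteq> carrier (kahler R)"
  using dlog_closed by auto

text \<open>Up to the sign of moving \<open>df\<close> to the front, which is absorbed into \<open>f\<close>, this is the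
  differential of \<open>f\<close> times the remaining logarithmic forms, and these are closed.\<close>

lemma wedge_d_exact:
  assumes f: "f \<in> I" and cs: "set as \<subseteq> Units R" "set cs \<subseteq> Units R" "length as + length cs = m"
  shows "form_wedge R (map (dlog R) as @ kahler_d R f # map (dlog R) cs) \<in> exact_rel R I (Suc m)"
proof -
  interpret K: module R "kahler R" by (rule kahler_module)
  define s where "s = (\<ominus> \<one>) [^] length as"
  have s: "s \<in> carrier R" "kahler_d R s = \<zero>\<^bsub>kahler R\<^esub>" unfolding s_def by (simp_all add: kahler_d_sign)
  have fc: "f \<in> carrier R" using f by simp
  have sf: "s \<otimes> f \<in> I" using f s by (intro I.I_l_closed)
  let ?A = "map (dlog R) as" and ?C = "map (dlog R) cs"
  have ds: "set ?A \<subseteq> carrier (kahler R)" "set ?C \<subseteq> carrier (kahler R)" "set (map (dlog R) (as @ cs)) \<subseteq> carrier (kahler R)"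
    using cs dlogs_closed by auto
  have "form_wedge R (?A @ kahler_d R f # ?C) = s \<odot>\<^bsub>forms R (Suc m)\<^esub> form_wedge R (kahler_d R f # ?A @ ?C)"
    unfolding s_def using form_wedge_move[of "[]" ?A ?C "Suc m" "kahler_d R f"] cs ds fc by simp
  also have "\<dots> = form_wedge R ((s \<odot>\<^bsub>kahler R\<^esub> kahler_d R f) # ?A @ ?C)"
    using form_wedge_smult[of "[]" "?A @ ?C" "Suc m" s "kahler_d R f"] cs ds fc s by simp
  also have "s \<odot>\<^bsub>kahler R\<^esub> kahler_d R f = kahler_d R (s \<otimes> f)"
    using kahler_d_const_mult[OF s(2,1) fc] by simp
  also have "form_wedge R (kahler_d R (s \<otimes> f) # ?A @ ?C) =
      de_rham R m ((s \<otimes> f) \<odot>\<^bsub>forms R m\<^esub> form_wedge R (map (dlog R) (as @ cs)))"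
    using de_rham_dlog[of "s \<otimes> f" "as @ cs" m] cs s fc by simp
  also have "\<dots> \<in> exact_rel R I (Suc m)"
    unfolding exact_rel_def using cs ds
    by (simp add: smult_in_forms_rel[OF sf] form_wedge_closed tuples_def)
  finally show ?thesis .
qed

end

section \<open>The Bloch map of a split nilpotent ideal\<close>

text \<open>A ring section of \<open>R \<rightarrow> R/I\<close> enters only through the endomorphism \<open>\<sigma>\<close> of \<open>R\<close> that it induces.\<close>

locale split_nilpotent = ideal_in_cring +
  fixes N :: nat and \<sigma> :: "'a \<Rightarrow> 'a"
  assumes N: "N \<ge> 1"
    and nil: "I [^]\<^bsub>ideals_set R\<^esub> N = {\<zero>}"
    and nat_unit: "\<And>k. 1 \<le> k \<Longrightarrow> k \<le> N \<Longrightarrow> nat_one k \<in> Units R"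
    and fact_unit: "nat_one (fact (N - 1)) \<in> Units R"
    and \<sigma>_hom: "\<sigma> \<in> ring_hom R R"
    and \<sigma>_ideal: "\<And>x. x \<in> I \<Longrightarrow> \<sigma> x = \<zero>"
    and \<sigma>_diff: "\<And>r. r \<in> carrier R \<Longrightarrow> r \<ominus> \<sigma> r \<in> I"
begin

interpretation K: module R "kahler R"
  by (rule kahler_module)

lemma \<sigma>_closed [simp]: "r \<in> carrier R \<Longrightarrow> \<sigma> r \<in> carrier R"
  using \<sigma>_hom by (rule ring_hom_closed)

lemma \<sigma>_mult: "a \<in> carrier R \<Longrightarrow> b \<in> carrier R \<Longrightarrow> \<sigma> (a \<otimes> b) = \<sigma> a \<otimes> \<sigma> b"
  using \<sigma>_hom by (rule ring_hom_mult)

lemma \<sigma>_add: "a \<in> carrier R \<Longrightarrow> b \<in> carrier R \<Longrightarrow> \<sigma> (a \<oplus> b) = \<sigma> a \<oplus> \<sigma> b"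
  using \<sigma>_hom by (rule ring_hom_add)

lemma \<sigma>_one: "\<sigma> \<one> = \<one>"
  using \<sigma>_hom by (rule ring_hom_one)

lemma \<sigma>_Units: "r \<in> Units R \<Longrightarrow> \<sigma> r \<in> Units R"
proof -
  assume r: "r \<in> Units R"
  have "\<sigma> r \<otimes> \<sigma> (inv r) = \<one>" "\<sigma> (inv r) \<otimes> \<sigma> r = \<one>"
    using r by (simp_all add: \<sigma>_mult[symmetric] \<sigma>_one Units_closed)
  moreover have "\<sigma> r \<in> carrier R" "\<sigma> (inv r) \<in> carrier R" using r by (simp_all add: Units_closed)
  ultimately show "\<sigma> r \<in> Units R" unfolding Units_def by blast
qed

lemma ideal_pow_zero: "x \<in> I \<Longrightarrow> x [^] N = \<zero>"
  using ideal_power_pow[OF I, of x N] nil by simp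

text \<open>The inverse is a partial sum of the geometric series in \<open>-x\<close>.\<close>

lemma one_plus_Units:
  assumes x: "x \<in> I"
  shows "\<one> \<oplus> x \<in> Units R"
proof -
  have xc: "x \<in> carrier R" using x by simp
  have "\<exists>g\<in>carrier R. (\<one> \<oplus> x) \<otimes> g = \<one> \<ominus> (\<ominus> x) [^] k" for k :: nat
  proof (induction k)
    case 0
    then show ?case using xc by (intro bexI[of _ \<zero>]) (simp_all add: minus_eq r_neg)
  next
    case (Suc k)
    then obtain g where g: "g \<in> carrier R" "(\<one> \<oplus> x) \<otimes> g = \<one> \<ominus> (\<ominus> x) [^] k" by blast
    define w where "w = (\<ominus> x) [^] k"
    have w: "w \<in> carrier R" unfolding w_def using xc by simp
    have "(\<one> \<oplus> x) \<otimes> (g \<oplus> w) = (\<one> \<ominus> w) \<oplus> (\<one> \<oplus> x) \<otimes> w"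
      using g w xc by (simp add: r_distr w_def)
    also have "\<dots> = \<one> \<oplus> x \<otimes> w"
      using w xc by (simp add: l_distr minus_eq a_assoc r_neg1 r_neg2)
    also have "\<dots> = \<one> \<ominus> w \<otimes> (\<ominus> x)"
      using w xc by (simp add: minus_eq r_minus m_comm)
    finally show ?case using g w by (intro bexI[of _ "g \<oplus> w"]) (simp_all add: w_def)
  qed
  then obtain g where g: "g \<in> carrier R" "(\<one> \<oplus> x) \<otimes> g = \<one> \<ominus> (\<ominus> x) [^] N" by blast
  have "(\<ominus> x) [^] N = \<zero>" using x by (intro ideal_pow_zero) simp
  then have "(\<one> \<oplus> x) \<otimes> g = \<one>" using g by (simp add: minus_eq)
  then show ?thesis using g xc m_comm[of g "\<one> \<oplus> x"] unfolding Units_def by auto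
qed

lemma nil_log_in_ideal:
  assumes x: "x \<in> I"
  shows "nil_log R N x \<in> I"
proof -
  have xc: "x \<in> carrier R" using x by simp
  have "Suc k \<le> N \<Longrightarrow> nil_log R (Suc k) x \<in> I" for k
  proof (induction k)
    case 0
    then show ?case by (simp add: nil_log_Suc_0)
  next
    case (Suc k)
    have u: "nat_one (Suc k) \<in> Units R" using Suc.prems by (intro nat_unit) auto
    have "x [^] Suc k \<in> I" using x xc by (simp add: I.I_l_closed)
    then have "(\<ominus> \<one>) [^] k \<otimes> (inv (nat_one (Suc k)) \<otimes> x [^] Suc k) \<in> I"
      using u by (intro I.I_l_closed) (simp_all del: nat_pow_Suc add.nat_pow_Suc)
    moreover have "nil_log R (Suc k) x \<in> I" using Suc by simp
    ultimately show ?case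
      using Suc.prems xc by (subst nil_log_Suc_Suc) (auto intro: nat_unit simp del: nat_pow_Suc add.nat_pow_Suc)
  qed
  from this[of "N - 1"] show ?thesis using N by simp
qed

definition unipotent_part :: "'a \<Rightarrow> 'a" where
  "unipotent_part r = inv (\<sigma> r) \<otimes> (r \<ominus> \<sigma> r)"

definition split_log :: "'a \<Rightarrow> 'a" where
  "split_log r = nil_log R N (unipotent_part r)"

lemma unipotent_part_in_ideal: "r \<in> Units R \<Longrightarrow> unipotent_part r \<in> I"
  unfolding unipotent_part_def using \<sigma>_Units[of r] by (intro I.I_l_closed \<sigma>_diff) (auto simp: Units_closed)

lemma unit_decomposition:
  assumes r: "r \<in> Units R"
  shows "\<sigma> r \<otimes> (\<one> \<oplus> unipotent_part r) = r"
proof -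
  have c: "r \<in> carrier R" "\<sigma> r \<in> carrier R" "inv (\<sigma> r) \<in> carrier R" using r \<sigma>_Units[OF r] by auto
  have "\<sigma> r \<otimes> (\<one> \<oplus> unipotent_part r) = \<sigma> r \<oplus> (\<sigma> r \<otimes> inv (\<sigma> r)) \<otimes> (r \<ominus> \<sigma> r)"
    unfolding unipotent_part_def using c by (simp add: r_distr m_assoc)
  also have "\<dots> = \<sigma> r \<oplus> (r \<oplus> \<ominus> \<sigma> r)" using \<sigma>_Units[OF r] c by (simp add: minus_eq)
  also have "\<dots> = r" using c by (simp add: a_comm[of r] r_neg2)
  finally show ?thesis .
qed

lemma unipotent_part_unique:
  assumes r: "r \<in> Units R" and x: "x \<in> carrier R" and eq: "\<sigma> r \<otimes> (\<one> \<oplus> x) = r"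
  shows "unipotent_part r = x"
proof -
  have u: "unipotent_part r \<in> carrier R" using unipotent_part_in_ideal[OF r] by simp
  have "\<sigma> r \<otimes> (\<one> \<oplus> unipotent_part r) = \<sigma> r \<otimes> (\<one> \<oplus> x)" using unit_decomposition[OF r] eq by simp
  then have "\<one> \<oplus> unipotent_part r = \<one> \<oplus> x"
    using Units_l_cancel[OF \<sigma>_Units[OF r]] u x by simp
  then show ?thesis using u x by simp
qed

lemma split_log_in_ideal: "r \<in> Units R \<Longrightarrow> split_log r \<in> I"
  unfolding split_log_def by (intro nil_log_in_ideal unipotent_part_in_ideal)

lemma split_log_mult:
  assumes a: "a \<in> Units R" and b: "b \<in> Units R"
  shows "split_log (a \<otimes> b) = split_log a \<oplus> split_log b"
proof -
  define x y where "x = unipotent_part a" and "y = unipotent_part b"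
  have xy: "x \<in> I" "y \<in> I" unfolding x_def y_def using a b by (simp_all add: unipotent_part_in_ideal)
  have c: "a \<in> carrier R" "b \<in> carrier R" "x \<in> carrier R" "y \<in> carrier R" using a b xy by auto
  have "\<sigma> (a \<otimes> b) \<otimes> (\<one> \<oplus> (x \<oplus> y \<oplus> x \<otimes> y)) = (\<sigma> a \<otimes> (\<one> \<oplus> x)) \<otimes> (\<sigma> b \<otimes> (\<one> \<oplus> y))"
  proof -
    have "\<one> \<oplus> (x \<oplus> y \<oplus> x \<otimes> y) = (\<one> \<oplus> x) \<otimes> (\<one> \<oplus> y)"
      using c by (simp add: l_distr r_distr a_ac)
    then show ?thesis using c by (simp add: \<sigma>_mult m_ac)
  qed
  also have "\<dots> = a \<otimes> b" unfolding x_def y_def unit_decomposition[OF a] unit_decomposition[OF b] ..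
  finally have "unipotent_part (a \<otimes> b) = x \<oplus> y \<oplus> x \<otimes> y"
    using a b c by (intro unipotent_part_unique) simp_all
  then show ?thesis
    unfolding split_log_def
    using nil_log_add[OF I N nil _ fact_unit xy] nat_unit unfolding x_def y_def by simp
qed

lemma split_log_one_plus:
  assumes x: "x \<in> I"
  shows "split_log (\<one> \<oplus> x) = nil_log R N x" and "\<sigma> (\<one> \<oplus> x) = \<one>"
proof -
  have c: "x \<in> carrier R" using x by simp
  show s: "\<sigma> (\<one> \<oplus> x) = \<one>" using c by (simp add: \<sigma>_add \<sigma>_one \<sigma>_ideal[OF x])
  have "unipotent_part (\<one> \<oplus> x) = x"
    using c s one_plus_Units[OF x] by (intro unipotent_part_unique) simp_all
  then show "split_log (\<one> \<oplus> x) = nil_log R N x" by (simp add: split_log_def)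
qed

lemma dlog_split:
  assumes r: "r \<in> Units R"
  shows "dlog R r = dlog R (\<sigma> r) \<oplus>\<^bsub>kahler R\<^esub> kahler_d R (split_log r)"
proof -
  have x: "unipotent_part r \<in> I" by (rule unipotent_part_in_ideal[OF r])
  have "kahler_d R (split_log r) = dlog R (\<one> \<oplus> unipotent_part r)"
    unfolding split_log_def using x
    by (intro kahler_d_nil_log[OF N _ ideal_pow_zero nat_unit] one_plus_Units) auto
  then show ?thesis
    using dlog_mult[OF \<sigma>_Units[OF r] one_plus_Units[OF x]] unit_decomposition[OF r] by simp
qed

text \<open>With \<open>a = \<sigma>(r)\<close>, \<open>b = \<sigma>(1 - r) = 1 - a\<close> and \<open>x = r - a\<close>, the two units are \<open>a (1 + x/a)\<close> and
  \<open>b (1 - x/b)\<close>.\<close>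

lemma steinberg_split_log_exact:
  assumes r: "r \<in> Units R" and r': "\<one> \<ominus> r \<in> Units R"
  shows "\<exists>f\<in>I. kahler_d R f = split_log r \<odot>\<^bsub>kahler R\<^esub> dlog R (\<one> \<ominus> r)
    \<ominus>\<^bsub>kahler R\<^esub> split_log (\<one> \<ominus> r) \<odot>\<^bsub>kahler R\<^esub> dlog R (\<sigma> r)"
proof -
  define a b x where "a = \<sigma> r" and "b = \<sigma> (\<one> \<ominus> r)" and "x = r \<ominus> \<sigma> r"
  have rc: "r \<in> carrier R" using r by auto
  have u: "a \<in> Units R" "b \<in> Units R" unfolding a_def b_def using r r' by (simp_all add: \<sigma>_Units)
  have c: "a \<in> carrier R" "b \<in> carrier R" "x \<in> carrier R"
    using u \<sigma>_diff[OF rc] by (auto simp: x_def)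
  have e: "r \<oplus> (\<one> \<ominus> r) = \<one>" using rc by (simp add: minus_eq a_comm[of \<one>] r_neg2 a_lcomm[of r] r_neg1)
  have ab: "a \<oplus> b = \<one>"
    unfolding a_def b_def using \<sigma>_add[OF rc, of "\<one> \<ominus> r"] rc by (simp add: e \<sigma>_one)
  have bx: "b \<ominus> x = \<one> \<ominus> r"
  proof -
    have "b \<ominus> x = (a \<oplus> b) \<ominus> r"
      unfolding x_def a_def[symmetric] using c rc by (simp add: minus_eq minus_add a_ac)
    then show ?thesis using ab by simp
  qed
  have "b \<ominus> x \<ominus> b = \<ominus> x" using c by (simp add: minus_eq a_comm[of b] a_assoc r_neg)
  then have "unipotent_part (\<one> \<ominus> r) = \<ominus> (inv b \<otimes> x)"
    unfolding unipotent_part_def b_def[symmetric] unfolding bx[symmetric] using c u by (simp add: r_minus)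
  moreover have "unipotent_part r = inv a \<otimes> x" unfolding unipotent_part_def a_def x_def ..
  moreover have "x \<in> I" unfolding x_def using rc by (rule \<sigma>_diff)
  ultimately show ?thesis
    using steinberg_form_exact[OF I _ ideal_pow_zero N u ab nat_unit, of x] r'
    unfolding split_log_def a_def[symmetric] bx by simp
qed

text \<open>Writing each \<open>r\<close> as \<open>\<sigma>(r)(1 + x)\<close> and expanding the symbol multilinearly from the left gives
  \<open>\<Sum>\<^sub>i {\<sigma>(r\<^sub>0), \<dots>, \<sigma>(r\<^bsub>i-1\<^esub>), 1 + x\<^sub>i, r\<^bsub>i+1\<^esub>, \<dots>, r\<^sub>n}\<close> up to a symbol of the image of \<open>\<sigma>\<close>.
  The following is the sum of the values that a Bloch map has to take on these symbols.
  The 1-forms \<open>\<omega>s\<close> accumulate the factors to the left.\<close>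

primrec bloch_sum :: "nat \<Rightarrow> ('a \<Rightarrow> 'a) set list \<Rightarrow> 'a list \<Rightarrow> 'a form" where
  "bloch_sum n \<omega>s [] = \<zero>\<^bsub>forms R n\<^esub>"
| "bloch_sum n \<omega>s (r # rs) =
    split_log r \<odot>\<^bsub>forms R n\<^esub> form_wedge R (\<omega>s @ map (dlog R) rs)
    \<ominus>\<^bsub>forms R n\<^esub> bloch_sum n (\<omega>s @ [dlog R (\<sigma> r)]) rs"

lemma split_log_carrier [simp]: "r \<in> Units R \<Longrightarrow> split_log r \<in> carrier R"
  using split_log_in_ideal by auto

lemma dlog_\<sigma>_closed: "r \<in> Units R \<Longrightarrow> dlog R (\<sigma> r) \<in> carrier (kahler R)"
  by (simp add: \<sigma>_Units)

lemma bloch_sum_forms_rel: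
  assumes "set \<omega>s \<subseteq> carrier (kahler R)" "set rs \<subseteq> Units R" "length \<omega>s + length rs = Suc n"
  shows "bloch_sum n \<omega>s rs \<in> forms_rel R I n"
  using assms
proof (induction rs arbitrary: \<omega>s)
  case Nil
  then show ?case by (simp add: forms_rel_zero)
next
  case (Cons r rs)
  have "form_wedge R (\<omega>s @ map (dlog R) rs) \<in> carrier (forms R n)"
    using Cons.prems dlogs_closed[of rs] by (intro form_wedge_closed) simp
  then have "split_log r \<odot>\<^bsub>forms R n\<^esub> form_wedge R (\<omega>s @ map (dlog R) rs) \<in> forms_rel R I n"
    using Cons.prems by (intro smult_in_forms_rel split_log_in_ideal) simp_all
  moreover have "bloch_sum n (\<omega>s @ [dlog R (\<sigma> r)]) rs \<in> forms_rel R I n"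
    using Cons.prems by (intro Cons.IH) (simp_all add: dlog_\<sigma>_closed)
  ultimately show ?case
    by (simp add: a_minus_def forms_rel_add forms_rel_minus)
qed

lemma bloch_sum_closed:
  assumes "set \<omega>s \<subseteq> carrier (kahler R)" "set rs \<subseteq> Units R" "length \<omega>s + length rs = Suc n"
  shows "bloch_sum n \<omega>s rs \<in> carrier (forms R n)"
  using bloch_sum_forms_rel[OF assms] by (rule forms_rel_carrier)

text \<open>All summands contain the factors \<open>\<omega>s\<close>.\<close>

lemma bloch_sum_zero:
  assumes "set rs \<subseteq> Units R"
    and "\<And>\<eta>s. set \<eta>s \<subseteq> carrier (kahler R) \<Longrightarrow> length \<omega>s + length \<eta>s = n \<Longrightarrow>
      form_wedge R (\<omega>s @ \<eta>s) = \<zero>\<^bsub>forms R n\<^esub>"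
    and "length \<omega>s + length rs = Suc n"
  shows "bloch_sum n \<omega>s rs = \<zero>\<^bsub>forms R n\<^esub>"
  using assms
proof (induction rs arbitrary: \<omega>s)
  case Nil
  then show ?case by simp
next
  case (Cons r rs)
  have "form_wedge R ((\<omega>s @ [dlog R (\<sigma> r)]) @ \<eta>s) = \<zero>\<^bsub>forms R n\<^esub>"
    if "set \<eta>s \<subseteq> carrier (kahler R)" "length (\<omega>s @ [dlog R (\<sigma> r)]) + length \<eta>s = n" for \<eta>s
    using Cons.prems(2)[of "dlog R (\<sigma> r) # \<eta>s"] Cons.prems(1) that by (simp add: dlog_\<sigma>_closed)
  then have "bloch_sum n (\<omega>s @ [dlog R (\<sigma> r)]) rs = \<zero>\<^bsub>forms R n\<^esub>"
    using Cons.prems by (intro Cons.IH) simp_all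
  moreover have "form_wedge R (\<omega>s @ map (dlog R) rs) = \<zero>\<^bsub>forms R n\<^esub>"
    using Cons.prems dlogs_closed[of rs] by (intro Cons.prems(2)) simp_all
  ultimately show ?case using Cons.prems by (simp add: W.M.minus_eq W.M.r_neg)
qed

lemma bloch_sum_add_form:
  assumes "set \<omega>s \<subseteq> carrier (kahler R)" "set \<eta>s \<subseteq> carrier (kahler R)" "set rs \<subseteq> Units R"
    "x \<in> carrier (kahler R)" "y \<in> carrier (kahler R)" "length \<omega>s + length \<eta>s + length rs = n"
  shows "bloch_sum n (\<omega>s @ (x \<oplus>\<^bsub>kahler R\<^esub> y) # \<eta>s) rs =
    bloch_sum n (\<omega>s @ x # \<eta>s) rs \<oplus>\<^bsub>forms R n\<^esub> bloch_sum n (\<omega>s @ y # \<eta>s) rs"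
  using assms
proof (induction rs arbitrary: \<eta>s)
  case Nil
  then show ?case by simp
next
  case (Cons r rs)
  let ?\<eta> = "\<eta>s @ [dlog R (\<sigma> r)]"
  let ?W = "\<lambda>z. form_wedge R (\<omega>s @ z # \<eta>s @ map (dlog R) rs)"
  have ds: "set (map (dlog R) rs) \<subseteq> carrier (kahler R)" using Cons.prems by (intro dlogs_closed) simp
  have Wc: "?W z \<in> carrier (forms R n)" if "z \<in> carrier (kahler R)" for z
    using Cons.prems ds that by (intro form_wedge_closed) simp
  have bc: "bloch_sum n (\<omega>s @ z # ?\<eta>) rs \<in> carrier (forms R n)" if "z \<in> carrier (kahler R)" for z
    using Cons.prems that by (intro bloch_sum_closed) (simp_all add: dlog_\<sigma>_closed)
  have 1: "?W (x \<oplus>\<^bsub>kahler R\<^esub> y) = ?W x \<oplus>\<^bsub>forms R n\<^esub> ?W y"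
    using form_wedge_add[of \<omega>s "\<eta>s @ map (dlog R) rs" n x y] Cons.prems ds by simp
  have 2: "bloch_sum n (\<omega>s @ (x \<oplus>\<^bsub>kahler R\<^esub> y) # ?\<eta>) rs =
      bloch_sum n (\<omega>s @ x # ?\<eta>) rs \<oplus>\<^bsub>forms R n\<^esub> bloch_sum n (\<omega>s @ y # ?\<eta>) rs"
    using Cons.prems by (intro Cons.IH) (simp_all add: dlog_\<sigma>_closed)
  have rc: "split_log r \<in> carrier R" using Cons.prems by simp
  have "split_log r \<odot>\<^bsub>forms R n\<^esub> (?W x \<oplus>\<^bsub>forms R n\<^esub> ?W y) \<ominus>\<^bsub>forms R n\<^esub>
      (bloch_sum n (\<omega>s @ x # ?\<eta>) rs \<oplus>\<^bsub>forms R n\<^esub> bloch_sum n (\<omega>s @ y # ?\<eta>) rs) =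
    (split_log r \<odot>\<^bsub>forms R n\<^esub> ?W x \<ominus>\<^bsub>forms R n\<^esub> bloch_sum n (\<omega>s @ x # ?\<eta>) rs) \<oplus>\<^bsub>forms R n\<^esub>
    (split_log r \<odot>\<^bsub>forms R n\<^esub> ?W y \<ominus>\<^bsub>forms R n\<^esub> bloch_sum n (\<omega>s @ y # ?\<eta>) rs)"
    using rc Wc[of x] Wc[of y] bc[of x] bc[of y] Cons.prems(4,5)
    by (simp add: W.smult_r_distr W.M.minus_eq W.M.minus_add W.M.a_ac)
  then show ?case using 1 2 by simp
qed

lemma bloch_sum_mult:
  assumes "set \<omega>s \<subseteq> carrier (kahler R)" "set xs \<subseteq> Units R" "set ys \<subseteq> Units R" "a \<in> Units R" "b \<in> Units R"
    "length \<omega>s + length xs + length ys = n"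
  shows "bloch_sum n \<omega>s (xs @ (a \<otimes> b) # ys) =
    bloch_sum n \<omega>s (xs @ a # ys) \<oplus>\<^bsub>forms R n\<^esub> bloch_sum n \<omega>s (xs @ b # ys)"
  using assms
proof (induction xs arbitrary: \<omega>s)
  case Nil
  let ?W = "form_wedge R (\<omega>s @ map (dlog R) ys)"
  have Wc: "?W \<in> carrier (forms R n)"
    using Nil dlogs_closed[of ys] by (intro form_wedge_closed) simp
  have bc: "bloch_sum n (\<omega>s @ [z]) ys \<in> carrier (forms R n)" if "z \<in> carrier (kahler R)" for z
    using Nil that by (intro bloch_sum_closed) simp_all
  have "dlog R (\<sigma> (a \<otimes> b)) = dlog R (\<sigma> a) \<oplus>\<^bsub>kahler R\<^esub> dlog R (\<sigma> b)"
    using Nil by (simp add: \<sigma>_mult Units_closed dlog_mult \<sigma>_Units)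
  then have "bloch_sum n (\<omega>s @ [dlog R (\<sigma> (a \<otimes> b))]) ys =
      bloch_sum n (\<omega>s @ [dlog R (\<sigma> a)]) ys \<oplus>\<^bsub>forms R n\<^esub> bloch_sum n (\<omega>s @ [dlog R (\<sigma> b)]) ys"
    using bloch_sum_add_form[of \<omega>s "[]" ys "dlog R (\<sigma> a)" "dlog R (\<sigma> b)" n] Nil by (simp add: dlog_\<sigma>_closed)
  then show ?case
    using Nil Wc bc[of "dlog R (\<sigma> a)"] bc[of "dlog R (\<sigma> b)"]
    by (simp add: split_log_mult W.smult_l_distr W.M.minus_eq W.M.minus_add W.M.a_ac dlog_\<sigma>_closed)
next
  case (Cons r xs)
  let ?W = "\<lambda>c. form_wedge R (\<omega>s @ map (dlog R) (xs @ c # ys))"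
  let ?B = "\<lambda>c. bloch_sum n (\<omega>s @ [dlog R (\<sigma> r)]) (xs @ c # ys)"
  have ds: "set (map (dlog R) xs) \<subseteq> carrier (kahler R)" "set (map (dlog R) ys) \<subseteq> carrier (kahler R)"
    using Cons.prems dlogs_closed by simp_all
  have Wc: "?W c \<in> carrier (forms R n)" if "c \<in> Units R" for c
    using Cons.prems ds that by (intro form_wedge_closed) simp
  have bc: "?B c \<in> carrier (forms R n)" if "c \<in> Units R" for c
    using Cons.prems that by (intro bloch_sum_closed) (simp_all add: dlog_\<sigma>_closed)
  have 1: "?W (a \<otimes> b) = ?W a \<oplus>\<^bsub>forms R n\<^esub> ?W b"
    using form_wedge_add[of "\<omega>s @ map (dlog R) xs" "map (dlog R) ys" n "dlog R a" "dlog R b"] Cons.prems ds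
    by (simp add: dlog_mult)
  have 2: "?B (a \<otimes> b) = ?B a \<oplus>\<^bsub>forms R n\<^esub> ?B b"
    using Cons.prems by (intro Cons.IH) (simp_all add: dlog_\<sigma>_closed)
  have rc: "split_log r \<in> carrier R" using Cons.prems by simp
  have "split_log r \<odot>\<^bsub>forms R n\<^esub> (?W a \<oplus>\<^bsub>forms R n\<^esub> ?W b) \<ominus>\<^bsub>forms R n\<^esub> (?B a \<oplus>\<^bsub>forms R n\<^esub> ?B b) =
    (split_log r \<odot>\<^bsub>forms R n\<^esub> ?W a \<ominus>\<^bsub>forms R n\<^esub> ?B a) \<oplus>\<^bsub>forms R n\<^esub>
    (split_log r \<odot>\<^bsub>forms R n\<^esub> ?W b \<ominus>\<^bsub>forms R n\<^esub> ?B b)"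
    using rc Wc[of a] Wc[of b] bc[of a] bc[of b] Cons.prems(4,5)
    by (simp add: W.smult_r_distr W.M.minus_eq W.M.minus_add W.M.a_ac)
  then show ?case using 1 2 by simp
qed

lemma form_wedge_steinberg:
  assumes "a \<in> Units R" "\<one> \<ominus> a \<in> Units R" "set \<omega>s \<subseteq> carrier (kahler R)" "set \<eta>s \<subseteq> carrier (kahler R)"
    "length \<omega>s + length \<eta>s + 2 = n"
  shows "form_wedge R (\<omega>s @ dlog R a # dlog R (\<one> \<ominus> a) # \<eta>s) = \<zero>\<^bsub>forms R n\<^esub>"
proof -
  let ?da = "kahler_d R a" and ?v = "inv (\<one> \<ominus> a)"
  have c: "a \<in> carrier R" "inv a \<in> carrier R" "?v \<in> carrier R" using assms by auto
  have "kahler_d R (\<one> \<ominus> a) = \<ominus>\<^bsub>kahler R\<^esub> ?da"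
    unfolding minus_eq using c by (simp add: kahler_d_add kahler_d_one kahler_d_minus)
  then have d: "dlog R (\<one> \<ominus> a) = (\<ominus> ?v) \<odot>\<^bsub>kahler R\<^esub> ?da"
    unfolding dlog_def using c by (simp add: K.smult_l_minus K.smult_r_minus)
  have "form_wedge R (\<omega>s @ ?da # ?da # \<eta>s) = \<zero>\<^bsub>forms R n\<^esub>"
    using assms c by (intro form_wedge_not_distinct) simp_all
  moreover have "form_wedge R (\<omega>s @ ?da # (\<ominus> ?v) \<odot>\<^bsub>kahler R\<^esub> ?da # \<eta>s) =
      (\<ominus> ?v) \<odot>\<^bsub>forms R n\<^esub> form_wedge R (\<omega>s @ ?da # ?da # \<eta>s)"
    using form_wedge_smult[of "\<omega>s @ [?da]" \<eta>s n "\<ominus> ?v" ?da] assms c by simp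
  moreover have "form_wedge R (\<omega>s @ dlog R a # (\<ominus> ?v) \<odot>\<^bsub>kahler R\<^esub> ?da # \<eta>s) =
      inv a \<odot>\<^bsub>forms R n\<^esub> form_wedge R (\<omega>s @ ?da # (\<ominus> ?v) \<odot>\<^bsub>kahler R\<^esub> ?da # \<eta>s)"
    using form_wedge_smult[of \<omega>s "(\<ominus> ?v) \<odot>\<^bsub>kahler R\<^esub> ?da # \<eta>s" n "inv a" ?da] assms c
    by (simp add: dlog_def)
  ultimately show ?thesis unfolding d using c by simp
qed

text \<open>A summand for a position before the pair \<open>r, 1 - r\<close> contains \<open>dlog r \<and> dlog(1 - r)\<close>, and one for
  a position after it contains \<open>dlog \<sigma>(r) \<and> dlog \<sigma>(1 - r)\<close>; the former are removed by induction. The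
  two summands of the pair itself combine to a product with \<open>df\<close> as one of its factors.\<close>

lemma bloch_sum_steinberg:
  assumes "set as \<subseteq> Units R" "set xs \<subseteq> Units R" "set ys \<subseteq> Units R" "r \<in> Units R" "\<one> \<ominus> r \<in> Units R"
    "length as + length xs + length ys + 1 = n"
  shows "bloch_sum n (map (dlog R) as) (xs @ r # (\<one> \<ominus> r) # ys) \<in> exact_rel R I n"
  using assms
proof (induction xs arbitrary: as)
  case Nil
  obtain m where m: "n = Suc m" "length as + length ys = m" using Nil by auto
  let ?A = "map (dlog R) as" and ?C = "map (dlog R) ys" and ?r' = "\<one> \<ominus> r"
  have ds: "set ?A \<subseteq> carrier (kahler R)" "set ?C \<subseteq> carrier (kahler R)"
    using Nil dlogs_closed by simp_all
  obtain f where f: "f \<in> I" and df: "kahler_d R f = split_log r \<odot>\<^bsub>kahler R\<^esub> dlog R ?r'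
      \<ominus>\<^bsub>kahler R\<^esub> split_log ?r' \<odot>\<^bsub>kahler R\<^esub> dlog R (\<sigma> r)"
    using steinberg_split_log_exact Nil by blast
  have rc: "r \<in> carrier R" using Nil by auto
  have \<sigma>r': "\<sigma> ?r' = \<one> \<ominus> \<sigma> r"
  proof -
    have "\<sigma> ?r' \<oplus> \<sigma> r = \<sigma> (?r' \<oplus> r)" using rc by (simp add: \<sigma>_add)
    also have "?r' \<oplus> r = \<one>" using rc by (simp add: minus_eq a_assoc l_neg)
    finally have "\<one> \<ominus> \<sigma> r = (\<sigma> ?r' \<oplus> \<sigma> r) \<ominus> \<sigma> r" by (simp add: \<sigma>_one)
    then show ?thesis using rc by (simp add: minus_eq a_assoc r_neg)
  qed
  let ?w = "\<lambda>u. form_wedge R (?A @ u # ?C)"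
  have wc: "?w u \<in> carrier (forms R n)" if "u \<in> carrier (kahler R)" for u
    using that ds m by (intro form_wedge_closed) simp
  have zero: "bloch_sum n (?A @ [dlog R (\<sigma> r), dlog R (\<sigma> ?r')]) ys = \<zero>\<^bsub>forms R n\<^esub>"
  proof (rule bloch_sum_zero)
    fix \<eta>s assume "set \<eta>s \<subseteq> carrier (kahler R)" "length (?A @ [dlog R (\<sigma> r), dlog R (\<sigma> ?r')]) + length \<eta>s = n"
    then show "form_wedge R ((?A @ [dlog R (\<sigma> r), dlog R (\<sigma> ?r')]) @ \<eta>s) = \<zero>\<^bsub>forms R n\<^esub>"
      using form_wedge_steinberg[of "\<sigma> r" ?A \<eta>s n] \<sigma>_Units[OF Nil(4)] \<sigma>_Units[OF Nil(5)] ds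
      by (simp add: \<sigma>r')
  qed (use Nil in simp_all)
  define u v where "u = split_log r" and "v = split_log ?r'"
  have uv: "u \<in> carrier R" "v \<in> carrier R" unfolding u_def v_def using Nil by simp_all
  define \<alpha> \<beta> where "\<alpha> = dlog R ?r'" and "\<beta> = dlog R (\<sigma> r)"
  have \<alpha>\<beta>: "\<alpha> \<in> carrier (kahler R)" "\<beta> \<in> carrier (kahler R)"
    unfolding \<alpha>_def \<beta>_def using Nil by (simp_all add: dlog_\<sigma>_closed)
  have "bloch_sum n ?A ([] @ r # ?r' # ys) =
      u \<odot>\<^bsub>forms R n\<^esub> ?w \<alpha> \<ominus>\<^bsub>forms R n\<^esub> (v \<odot>\<^bsub>forms R n\<^esub> ?w \<beta> \<ominus>\<^bsub>forms R n\<^esub> \<zero>\<^bsub>forms R n\<^esub>)"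
    using zero by (simp add: u_def v_def \<alpha>_def \<beta>_def)
  also have "\<dots> = u \<odot>\<^bsub>forms R n\<^esub> ?w \<alpha> \<oplus>\<^bsub>forms R n\<^esub> (\<ominus> v) \<odot>\<^bsub>forms R n\<^esub> ?w \<beta>"
    using uv wc[OF \<alpha>\<beta>(1)] wc[OF \<alpha>\<beta>(2)] W.M.diff_eq_zero_iff
    by (simp add: W.M.minus_eq W.smult_l_minus W.M.minus_add W.M.r_neg)
  also have "\<dots> = ?w (u \<odot>\<^bsub>kahler R\<^esub> \<alpha>) \<oplus>\<^bsub>forms R n\<^esub> ?w ((\<ominus> v) \<odot>\<^bsub>kahler R\<^esub> \<beta>)"
    using form_wedge_smult[of ?A ?C n u \<alpha>] form_wedge_smult[of ?A ?C n "\<ominus> v" \<beta>] m ds uv \<alpha>\<beta> by simp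
  also have "\<dots> = ?w (u \<odot>\<^bsub>kahler R\<^esub> \<alpha> \<oplus>\<^bsub>kahler R\<^esub> (\<ominus> v) \<odot>\<^bsub>kahler R\<^esub> \<beta>)"
    using form_wedge_add[of ?A ?C n "u \<odot>\<^bsub>kahler R\<^esub> \<alpha>" "(\<ominus> v) \<odot>\<^bsub>kahler R\<^esub> \<beta>"] m ds uv \<alpha>\<beta> by simp
  also have "u \<odot>\<^bsub>kahler R\<^esub> \<alpha> \<oplus>\<^bsub>kahler R\<^esub> (\<ominus> v) \<odot>\<^bsub>kahler R\<^esub> \<beta> = kahler_d R f"
    unfolding df using uv \<alpha>\<beta> by (simp add: K.smult_l_minus K.M.minus_eq u_def v_def \<alpha>_def \<beta>_def)
  also have "?w (kahler_d R f) \<in> exact_rel R I n"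
    unfolding m(1) using f Nil m(2) by (intro wedge_d_exact) simp_all
  finally show ?case .
next
  case (Cons s xs)
  let ?zs = "xs @ r # (\<one> \<ominus> r) # ys"
  have "form_wedge R ((map (dlog R) as @ map (dlog R) xs) @ dlog R r # dlog R (\<one> \<ominus> r) # map (dlog R) ys) = \<zero>\<^bsub>forms R n\<^esub>"
    using Cons.prems dlogs_closed[of as] dlogs_closed[of xs] dlogs_closed[of ys]
    by (intro form_wedge_steinberg) simp_all
  moreover have IH: "bloch_sum n (map (dlog R) (as @ [\<sigma> s])) ?zs \<in> exact_rel R I n"
    using Cons.prems by (intro Cons.IH) (simp_all add: \<sigma>_Units)
  moreover have "bloch_sum n (map (dlog R) (as @ [\<sigma> s])) ?zs \<in> carrier (forms R n)"
    using IH exact_rel_subset forms_rel_carrier by blast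
  ultimately show ?case
    using Cons.prems exact_rel_minus[OF IH] by (simp add: W.M.minus_eq)
qed

text \<open>Summands after \<open>1 + x\<close> vanish since \<open>\<sigma>(1 + x) = 1\<close>. For a first entry \<open>r\<close>, its summand is
  \<open>\<lambda>(r) dL\<close> times the rest, with \<open>L = log(1 + x)\<close>, and the induction hypothesis gives \<open>- L dlog \<sigma>(r)\<close>
  times the rest, up to a common sign. Modulo the differential of \<open>\<lambda>(r) L\<close> times the rest they add up to
  \<open>- L (d\<lambda>(r) + dlog \<sigma>(r))\<close>, which is \<open>- L dlog r\<close>.\<close>

lemma bloch_sum_one_plus:
  assumes "set as \<subseteq> Units R" "set xs \<subseteq> Units R" "set ys \<subseteq> Units R" and x: "x \<in> I"
    and "length as + length xs + length ys = n"
  shows "\<exists>e\<in>exact_rel R I n. bloch_sum n (map (dlog R) as) (xs @ (\<one> \<oplus> x) # ys) =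
    ((\<ominus> \<one>) [^] length xs \<otimes> nil_log R N x) \<odot>\<^bsub>forms R n\<^esub> form_wedge R (map (dlog R) (as @ xs @ ys))
    \<oplus>\<^bsub>forms R n\<^esub> e"
  using assms(1-3,5)
proof (induction xs arbitrary: as)
  case Nil
  let ?A = "map (dlog R) as" and ?C = "map (dlog R) ys"
  have ds: "set ?A \<subseteq> carrier (kahler R)" "set ?C \<subseteq> carrier (kahler R)"
    using Nil dlogs_closed by simp_all
  have Lc: "nil_log R N x \<in> carrier R" using nil_log_in_ideal[OF x] by simp
  have wc: "form_wedge R (?A @ ?C) \<in> carrier (forms R n)" using Nil ds by (intro form_wedge_closed) simp
  have "bloch_sum n (?A @ [\<zero>\<^bsub>kahler R\<^esub>]) ys = \<zero>\<^bsub>forms R n\<^esub>"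
  proof (rule bloch_sum_zero)
    fix \<eta>s assume \<eta>: "set \<eta>s \<subseteq> carrier (kahler R)" "length (?A @ [\<zero>\<^bsub>kahler R\<^esub>]) + length \<eta>s = n"
    have "form_wedge R (?A @ \<zero>\<^bsub>kahler R\<^esub> # \<eta>s) \<in> carrier (forms R n)"
      using \<eta> ds by (intro form_wedge_closed) simp
    then show "form_wedge R ((?A @ [\<zero>\<^bsub>kahler R\<^esub>]) @ \<eta>s) = \<zero>\<^bsub>forms R n\<^esub>"
      using form_wedge_smult[of ?A \<eta>s n \<zero> "\<zero>\<^bsub>kahler R\<^esub>"] \<eta> ds by simp
  qed (use Nil in simp_all)
  then have "bloch_sum n ?A ([] @ (\<one> \<oplus> x) # ys) =
      ((\<ominus> \<one>) [^] length [] \<otimes> nil_log R N x) \<odot>\<^bsub>forms R n\<^esub> form_wedge R (map (dlog R) (as @ [] @ ys))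
      \<oplus>\<^bsub>forms R n\<^esub> (\<ominus>\<^bsub>forms R n\<^esub> \<zero>\<^bsub>forms R n\<^esub>)"
    using Lc wc by (simp add: split_log_one_plus[OF x] dlog_one W.M.minus_eq)
  then show ?case using exact_rel_minus[OF exact_rel_zero] by blast
next
  case (Cons r xs)
  obtain m where m: "n = Suc m" "length as + length xs + length ys = m" using Cons.prems by auto
  let ?A = "map (dlog R) as" and ?X = "map (dlog R) xs" and ?C = "map (dlog R) ys"
  have ds: "set ?A \<subseteq> carrier (kahler R)" "set ?X \<subseteq> carrier (kahler R)" "set ?C \<subseteq> carrier (kahler R)"
    using Cons.prems dlogs_closed by simp_all
  define s L l where "s = (\<ominus> \<one>) [^] length xs" and "L = nil_log R N x" and "l = split_log r"
  have LI: "L \<in> I" unfolding L_def by (rule nil_log_in_ideal[OF x])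
  have c: "s \<in> carrier R" "L \<in> carrier R" "l \<in> carrier R" "r \<in> Units R"
    unfolding s_def l_def using LI Cons.prems by simp_all
  have dL: "dlog R (\<one> \<oplus> x) = kahler_d R L"
    unfolding L_def using x by (intro kahler_d_nil_log[symmetric] N ideal_pow_zero nat_unit one_plus_Units) auto
  let ?w = "\<lambda>u. form_wedge R (?A @ u # ?X @ ?C)"
  have wc: "?w u \<in> carrier (forms R n)" if "u \<in> carrier (kahler R)" for u
    using that ds m by (intro form_wedge_closed) simp
  have wa: "?w (u \<oplus>\<^bsub>kahler R\<^esub> v) = ?w u \<oplus>\<^bsub>forms R n\<^esub> ?w v"
    if "u \<in> carrier (kahler R)" "v \<in> carrier (kahler R)" for u v
    using form_wedge_add[of ?A "?X @ ?C" n u v] that ds m by simp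
  have ws: "?w (a \<odot>\<^bsub>kahler R\<^esub> u) = a \<odot>\<^bsub>forms R n\<^esub> ?w u"
    if "u \<in> carrier (kahler R)" "a \<in> carrier R" for u a
    using form_wedge_smult[of ?A "?X @ ?C" n a u] that ds m by simp
  obtain e where e: "e \<in> exact_rel R I n" and IH: "bloch_sum n (map (dlog R) (as @ [\<sigma> r])) (xs @ (\<one> \<oplus> x) # ys) =
      (s \<otimes> L) \<odot>\<^bsub>forms R n\<^esub> form_wedge R (map (dlog R) ((as @ [\<sigma> r]) @ xs @ ys)) \<oplus>\<^bsub>forms R n\<^esub> e"
    using Cons.IH[of "as @ [\<sigma> r]"] Cons.prems \<sigma>_Units[OF c(4)] unfolding s_def L_def by auto
  have ec: "e \<in> carrier (forms R n)" using e exact_rel_subset forms_rel_carrier by blast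
  define \<alpha> \<delta>L \<delta>l where "\<alpha> = dlog R (\<sigma> r)" and "\<delta>L = kahler_d R L" and "\<delta>l = kahler_d R l"
  have \<alpha>: "\<alpha> \<in> carrier (kahler R)" "\<delta>L \<in> carrier (kahler R)" "\<delta>l \<in> carrier (kahler R)"
    unfolding \<alpha>_def \<delta>L_def \<delta>l_def using c by (simp_all add: dlog_\<sigma>_closed)
  have dr: "dlog R r = \<alpha> \<oplus>\<^bsub>kahler R\<^esub> \<delta>l" unfolding \<alpha>_def \<delta>l_def l_def by (rule dlog_split[OF c(4)])
  have move: "form_wedge R (?A @ ?X @ \<delta>L # ?C) = s \<odot>\<^bsub>forms R n\<^esub> ?w \<delta>L"
    unfolding s_def using form_wedge_move[of ?A ?X ?C n \<delta>L] ds m \<alpha> by simp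
  have exact: "(s \<otimes> l) \<odot>\<^bsub>forms R n\<^esub> ?w \<delta>L \<oplus>\<^bsub>forms R n\<^esub> (s \<otimes> L) \<odot>\<^bsub>forms R n\<^esub> ?w \<delta>l \<in> exact_rel R I n"
  proof -
    have "s \<otimes> (l \<otimes> L) \<in> I" using LI c by (intro I.I_l_closed)
    then have "form_wedge R (?A @ kahler_d R (s \<otimes> (l \<otimes> L)) # map (dlog R) (xs @ ys)) \<in> exact_rel R I n"
      unfolding m(1) using Cons.prems m(2) by (intro wedge_d_exact) simp_all
    moreover have "kahler_d R (s \<otimes> (l \<otimes> L)) =
        (s \<otimes> l) \<odot>\<^bsub>kahler R\<^esub> \<delta>L \<oplus>\<^bsub>kahler R\<^esub> (s \<otimes> L) \<odot>\<^bsub>kahler R\<^esub> \<delta>l"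
      using c \<alpha> kahler_d_const_mult[of s "l \<otimes> L"] kahler_d_sign[of "length xs"] unfolding s_def[symmetric]
      by (simp add: kahler_d_mult[of l L] K.smult_r_distr K.smult_assoc1 \<delta>L_def[symmetric] \<delta>l_def[symmetric])
    ultimately show ?thesis using c \<alpha> by (simp add: wa ws)
  qed
  define E where "E = ((s \<otimes> l) \<odot>\<^bsub>forms R n\<^esub> ?w \<delta>L \<oplus>\<^bsub>forms R n\<^esub> (s \<otimes> L) \<odot>\<^bsub>forms R n\<^esub> ?w \<delta>l) \<oplus>\<^bsub>forms R n\<^esub> (\<ominus>\<^bsub>forms R n\<^esub> e)"
  have E: "E \<in> exact_rel R I n" unfolding E_def by (intro exact_rel_add exact exact_rel_minus e)
  define P Q T where "P = (s \<otimes> l) \<odot>\<^bsub>forms R n\<^esub> ?w \<delta>L" and "Q = (s \<otimes> L) \<odot>\<^bsub>forms R n\<^esub> ?w \<delta>l"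
    and "T = (s \<otimes> L) \<odot>\<^bsub>forms R n\<^esub> ?w \<alpha>"
  have PQT: "P \<in> carrier (forms R n)" "Q \<in> carrier (forms R n)" "T \<in> carrier (forms R n)"
    unfolding P_def Q_def T_def using c wc[OF \<alpha>(1)] wc[OF \<alpha>(2)] wc[OF \<alpha>(3)] by simp_all
  have "bloch_sum n ?A ((r # xs) @ (\<one> \<oplus> x) # ys) =
      l \<odot>\<^bsub>forms R n\<^esub> form_wedge R (?A @ ?X @ \<delta>L # ?C) \<ominus>\<^bsub>forms R n\<^esub>
      bloch_sum n (map (dlog R) (as @ [\<sigma> r])) (xs @ (\<one> \<oplus> x) # ys)"
    by (simp add: l_def \<delta>L_def dL)
  also have "\<dots> = P \<ominus>\<^bsub>forms R n\<^esub> (T \<oplus>\<^bsub>forms R n\<^esub> e)"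
    unfolding IH move P_def T_def using c wc[OF \<alpha>(2)] by (simp add: W.smult_assoc1[symmetric] m_comm \<alpha>_def)
  also have "\<dots> = (\<ominus>\<^bsub>forms R n\<^esub> (T \<oplus>\<^bsub>forms R n\<^esub> Q)) \<oplus>\<^bsub>forms R n\<^esub> ((P \<oplus>\<^bsub>forms R n\<^esub> Q) \<oplus>\<^bsub>forms R n\<^esub> (\<ominus>\<^bsub>forms R n\<^esub> e))"
  proof -
    have "(\<ominus>\<^bsub>forms R n\<^esub> (T \<oplus>\<^bsub>forms R n\<^esub> Q)) \<oplus>\<^bsub>forms R n\<^esub> ((P \<oplus>\<^bsub>forms R n\<^esub> Q) \<oplus>\<^bsub>forms R n\<^esub> (\<ominus>\<^bsub>forms R n\<^esub> e))
        = (P \<oplus>\<^bsub>forms R n\<^esub> (\<ominus>\<^bsub>forms R n\<^esub> T \<oplus>\<^bsub>forms R n\<^esub> \<ominus>\<^bsub>forms R n\<^esub> e)) \<oplus>\<^bsub>forms R n\<^esub> (Q \<oplus>\<^bsub>forms R n\<^esub> \<ominus>\<^bsub>forms R n\<^esub> Q)"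
      using PQT ec by (simp only: W.M.minus_add W.M.a_ac W.M.a_closed W.M.a_inv_closed)
    then show ?thesis using PQT ec by (simp add: W.M.minus_eq W.M.minus_add W.M.r_neg)
  qed
  also have "T \<oplus>\<^bsub>forms R n\<^esub> Q = (s \<otimes> L) \<odot>\<^bsub>forms R n\<^esub> ?w (dlog R r)"
    unfolding dr T_def Q_def using c \<alpha> wc by (simp add: wa W.smult_r_distr)
  also have "\<ominus>\<^bsub>forms R n\<^esub> ((s \<otimes> L) \<odot>\<^bsub>forms R n\<^esub> ?w (dlog R r)) = ((\<ominus> \<one>) [^] length (r # xs) \<otimes> L) \<odot>\<^bsub>forms R n\<^esub>
      form_wedge R (map (dlog R) (as @ (r # xs) @ ys))"
  proof -
    have "(\<ominus> \<one>) [^] length (r # xs) \<otimes> L = \<ominus> (s \<otimes> L)" using c by (simp add: s_def[symmetric] r_minus l_minus)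
    then show ?thesis using c wc[of "dlog R r"] by (simp add: W.smult_l_minus)
  qed
  finally show ?case using E unfolding E_def P_def Q_def L_def by blast
qed

theorem Bloch_map_exists: "\<exists>B. is_Bloch_map R I N n B"
proof -
  let ?G = "forms_rel_group R I n Mod exact_rel R I n"
  let ?cl = "\<lambda>x. exact_rel R I n #>\<^bsub>forms_rel_group R I n\<^esub> x"
  let ?\<beta> = "\<lambda>rs. ?cl (bloch_sum n [] rs)"
  have b_rel: "bloch_sum n [] rs \<in> forms_rel R I n" if "rs \<in> tuples (Units R) (n + 1)" for rs
    using that by (intro bloch_sum_forms_rel) (simp_all add: tuples_def)
  obtain B where B: "B \<in> hom (milnor_K R (n + 1)) ?G"
    and B_symbol: "\<And>rs. rs \<in> tuples (Units R) (n + 1) \<Longrightarrow> B (milnor_symbol R rs) = ?\<beta> rs"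
  proof (rule milnor_K_universal[OF is_cring forms_quotient_comm_group, of "n + 1" ?\<beta> n])
    show "?\<beta> rs \<in> carrier ?G" if "rs \<in> tuples (Units R) (n + 1)" for rs
      by (rule form_class_closed[OF b_rel[OF that]])
  next
    fix xs a b ys
    assume w: "length xs + length ys + 1 = n + 1" "set xs \<subseteq> Units R" "set ys \<subseteq> Units R"
      "a \<in> Units R" "b \<in> Units R"
    then show "?\<beta> (xs @ (a \<otimes> b) # ys) = ?\<beta> (xs @ a # ys) \<otimes>\<^bsub>?G\<^esub> ?\<beta> (xs @ b # ys)"
      using b_rel[of "xs @ a # ys"] b_rel[of "xs @ b # ys"] bloch_sum_mult[of "[]" xs ys a b n]
      by (simp add: form_class_add)
  next
    fix xs r ys
    assume w: "length xs + length ys + 2 = n + 1" "set xs \<subseteq> Units R" "set ys \<subseteq> Units R"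
      "r \<in> Units R" "\<one> \<ominus> r \<in> Units R"
    then show "?\<beta> (xs @ [r, \<one> \<ominus> r] @ ys) = \<one>\<^bsub>?G\<^esub>"
      using bloch_sum_steinberg[of "[]" xs ys r n] by (intro form_class_exact) simp
  qed blast
  \<comment> \<open>The map is defined on the whole Milnor K-group; restricting it to the kernel of reduction
    modulo \<open>I\<close> is enough.\<close>
  have "B \<in> hom (milnor_K_rel R I (n + 1)) ?G"
    using B unfolding milnor_K_rel_def by (auto simp: hom_def kernel_def)
  moreover have "B (milnor_symbol R (take i rs @ (\<one> \<oplus> x) # drop i rs)) =
      ?cl (((\<ominus> \<one>) [^] i \<otimes> nil_log R N x) \<odot>\<^bsub>forms R n\<^esub> form_wedge R (map (dlog R) rs))"
    if i: "i \<le> n" and rs: "rs \<in> tuples (Units R) n" and x: "x \<in> I" for i rs x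
  proof -
    have len: "length rs = n" and units: "set rs \<subseteq> Units R" using rs by (simp_all add: tuples_def)
    have td: "set (take i rs) \<subseteq> Units R" "set (drop i rs) \<subseteq> Units R"
      using units set_take_subset[of i rs] set_drop_subset[of i rs] by auto
    have t: "take i rs @ (\<one> \<oplus> x) # drop i rs \<in> tuples (Units R) (n + 1)"
      using td one_plus_Units[OF x] len i by simp
    obtain e where e: "e \<in> exact_rel R I n" and "bloch_sum n (map (dlog R) []) (take i rs @ (\<one> \<oplus> x) # drop i rs) =
        ((\<ominus> \<one>) [^] length (take i rs) \<otimes> nil_log R N x) \<odot>\<^bsub>forms R n\<^esub>
        form_wedge R (map (dlog R) ([] @ take i rs @ drop i rs)) \<oplus>\<^bsub>forms R n\<^esub> e"
      using bloch_sum_one_plus[of "[]" "take i rs" "drop i rs" x n] td x len i by auto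
    then have b: "bloch_sum n [] (take i rs @ (\<one> \<oplus> x) # drop i rs) =
        ((\<ominus> \<one>) [^] i \<otimes> nil_log R N x) \<odot>\<^bsub>forms R n\<^esub> form_wedge R (map (dlog R) rs) \<oplus>\<^bsub>forms R n\<^esub> e"
      using len i by (simp add: min_absorb2)
    have "((\<ominus> \<one>) [^] i \<otimes> nil_log R N x) \<odot>\<^bsub>forms R n\<^esub> form_wedge R (map (dlog R) rs) \<in> forms_rel R I n"
      using nil_log_in_ideal[OF x] rs
      by (intro smult_in_forms_rel I.I_l_closed form_wedge_closed map_in_tuples[OF dlog_closed]) simp_all
    then show ?thesis unfolding B_symbol[OF t] b using e by (rule form_class_add_exact)
  qed
  ultimately show ?thesis unfolding is_Bloch_map_def by blast
qed

end

theorem theorem2p10: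
  fixes R :: "('a, 'm) ring_scheme" (structure) and I :: "'a set" and N n :: nat
  assumes "cring R"
    and "ideal I R"
    and "N \<ge> 1"
    and "I [^]\<^bsub>ideals_set R\<^esub> N = {\<zero>}"
    and "\<exists>s \<in> ring_hom (R Quot I) R. \<forall>X \<in> carrier (R Quot I). I +> s X = X"
    and "add_pow R (fact N :: nat) \<one> \<in> Units R"
  shows "\<exists>B. is_Bloch_map R I N n B"
proof -
  interpret cring R by (rule assms(1))
  interpret I: ideal I R by (rule assms(2))
  obtain s where s: "s \<in> ring_hom (R Quot I) R" and sec: "\<And>X. X \<in> carrier (R Quot I) \<Longrightarrow> I +> s X = X"
    using assms(5) by blast
  let ?\<sigma> = "\<lambda>r. s (I +> r)"
  have unit_dvd: "add_pow R k \<one> \<in> Units R" if k: "k dvd (fact N :: nat)" for k :: nat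
  proof -
    obtain m where m: "fact N = k * m" using k by (auto simp: dvd_def)
    define u v where "u = add_pow R k \<one>" and "v = add_pow R m \<one>"
    have c: "u \<in> carrier R" "v \<in> carrier R" unfolding u_def v_def by simp_all
    have uv: "u \<otimes> v \<in> Units R"
      using assms(6) unfolding m nat_mult_one u_def v_def .
    have "u \<otimes> (v \<otimes> inv (u \<otimes> v)) = \<one>" using c uv by (simp add: m_assoc[symmetric])
    moreover from this have "(v \<otimes> inv (u \<otimes> v)) \<otimes> u = \<one>" using c uv by (simp add: m_comm)
    moreover have "v \<otimes> inv (u \<otimes> v) \<in> carrier R" using c uv by simp
    ultimately have "u \<in> Units R" using c unfolding Units_def by blast
    then show ?thesis unfolding u_def .
  qed
  have "split_nilpotent R I N ?\<sigma>"
  proof (intro split_nilpotent.intro ideal_in_cring.intro ideal_in_cring_axioms.intro split_nilpotent_axioms.intro)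
    show "cring R" "ideal I R" "N \<ge> 1" "I [^]\<^bsub>ideals_set R\<^esub> N = {\<zero>}" by fact+
    show "add_pow R k \<one> \<in> Units R" if "1 \<le> k" "k \<le> N" for k :: nat
      using that by (intro unit_dvd dvd_fact)
    show "add_pow R (fact (N - 1) :: nat) \<one> \<in> Units R"
      by (intro unit_dvd fact_dvd) simp
    show "?\<sigma> \<in> ring_hom R R"
      using ring_hom_trans[OF I.rcos_ring_hom s] by (simp add: comp_def)
    show "?\<sigma> x = \<zero>" if "x \<in> I" for x
    proof -
      have "I +> x = \<zero>\<^bsub>R Quot I\<^esub>" using that by (simp add: FactRing_def I.a_rcos_const)
      then show ?thesis
        using ring_hom_zero[OF s I.quotient_is_ring ring_axioms] by simp
    qed
    show "r \<ominus> ?\<sigma> r \<in> I" if r: "r \<in> carrier R" for r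
    proof -
      have q: "I +> r \<in> carrier (R Quot I)" using r by (simp add: FactRing_def a_rcosetsI I.a_subset)
      have c: "?\<sigma> r \<in> carrier R" using ring_hom_closed[OF s q] .
      have "r \<in> I +> ?\<sigma> r" unfolding sec[OF q] by (rule I.a_rcos_self[OF r])
      then show ?thesis using I.a_rcos_module_minus[OF ring_axioms c r] by simp
    qed
  qed
  then show ?thesis by (rule split_nilpotent.Bloch_map_exists)
qed

end
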